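(* Let $K$ be a field and $Q$ a finite quiver, let $\mathfrak{M}_Q$ be the adjacency matrix of $Q$, and let $J$ be the ideal of the path algebra $KQ$ generated by all the arrows. The following algebras have only trivial $0$-Igusa-Todorov subcategories: (1) $A=KQ/J^2$, whenever $A$ is a non-selfinjective radical square zero algebra such that $Q$ is strongly connected and $\mathfrak{M}_Q$ is not invertible; (2) the truncated path algebra $A=KQ/J^k$ ($k\ge2$), whenever $Q$ is strongly connected with at least one loop and $\mathfrak{M}_Q$ is not invertible.
   Context: A quiver $Q$ is strongly connected if for every two vertices $v_1,v_2$ there is a path in $Q$ from $v_1$ to $v_2$. For an Artin algebra $A$, $\operatorname{mod}A$ is the category of finitely generated right $A$-modules, and $\mathcal{P}_A$ is the class of projective modules in it; subcategories are full and closed under isomorphism. $\Omega(M)$ is the syzygy of $M$ (kernel of a projective cover). $\operatorname{add}$ denotes closure under finite direct sums and direct summands. $K_0(A)$ is the abelian group generated by symbols $[M]$, $M\in\operatorname{mod}A$, modulo $[M]-[M']-[M'']$ if $M\cong M'\oplus M''$, and $[P]$ for $P$ projective. $\bar\Omega:K_0(A)\to K_0(A)$ is the endomorphism $[M]\mapsto[\Omega(M)]$. $\langle M\rangle\subset K_0(A)$ is the subgroup generated by the classes of modules in $\operatorname{add}M$. The Igusa-Todorov function is $\phi(M)=\min\{k\ge 0:\bar\Omega:\bar\Omega^m\langle M\rangle\to\bar\Omega^{m+1}\langle M\rangle \text{ is an isomorphism for all } m\ge k\}$, and $\phi\dim(\mathcal{C})=\sup\{\phi(M):M\in\mathcal{C}\}$.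 A subcategory $\mathcal{D}\subset\operatorname{mod}A$ is a $0$-Igusa-Todorov subcategory if $\mathcal{D}=\operatorname{add}(\mathcal{D})$, $\Omega(\mathcal{D})\subset\mathcal{D}$ and $\phi\dim(\mathcal{D})=0$. The algebra $A$ has only trivial $0$-Igusa-Todorov subcategories if every $0$-Igusa-Todorov subcategory $\mathcal{D}$ of $\operatorname{mod}A$ satisfies $\mathcal{D}\subset\mathcal{P}_A$. *)

theory Defs
  imports
    "HOL-Algebra.QuotRing"
    "HOL-Algebra.Ideal_Product"
    "HOL-Algebra.Free_Abelian_Groups"
    "HOL-Library.Extended_Nat"
    "HOL-Library.Poly_Mapping"
    "Graph_Theory.Digraph_Component"
    "Graph_Theory.Arc_Walk"
    "Jordan_Normal_Form.Matrix"
begin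

section \<open>Right modules over a ring\<close>

text \<open>The fields \<open>mult\<close> and \<open>one\<close> inherited from \<open>ring\<close> carry no meaning here,
  as for the library's record \<open>module\<close>.\<close>

record ('a, 'm) rmodule = "'m ring" +
  ract :: "['m, 'a] \<Rightarrow> 'm" (infixl \<open>\<odot>r\<index>\<close> 70)

locale right_module = R?: ring R + M?: abelian_group M
  for R :: "('a, 'c) ring_scheme" (structure) and M :: "('a, 'm) rmodule" (structure) +
  assumes ract_closed: "\<lbrakk>x \<in> carrier M; a \<in> carrier R\<rbrakk> \<Longrightarrow> x \<odot>r\<^bsub>M\<^esub> a \<in> carrier M"
    and ract_l_distr: "\<lbrakk>x \<in> carrier M; y \<in> carrier M; a \<in> carrier R\<rbrakk> \<Longrightarrow>
      (x \<oplus>\<^bsub>M\<^esub> y) \<odot>r\<^bsub>M\<^esub> a = x \<odot>r\<^bsub>M\<^esub> a \<oplus>\<^bsub>M\<^esub> y \<odot>r\<^bsub>M\<^esub> a"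
    and ract_r_distr: "\<lbrakk>x \<in> carrier M; a \<in> carrier R; b \<in> carrier R\<rbrakk> \<Longrightarrow>
      x \<odot>r\<^bsub>M\<^esub> (a \<oplus>\<^bsub>R\<^esub> b) = x \<odot>r\<^bsub>M\<^esub> a \<oplus>\<^bsub>M\<^esub> x \<odot>r\<^bsub>M\<^esub> b"
    and ract_assoc: "\<lbrakk>x \<in> carrier M; a \<in> carrier R; b \<in> carrier R\<rbrakk> \<Longrightarrow>
      x \<odot>r\<^bsub>M\<^esub> (a \<otimes>\<^bsub>R\<^esub> b) = (x \<odot>r\<^bsub>M\<^esub> a) \<odot>r\<^bsub>M\<^esub> b"
    and ract_one: "x \<in> carrier M \<Longrightarrow> x \<odot>r\<^bsub>M\<^esub> \<one>\<^bsub>R\<^esub> = x"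

definition fin_gen :: "('a, 'c) ring_scheme \<Rightarrow> ('a, 'm) rmodule \<Rightarrow> bool" where
  "fin_gen A M \<longleftrightarrow> (\<exists>S. finite S \<and> S \<subseteq> carrier M \<and>
     (\<forall>x\<in>carrier M. \<exists>c. c \<in> S \<rightarrow> carrier A \<and> x = (\<Oplus>\<^bsub>M\<^esub>s\<in>S. s \<odot>r\<^bsub>M\<^esub> c s)))"

definition rmod_hom ::
    "('a, 'c) ring_scheme \<Rightarrow> ('a, 'm) rmodule \<Rightarrow> ('a, 'n) rmodule \<Rightarrow> ('m \<Rightarrow> 'n) set" where
  "rmod_hom A M N = {f. f \<in> carrier M \<rightarrow> carrier N \<and>
     (\<forall>x\<in>carrier M. \<forall>y\<in>carrier M. f (x \<oplus>\<^bsub>M\<^esub> y) = f x \<oplus>\<^bsub>N\<^esub> f y) \<and>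
     (\<forall>x\<in>carrier M. \<forall>a\<in>carrier A. f (x \<odot>r\<^bsub>M\<^esub> a) = f x \<odot>r\<^bsub>N\<^esub> a)}"

definition rmod_iso ::
    "('a, 'c) ring_scheme \<Rightarrow> ('a, 'm) rmodule \<Rightarrow> ('a, 'n) rmodule \<Rightarrow> bool" where
  "rmod_iso A M N \<longleftrightarrow> (\<exists>f\<in>rmod_hom A M N. bij_betw f (carrier M) (carrier N))"

definition submodule :: "('a, 'c) ring_scheme \<Rightarrow> ('a, 'm) rmodule \<Rightarrow> 'm set \<Rightarrow> bool" where
  "submodule A M L \<longleftrightarrow> subgroup L (add_monoid M) \<and>
     (\<forall>x\<in>L. \<forall>a\<in>carrier A. x \<odot>r\<^bsub>M\<^esub> a \<in> L)"

definition kernel_module ::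
    "('a, 'm) rmodule \<Rightarrow> ('a, 'n) rmodule \<Rightarrow> ('m \<Rightarrow> 'n) \<Rightarrow> ('a, 'm) rmodule" where
  "kernel_module M N f = M\<lparr>carrier := a_kernel M N f\<rparr>"

definition dsum :: "('a, 'm) rmodule \<Rightarrow> ('a, 'n) rmodule \<Rightarrow> ('a, 'm \<times> 'n) rmodule" where
  "dsum M N = \<lparr>carrier = carrier M \<times> carrier N, monoid.mult = undefined, monoid.one = undefined,
     ring.zero = (\<zero>\<^bsub>M\<^esub>, \<zero>\<^bsub>N\<^esub>),
     ring.add = (\<lambda>(x, y) (x', y'). (x \<oplus>\<^bsub>M\<^esub> x', y \<oplus>\<^bsub>N\<^esub> y')),
     ract = (\<lambda>(x, y) a. (x \<odot>r\<^bsub>M\<^esub> a, y \<odot>r\<^bsub>N\<^esub> a))\<rparr>"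

definition regular_module :: "('a, 'c) ring_scheme \<Rightarrow> ('a, 'a) rmodule" where
  "regular_module A = \<lparr>carrier = carrier A, monoid.mult = undefined, monoid.one = undefined,
     ring.zero = \<zero>\<^bsub>A\<^esub>, ring.add = ring.add A, ract = monoid.mult A\<rparr>"


lemma right_module_transport:
  assumes "right_module A M" and t: "inj_on t (carrier M)"
    and N: "N = \<lparr>carrier = t ` carrier M, monoid.mult = undefined, monoid.one = undefined,
      ring.zero = t \<zero>\<^bsub>M\<^esub>,
      ring.add = (\<lambda>x y. t (the_inv_into (carrier M) t x \<oplus>\<^bsub>M\<^esub> the_inv_into (carrier M) t y)),
      ract = (\<lambda>x a. t (the_inv_into (carrier M) t x \<odot>r\<^bsub>M\<^esub> a))\<rparr>"
  shows "right_module A N" and "t \<in> rmod_hom A M N" and "t ` carrier M = carrier N"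
proof -
  interpret M: right_module A M by fact
  note [simp] = the_inv_into_f_f[OF t] M.ract_closed
  have "abelian_group N"
  proof (rule abelian_groupI)
    fix x assume "x \<in> carrier N"
    then obtain m where m: "m \<in> carrier M" "x = t m" by (auto simp: N)
    then show "\<exists>y\<in>carrier N. y \<oplus>\<^bsub>N\<^esub> x = \<zero>\<^bsub>N\<^esub>"
      by (intro bexI[of _ "t (\<ominus>\<^bsub>M\<^esub> m)"]) (auto simp: N M.l_neg)
  qed (auto simp: N M.a_ac)
  then show "right_module A N"
    by (intro right_module.intro right_module_axioms.intro M.R.ring_axioms)
      (auto simp: N M.ract_l_distr M.ract_r_distr M.ract_assoc M.ract_one)
  show "t \<in> rmod_hom A M N" "t ` carrier M = carrier N"
    by (auto simp: N rmod_hom_def)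
qed

lemma rmod_hom_finsum:
  assumes "right_module A M" "right_module A N" "f \<in> rmod_hom A M N"
    and "finite S" "g \<in> S \<rightarrow> carrier M"
  shows "f (\<Oplus>\<^bsub>M\<^esub>s\<in>S. g s) = (\<Oplus>\<^bsub>N\<^esub>s\<in>S. f (g s))"
proof -
  interpret M: right_module A M by fact
  interpret N: right_module A N by fact
  have f: "f x \<in> carrier N" if "x \<in> carrier M" for x using assms(3) that by (auto simp: rmod_hom_def)
  have add: "f (x \<oplus>\<^bsub>M\<^esub> y) = f x \<oplus>\<^bsub>N\<^esub> f y" if "x \<in> carrier M" "y \<in> carrier M" for x y
    using assms(3) that by (auto simp: rmod_hom_def)
  have "f \<zero>\<^bsub>M\<^esub> \<oplus>\<^bsub>N\<^esub> f \<zero>\<^bsub>M\<^esub> = f \<zero>\<^bsub>M\<^esub>" using add[of "\<zero>\<^bsub>M\<^esub>" "\<zero>\<^bsub>M\<^esub>"] by simp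
  then have z: "f \<zero>\<^bsub>M\<^esub> = \<zero>\<^bsub>N\<^esub>" using f[OF M.zero_closed] by (metis N.M.add.r_cancel_one')
  from assms(4,5) show ?thesis
    by (induction S) (simp_all add: z M.M.finsum_insert N.M.finsum_insert add f Pi_iff)
qed

lemma fin_gen_image:
  assumes "right_module A M" "right_module A N" and f: "f \<in> rmod_hom A M N"
    and inj: "inj_on f (carrier M)" and sur: "f ` carrier M = carrier N" and "fin_gen A M"
  shows "fin_gen A N"
proof -
  interpret M: right_module A M by fact
  interpret N: right_module A N by fact
  obtain S where S: "finite S" "S \<subseteq> carrier M"
    and gen: "\<And>x. x \<in> carrier M \<Longrightarrow> \<exists>c. c \<in> S \<rightarrow> carrier A \<and> x = (\<Oplus>\<^bsub>M\<^esub>s\<in>S. s \<odot>r\<^bsub>M\<^esub> c s)"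
    using \<open>fin_gen A M\<close> unfolding fin_gen_def by blast
  have Sc: "s \<in> carrier M" if "s \<in> S" for s using S(2) that by auto
  have f_carr: "f x \<in> carrier N" if "x \<in> carrier M" for x using sur that by auto
  have act: "f (x \<odot>r\<^bsub>M\<^esub> a) = f x \<odot>r\<^bsub>N\<^esub> a" if "x \<in> carrier M" "a \<in> carrier A" for x a
    using f that by (auto simp: rmod_hom_def)
  have injS: "inj_on f S" using inj S(2) by (rule inj_on_subset)
  show ?thesis unfolding fin_gen_def
  proof (intro exI[of _ "f ` S"] conjI ballI)
    show "finite (f ` S)" "f ` S \<subseteq> carrier N" using S sur by auto
    fix y assume "y \<in> carrier N"
    then obtain x where x: "x \<in> carrier M" "y = f x" using sur by auto
    obtain c where c: "c \<in> S \<rightarrow> carrier A" "x = (\<Oplus>\<^bsub>M\<^esub>s\<in>S. s \<odot>r\<^bsub>M\<^esub> c s)" using gen x by blast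
    let ?c = "\<lambda>z. c (the_inv_into S f z)"
    have "y = (\<Oplus>\<^bsub>N\<^esub>s\<in>S. f (s \<odot>r\<^bsub>M\<^esub> c s))" unfolding x c
      using c S by (intro rmod_hom_finsum[OF assms(1-3)]) (auto intro!: M.ract_closed)
    also have "\<dots> = (\<Oplus>\<^bsub>N\<^esub>s\<in>S. f s \<odot>r\<^bsub>N\<^esub> ?c (f s))"
      using c Sc f_carr act by (intro N.M.finsum_cong' refl)
        (auto simp: the_inv_into_f_f[OF injS] Pi_iff intro!: N.ract_closed)
    also have "\<dots> = (\<Oplus>\<^bsub>N\<^esub>z\<in>f ` S. z \<odot>r\<^bsub>N\<^esub> ?c z)"
      using c S sur by (intro N.M.finsum_reindex[symmetric] injS)
        (auto simp: the_inv_into_f_f[OF injS] intro!: N.ract_closed)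
    finally show "\<exists>c. c \<in> f ` S \<rightarrow> carrier A \<and> y = (\<Oplus>\<^bsub>N\<^esub>z\<in>f ` S. z \<odot>r\<^bsub>N\<^esub> c z)"
      using c by (intro exI[of _ ?c]) (auto simp: the_inv_into_f_f[OF injS])
  qed
qed


section \<open>The category of finitely generated right modules\<close>

text \<open>A class of modules has to be a set of modules whose elements live in one HOL type. For
  \<open>mod A\<close> this type is \<open>(nat \<Rightarrow> 'a) set\<close>: a finitely generated right module is a quotient of
  some \<open>A\<^sup>n\<close>, so it is isomorphic to one whose elements are sets of coefficient vectors. The
  lemma \<open>fg_modules_representative\<close> states that no isomorphism class is lost, whatever the
  type of the given module.\<close>

type_synonym 'a fg_module = "('a, (nat \<Rightarrow> 'a) set) rmodule"

definition fg_modules :: "('a, 'c) ring_scheme \<Rightarrow> 'a fg_module set" where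
  "fg_modules A = {M. right_module A M \<and> fin_gen A M}"

lemma fg_modules_representative:
  fixes M :: "('a, 'm) rmodule"
  assumes M: "right_module A M" and "fin_gen A M"
  shows "\<exists>N\<in>fg_modules A. rmod_iso A M N"
proof -
  obtain S where S: "finite S" "S \<subseteq> carrier M"
    and gen: "\<And>x. x \<in> carrier M \<Longrightarrow> \<exists>c. c \<in> S \<rightarrow> carrier A \<and> x = (\<Oplus>\<^bsub>M\<^esub>s\<in>S. s \<odot>r\<^bsub>M\<^esub> c s)"
    using \<open>fin_gen A M\<close> unfolding fin_gen_def by blast
  obtain k :: "'m \<Rightarrow> nat" where k: "inj_on k S" using finite_imp_inj_to_nat_seg[OF S(1)] by blast
  interpret M: right_module A M by fact
  define t :: "'m \<Rightarrow> (nat \<Rightarrow> 'a) set" where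
    "t x = {c. (\<forall>s\<in>S. c (k s) \<in> carrier A) \<and>
      x = (\<Oplus>\<^bsub>M\<^esub>s\<in>S. s \<odot>r\<^bsub>M\<^esub> c (k s))}" for x
  have ne: "t x \<noteq> {}" if x: "x \<in> carrier M" for x
  proof -
    obtain c where c: "c \<in> S \<rightarrow> carrier A" "x = (\<Oplus>\<^bsub>M\<^esub>s\<in>S. s \<odot>r\<^bsub>M\<^esub> c s)" using gen[OF x] by blast
    have "(\<Oplus>\<^bsub>M\<^esub>s\<in>S. s \<odot>r\<^bsub>M\<^esub> c (the_inv_into S k (k s))) = (\<Oplus>\<^bsub>M\<^esub>s\<in>S. s \<odot>r\<^bsub>M\<^esub> c s)"
      using c(1) S(2) by (intro M.M.finsum_cong' refl)
        (auto simp: the_inv_into_f_f[OF k] intro!: M.ract_closed)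
    with c(2) have "x = (\<Oplus>\<^bsub>M\<^esub>s\<in>S. s \<odot>r\<^bsub>M\<^esub> c (the_inv_into S k (k s)))" by simp
    then have "(\<lambda>i. c (the_inv_into S k i)) \<in> t x"
      using c(1) by (auto simp only: t_def mem_Collect_eq the_inv_into_f_f[OF k] Pi_iff)
    then show ?thesis by blast
  qed
  have t: "inj_on t (carrier M)"
  proof (rule inj_onI)
    fix x y assume "x \<in> carrier M" and eq: "t x = t y"
    then obtain c where "c \<in> t x" using ne by blast
    moreover from this eq have "c \<in> t y" by simp
    ultimately show "x = y" by (simp add: t_def)
  qed
  define N :: "'a fg_module" where
    "N = \<lparr>carrier = t ` carrier M, monoid.mult = undefined, monoid.one = undefined,
    ring.zero = t \<zero>\<^bsub>M\<^esub>,
    ring.add = (\<lambda>x y. t (the_inv_into (carrier M) t x \<oplus>\<^bsub>M\<^esub> the_inv_into (carrier M) t y)),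
    ract = (\<lambda>x a. t (the_inv_into (carrier M) t x \<odot>r\<^bsub>M\<^esub> a))\<rparr>"
  note N = right_module_transport[OF M t N_def]
  have "N \<in> fg_modules A"
    using N(1) fin_gen_image[OF M N(1,2) t N(3) assms(2)] by (simp add: fg_modules_def)
  moreover have "rmod_iso A M N"
    using N(2,3) t unfolding rmod_iso_def bij_betw_def by blast
  ultimately show ?thesis by blast
qed

definition projective_modules :: "('a, 'c) ring_scheme \<Rightarrow> 'a fg_module set" where
  "projective_modules A = {P \<in> fg_modules A.
     \<forall>M\<in>fg_modules A. \<forall>N\<in>fg_modules A. \<forall>g\<in>rmod_hom A M N. \<forall>f\<in>rmod_hom A P N.
       g ` carrier M = carrier N \<longrightarrow> (\<exists>h\<in>rmod_hom A P M. \<forall>x\<in>carrier P. g (h x) = f x)}"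

definition injective_module :: "('a, 'c) ring_scheme \<Rightarrow> ('a, 'm) rmodule \<Rightarrow> bool" where
  "injective_module A E \<longleftrightarrow>
     (\<forall>M\<in>fg_modules A. \<forall>N\<in>fg_modules A. \<forall>i\<in>rmod_hom A M N. \<forall>f\<in>rmod_hom A M E.
       inj_on i (carrier M) \<longrightarrow> (\<exists>h\<in>rmod_hom A N E. \<forall>x\<in>carrier M. h (i x) = f x))"

definition selfinjective :: "('a, 'c) ring_scheme \<Rightarrow> bool" where
  "selfinjective A \<longleftrightarrow> injective_module A (regular_module A)"

definition superfluous :: "('a, 'c) ring_scheme \<Rightarrow> ('a, 'm) rmodule \<Rightarrow> 'm set \<Rightarrow> bool" where
  "superfluous A M K \<longleftrightarrow> (\<forall>L. submodule A M L \<and> L <+>\<^bsub>M\<^esub> K = carrier M \<longrightarrow> L = carrier M)"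

definition projective_cover ::
    "('a, 'c) ring_scheme \<Rightarrow> 'a fg_module \<Rightarrow> 'a fg_module \<Rightarrow> ((nat \<Rightarrow> 'a) set \<Rightarrow> (nat \<Rightarrow> 'a) set) \<Rightarrow> bool"
  where
  "projective_cover A M P f \<longleftrightarrow> P \<in> projective_modules A \<and> f \<in> rmod_hom A P M \<and>
     f ` carrier P = carrier M \<and> superfluous A P (a_kernel P M f)"

text \<open>The syzygy is determined up to isomorphism only, hence a relation:
  \<open>N\<close> is a syzygy of \<open>M\<close>.\<close>

definition is_syzygy :: "('a, 'c) ring_scheme \<Rightarrow> 'a fg_module \<Rightarrow> 'a fg_module \<Rightarrow> bool" where
  "is_syzygy A M N \<longleftrightarrow> N \<in> fg_modules A \<and>
     (\<exists>P f. projective_cover A M P f \<and> rmod_iso A N (kernel_module P M f))"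

text \<open>The zero module is the empty direct sum. Closure under isomorphism follows
  from the rule \<open>sum\<close> with a zero summand.\<close>

inductive_set add_closure :: "('a, 'c) ring_scheme \<Rightarrow> 'a fg_module set \<Rightarrow> 'a fg_module set"
  for A and D where
  base: "\<lbrakk>M \<in> D; M \<in> fg_modules A\<rbrakk> \<Longrightarrow> M \<in> add_closure A D"
| zero: "\<lbrakk>M \<in> fg_modules A; carrier M = {\<zero>\<^bsub>M\<^esub>}\<rbrakk> \<Longrightarrow> M \<in> add_closure A D"
| sum: "\<lbrakk>M \<in> add_closure A D; N \<in> add_closure A D; L \<in> fg_modules A; rmod_iso A L (dsum M N)\<rbrakk>
    \<Longrightarrow> L \<in> add_closure A D"
| summand: "\<lbrakk>L \<in> add_closure A D; M \<in> fg_modules A; N \<in> fg_modules A; rmod_iso A L (dsum M N)\<rbrakk>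
    \<Longrightarrow> M \<in> add_closure A D"


section \<open>The Igusa-Todorov function\<close>

definition K0_relations :: "('a, 'c) ring_scheme \<Rightarrow> ('a fg_module \<Rightarrow>\<^sub>0 int) set" where
  "K0_relations A =
     {frag_of M - frag_of M' - frag_of M'' | M M' M''.
        M \<in> fg_modules A \<and> M' \<in> fg_modules A \<and> M'' \<in> fg_modules A \<and> rmod_iso A M (dsum M' M'')}
     \<union> frag_of ` projective_modules A"

definition K0_subgroup :: "('a, 'c) ring_scheme \<Rightarrow> ('a fg_module \<Rightarrow>\<^sub>0 int) set" where
  "K0_subgroup A = generate (free_Abelian_group (fg_modules A)) (K0_relations A)"

definition K0 :: "('a, 'c) ring_scheme \<Rightarrow> ('a fg_module \<Rightarrow>\<^sub>0 int) set monoid" where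
  "K0 A = free_Abelian_group (fg_modules A) Mod K0_subgroup A"

definition K0_class :: "('a, 'c) ring_scheme \<Rightarrow> 'a fg_module \<Rightarrow> ('a fg_module \<Rightarrow>\<^sub>0 int) set" where
  "K0_class A M = K0_subgroup A #>\<^bsub>free_Abelian_group (fg_modules A)\<^esub> frag_of M"

text \<open>The classes \<open>[M]\<close> generate \<open>K0 A\<close>, so any two choices agree on \<open>carrier (K0 A)\<close>;
  an endomorphism as required exists whenever projective covers do, in particular for every
  Artin algebra.\<close>

definition syzygy_endo ::
    "('a, 'c) ring_scheme \<Rightarrow> ('a fg_module \<Rightarrow>\<^sub>0 int) set \<Rightarrow> ('a fg_module \<Rightarrow>\<^sub>0 int) set" where
  "syzygy_endo A = (SOME w. w \<in> hom (K0 A) (K0 A) \<and>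
     (\<forall>M\<in>fg_modules A. \<forall>N. is_syzygy A M N \<longrightarrow> w (K0_class A M) = K0_class A N))"

definition K0_span :: "('a, 'c) ring_scheme \<Rightarrow> 'a fg_module \<Rightarrow> ('a fg_module \<Rightarrow>\<^sub>0 int) set set" where
  "K0_span A M = generate (K0 A) (K0_class A ` add_closure A {M})"

definition syzygy_image ::
    "('a, 'c) ring_scheme \<Rightarrow> 'a fg_module \<Rightarrow> nat \<Rightarrow> ('a fg_module \<Rightarrow>\<^sub>0 int) set monoid" where
  "syzygy_image A M m = (K0 A)\<lparr>carrier := (syzygy_endo A ^^ m) ` K0_span A M\<rparr>"

definition IT_phi :: "('a, 'c) ring_scheme \<Rightarrow> 'a fg_module \<Rightarrow> nat" where
  "IT_phi A M =
     (LEAST k. \<forall>m\<ge>k. syzygy_endo A \<in> iso (syzygy_image A M m) (syzygy_image A M (Suc m)))"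

definition phi_dim :: "('a, 'c) ring_scheme \<Rightarrow> 'a fg_module set \<Rightarrow> enat" where
  "phi_dim A C = (SUP M\<in>C. enat (IT_phi A M))"

definition subcategory :: "('a, 'c) ring_scheme \<Rightarrow> 'a fg_module set \<Rightarrow> bool" where
  "subcategory A D \<longleftrightarrow> D \<subseteq> fg_modules A \<and>
     (\<forall>M\<in>D. \<forall>N\<in>fg_modules A. rmod_iso A M N \<longrightarrow> N \<in> D)"

definition zero_IT_subcategory :: "('a, 'c) ring_scheme \<Rightarrow> 'a fg_module set \<Rightarrow> bool" where
  "zero_IT_subcategory A D \<longleftrightarrow> subcategory A D \<and> D = add_closure A D \<and>
     (\<forall>M\<in>D. \<forall>N. is_syzygy A M N \<longrightarrow> N \<in> D) \<and> phi_dim A D = 0"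

definition only_trivial_zero_IT_subcategories :: "('a, 'c) ring_scheme \<Rightarrow> bool" where
  "only_trivial_zero_IT_subcategories A \<longleftrightarrow>
     (\<forall>D. zero_IT_subcategory A D \<longrightarrow> D \<subseteq> projective_modules A)"


section \<open>Truncated path algebras\<close>

text \<open>A finite quiver is a \<open>fin_digraph\<close> (loops and parallel arcs are allowed). A path is
  given by its source and the list of its arrows in the order of traversal; the source is
  redundant except for the trivial paths. Paths are multiplied in the order of traversal.\<close>

type_synonym ('v, 'e) qpath = "'v \<times> 'e list"

definition qpaths :: "('v, 'e) pre_digraph \<Rightarrow> ('v, 'e) qpath set" where
  "qpaths Q = {(u, p). \<exists>v. pre_digraph.awalk Q u p v}"

definition path_algebra :: "('v, 'e) pre_digraph \<Rightarrow> (('v, 'e) qpath \<Rightarrow>\<^sub>0 'k::field) ring" where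
  "path_algebra Q = \<lparr>carrier = {f. Poly_Mapping.keys f \<subseteq> qpaths Q},
     monoid.mult = (\<lambda>f g. \<Sum>(u, p)\<in>Poly_Mapping.keys f. \<Sum>(w, q)\<in>Poly_Mapping.keys g.
       if pre_digraph.awalk Q u p w
       then Poly_Mapping.single (u, p @ q)
         (Poly_Mapping.lookup f (u, p) * Poly_Mapping.lookup g (w, q))
       else 0),
     monoid.one = (\<Sum>v\<in>verts Q. Poly_Mapping.single (v, []) 1),
     ring.zero = 0,
     ring.add = (+)\<rparr>"

definition arrow_ideal :: "('v, 'e) pre_digraph \<Rightarrow> (('v, 'e) qpath \<Rightarrow>\<^sub>0 'k::field) set" where
  "arrow_ideal Q =
     genideal (path_algebra Q) ((\<lambda>a. Poly_Mapping.single (tail Q a, [a]) 1) ` arcs Q)"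

primrec ideal_power :: "('a, 'c) ring_scheme \<Rightarrow> 'a set \<Rightarrow> nat \<Rightarrow> 'a set" where
  "ideal_power R I 0 = carrier R"
| "ideal_power R I (Suc n) = ideal_prod R (ideal_power R I n) I"

definition truncated_path_algebra ::
    "('v, 'e) pre_digraph \<Rightarrow> nat \<Rightarrow> (('v, 'e) qpath \<Rightarrow>\<^sub>0 'k::field) set ring" where
  "truncated_path_algebra Q k = path_algebra Q Quot ideal_power (path_algebra Q) (arrow_ideal Q) k"

text \<open>The adjacency matrix with respect to an enumeration of the vertices. Its invertibility is
  meant over the rationals: the integer matrix \<open>(2)\<close> of the quiver with one vertex and two
  loops counts as invertible.\<close>

definition adjacency_matrix :: "('v, 'e) pre_digraph \<Rightarrow> 'v list \<Rightarrow> rat mat" where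
  "adjacency_matrix Q vs = mat (length vs) (length vs)
     (\<lambda>(i, j). of_nat (card {a \<in> arcs Q. tail Q a = vs ! i \<and> head Q a = vs ! j}))"

end

theory Submission
  imports Defs "HOL-Library.Function_Algebras" "Jordan_Normal_Form.Determinant"
begin

text \<open>For a vertex \<open>u\<close> with idempotent \<open>e\<close> let \<open>M(u, r) = e A / e J\<^sup>r\<close> (\<open>MS u r\<close> below). If \<open>0 < r < k\<close>, its syzygy is
  the direct sum of the modules \<open>M(w, k - r)\<close> over all paths of length \<open>r\<close> from \<open>u\<close>, where \<open>w\<close> is the
  end of the path. Moreover every nonzero submodule of the radical of a projective module has some
  \<open>M(u, r)\<close> with \<open>0 < r < k\<close> as a direct summand. A 0-Igusa-Todorov subcategory with a nonprojective
  module therefore contains some \<open>M(u, r)\<close>, hence also \<open>M(w, r)\<close> whenever there is a path of length \<open>k\<close>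
  from \<open>u\<close> to \<open>w\<close>, and in the end \<open>M(w, r)\<close> for all vertices \<open>w\<close>: for \<open>k = 2\<close> since then single
  arrows already stay within \<open>r = 1\<close>, and otherwise since a loop allows to prolong every path to a
  length divisible by \<open>k\<close>.

  The classes \<open>[M(w, r)]\<close> are linearly independent in \<open>K0\<close>, since they are separated by additive
  invariants that vanish on projective modules. The syzygy endomorphism maps their span to the span of
  the \<open>[M(w, k - r)]\<close> by the \<open>r\<close>-th power of the adjacency matrix. As this matrix is singular,
  the endomorphism is not injective on the subgroup of the direct sum of all \<open>M(w, r)\<close>, so the
  Igusa-Todorov function is positive there.\<close>

section \<open>Right modules\<close>

text \<open>The spreading of \<open>M(w, r)\<close> over the vertices is what separates the two
  cases. Syzygies alternate between the parameters \<open>r\<close> and \<open>k - r\<close>, so a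
  return to \<open>r\<close> is guaranteed in general only along paths whose length is a multiple of
  \<open>k\<close>. If the cycle lengths of \<open>Q\<close> share a factor with \<open>k\<close>,
  some vertices may stay out of reach; a loop destroys this periodicity, and for
  \<open>k = 2\<close> it does not arise because \<open>r = k - r\<close>.

  No Krull-Schmidt theorem is invoked. Summands of sums of \<open>M(u, r)\<close> are recognised as
  such sums by minimal covers over \<open>A / J\<^sup>r\<close>. Independence of the classes comes
  from the part of the top that is visible on elements annihilated by \<open>J\<^sup>r\<close>:
  without sinks and for \<open>r < k\<close>, such elements of a sum of modules \<open>e A\<close>
  lie in its radical, so projective modules contribute nothing.

  Members of \<open>mod A\<close> have elements in one fixed type, whereas the computations take
  place in function spaces and products of other types. Hence finite generation is needed for
  arbitrary types (\<open>fgm\<close>), and \<open>rep\<close> returns to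
  \<open>mod A\<close>.\<close>

definition fgm :: "('a, 'c) ring_scheme \<Rightarrow> ('a, 'm) rmodule \<Rightarrow> bool" where
  "fgm A M \<longleftrightarrow> right_module A M \<and> fin_gen A M"

lemma fg_modules_iff: "M \<in> fg_modules A \<longleftrightarrow> fgm A M"
  by (simp add: fg_modules_def fgm_def)

lemma rmod_homD:
  assumes "f \<in> rmod_hom A M N"
  shows "x \<in> carrier M \<Longrightarrow> f x \<in> carrier N"
    and "x \<in> carrier M \<Longrightarrow> y \<in> carrier M \<Longrightarrow> f (x \<oplus>\<^bsub>M\<^esub> y) = f x \<oplus>\<^bsub>N\<^esub> f y"
    and "x \<in> carrier M \<Longrightarrow> a \<in> carrier A \<Longrightarrow> f (x \<odot>r\<^bsub>M\<^esub> a) = f x \<odot>r\<^bsub>N\<^esub> a"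
  using assms by (auto simp: rmod_hom_def)

lemma rmod_homI:
  assumes "\<And>x. x \<in> carrier M \<Longrightarrow> f x \<in> carrier N"
    and "\<And>x y. x \<in> carrier M \<Longrightarrow> y \<in> carrier M \<Longrightarrow> f (x \<oplus>\<^bsub>M\<^esub> y) = f x \<oplus>\<^bsub>N\<^esub> f y"
    and "\<And>x a. x \<in> carrier M \<Longrightarrow> a \<in> carrier A \<Longrightarrow> f (x \<odot>r\<^bsub>M\<^esub> a) = f x \<odot>r\<^bsub>N\<^esub> a"
  shows "f \<in> rmod_hom A M N"
  using assms by (auto simp: rmod_hom_def)

lemma rmod_hom_zero:
  assumes "right_module A M" "right_module A N" "f \<in> rmod_hom A M N"
  shows "f \<zero>\<^bsub>M\<^esub> = \<zero>\<^bsub>N\<^esub>"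
  using rmod_hom_finsum[OF assms, of "{}"] assms
  by (simp add: abelian_monoid.finsum_empty abelian_group.axioms(1) right_module.axioms(2))

lemma rmod_hom_comp:
  assumes "f \<in> rmod_hom A M N" "g \<in> rmod_hom A N L"
  shows "(\<lambda>x. g (f x)) \<in> rmod_hom A M L"
  using rmod_homD[OF assms(1)] rmod_homD[OF assms(2)] by (intro rmod_homI) auto

lemma rmod_isoE:
  assumes "rmod_iso A M N"
  obtains f where "f \<in> rmod_hom A M N" "bij_betw f (carrier M) (carrier N)"
  using assms by (auto simp: rmod_iso_def)

lemma rmod_isoI:
  assumes "f \<in> rmod_hom A M N" "bij_betw f (carrier M) (carrier N)"
  shows "rmod_iso A M N"
  using assms by (auto simp: rmod_iso_def)

lemma rmod_iso_refl [simp]: "rmod_iso A M M"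
  by (rule rmod_isoI[of "\<lambda>x. x"]) (auto simp: rmod_hom_def bij_betw_def)

lemma rmod_iso_trans: "rmod_iso A M N \<Longrightarrow> rmod_iso A N L \<Longrightarrow> rmod_iso A M L"
  by (elim rmod_isoE) (rule rmod_isoI[OF rmod_hom_comp], auto intro: bij_betw_trans[unfolded o_def])

section \<open>Submodules and finite generation\<close>

context right_module
begin

lemma ract_zero_left [simp]: "a \<in> carrier R \<Longrightarrow> \<zero>\<^bsub>M\<^esub> \<odot>r\<^bsub>M\<^esub> a = \<zero>\<^bsub>M\<^esub>"
  using ract_l_distr[of "\<zero>\<^bsub>M\<^esub>" "\<zero>\<^bsub>M\<^esub>" a] ract_closed[of "\<zero>\<^bsub>M\<^esub>" a]
  by (metis M.add.r_cancel_one' M.r_zero M.zero_closed)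

lemma ract_zero_right [simp]: "x \<in> carrier M \<Longrightarrow> x \<odot>r\<^bsub>M\<^esub> \<zero>\<^bsub>R\<^esub> = \<zero>\<^bsub>M\<^esub>"
  using ract_r_distr[of x "\<zero>\<^bsub>R\<^esub>" "\<zero>\<^bsub>R\<^esub>"] ract_closed[of x "\<zero>\<^bsub>R\<^esub>"]
  by (metis M.add.r_cancel_one' R.l_zero R.zero_closed)

lemma ract_minus_right:
  assumes "x \<in> carrier M" "a \<in> carrier R"
  shows "x \<odot>r\<^bsub>M\<^esub> (\<ominus>\<^bsub>R\<^esub> a) = \<ominus>\<^bsub>M\<^esub> (x \<odot>r\<^bsub>M\<^esub> a)"
  using assms ract_r_distr[of x "\<ominus>\<^bsub>R\<^esub> a" a]
  by (intro M.minus_equality[symmetric]) (auto simp: ract_closed R.l_neg)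

lemma ract_minus_one: "x \<in> carrier M \<Longrightarrow> x \<odot>r\<^bsub>M\<^esub> (\<ominus>\<^bsub>R\<^esub> \<one>\<^bsub>R\<^esub>) = \<ominus>\<^bsub>M\<^esub> x"
  by (simp add: ract_minus_right ract_one)

lemma ract_finsum:
  assumes "f \<in> S \<rightarrow> carrier M" "a \<in> carrier R"
  shows "(\<Oplus>\<^bsub>M\<^esub>s\<in>S. f s) \<odot>r\<^bsub>M\<^esub> a = (\<Oplus>\<^bsub>M\<^esub>s\<in>S. f s \<odot>r\<^bsub>M\<^esub> a)"
proof (cases "finite S")
  case True
  then show ?thesis using assms(1)
    by (induction S)
      (use assms(2) in \<open>simp_all add: ract_l_distr ract_closed M.finsum_closed Pi_iff\<close>)
\<comment> \<open>Over an infinite index set \<open>finsum\<close> is zero by convention, and the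
  action fixes zero.\<close>
qed (use assms(2) in \<open>simp add: M.add.finprod_infinite finsum_def finprod_def\<close>)

text \<open>Negatives come for free: \<open>- x\<close> is \<open>x\<close> acted on by
  \<open>- 1\<close>.\<close>

lemma submoduleI:
  assumes "L \<subseteq> carrier M" "\<zero>\<^bsub>M\<^esub> \<in> L" "\<And>x y. x \<in> L \<Longrightarrow> y \<in> L \<Longrightarrow> x \<oplus>\<^bsub>M\<^esub> y \<in> L"
    and "\<And>x a. x \<in> L \<Longrightarrow> a \<in> carrier R \<Longrightarrow> x \<odot>r\<^bsub>M\<^esub> a \<in> L"
  shows "submodule R M L"
proof -
  have "\<ominus>\<^bsub>M\<^esub> x \<in> L" if "x \<in> L" for x
    using assms(1) assms(4)[OF that, of "\<ominus>\<^bsub>R\<^esub> \<one>\<^bsub>R\<^esub>"] that ract_minus_one[of x] by auto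
  then show ?thesis using assms
    by (auto simp: submodule_def a_inv_def intro!: M.add.subgroupI)
qed

lemma submoduleD:
  assumes "submodule R M L"
  shows "L \<subseteq> carrier M" "x \<in> L \<Longrightarrow> x \<in> carrier M" "\<zero>\<^bsub>M\<^esub> \<in> L"
    and "x \<in> L \<Longrightarrow> y \<in> L \<Longrightarrow> x \<oplus>\<^bsub>M\<^esub> y \<in> L"
    and "x \<in> L \<Longrightarrow> a \<in> carrier R \<Longrightarrow> x \<odot>r\<^bsub>M\<^esub> a \<in> L"
    and "x \<in> L \<Longrightarrow> \<ominus>\<^bsub>M\<^esub> x \<in> L"
    and "x \<in> L \<Longrightarrow> y \<in> L \<Longrightarrow> x \<ominus>\<^bsub>M\<^esub> y \<in> L"
proof -
  have s: "subgroup L (add_monoid M)" and a: "\<And>x a. x \<in> L \<Longrightarrow> a \<in> carrier R \<Longrightarrow> x \<odot>r\<^bsub>M\<^esub> a \<in> L"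
    using assms by (auto simp: submodule_def)
  show c: "L \<subseteq> carrier M" "x \<in> L \<Longrightarrow> x \<in> carrier M" "\<zero>\<^bsub>M\<^esub> \<in> L"
    and p: "\<And>x y. x \<in> L \<Longrightarrow> y \<in> L \<Longrightarrow> x \<oplus>\<^bsub>M\<^esub> y \<in> L"
    using subgroup.subset[OF s] subgroup.one_closed[OF s] subgroup.m_closed[OF s] by auto
  show "x \<in> L \<Longrightarrow> a \<in> carrier R \<Longrightarrow> x \<odot>r\<^bsub>M\<^esub> a \<in> L" by (rule a)
  show m: "\<And>x. x \<in> L \<Longrightarrow> \<ominus>\<^bsub>M\<^esub> x \<in> L"
    using subgroup.m_inv_closed[OF s] by (simp add: a_inv_def)
  show "x \<in> L \<Longrightarrow> y \<in> L \<Longrightarrow> x \<ominus>\<^bsub>M\<^esub> y \<in> L"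
    using p m by (simp add: a_minus_def)
qed

lemma submodule_finsum:
  assumes "submodule R M L" "f \<in> S \<rightarrow> L"
  shows "(\<Oplus>\<^bsub>M\<^esub>s\<in>S. f s) \<in> L"
proof (cases "finite S")
  case True
  then show ?thesis using assms(2)
  proof (induction S)
    case (insert s S)
    then show ?case using submoduleD[OF assms(1)] by (subst M.finsum_insert) auto
  qed (simp add: submoduleD[OF assms(1)])
qed (use submoduleD[OF assms(1)] in \<open>simp add: finsum_def finprod_def\<close>)

lemma submodule_carrier: "submodule R M (carrier M)"
  by (rule submoduleI) (auto simp: ract_closed)

text \<open>The linear combinations of \<open>S\<close> form a submodule that contains
  \<open>S\<close>. Together with \<open>fin_genE\<close> this replaces coefficient families by the
  universal property of generators, which is easier to transport along homomorphisms.\<close>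

lemma fin_genI:
  assumes S: "finite S" "S \<subseteq> carrier M"
    and gen: "\<And>L. submodule R M L \<Longrightarrow> S \<subseteq> L \<Longrightarrow> carrier M \<subseteq> L"
  shows "fin_gen R M"
proof -
  let ?L = "{(\<Oplus>\<^bsub>M\<^esub>s\<in>S. s \<odot>r\<^bsub>M\<^esub> c s) | c. c \<in> S \<rightarrow> carrier R}"
  have cl: "s \<odot>r\<^bsub>M\<^esub> c s \<in> carrier M" if "s \<in> S" "c \<in> S \<rightarrow> carrier R" for s c
    using that S by (auto intro!: ract_closed)
  have "submodule R M ?L"
  proof (rule submoduleI)
    show "?L \<subseteq> carrier M" using cl by (auto intro!: M.finsum_closed)
    show "\<zero>\<^bsub>M\<^esub> \<in> ?L"
    proof -
      have "(\<Oplus>\<^bsub>M\<^esub>s\<in>S. s \<odot>r\<^bsub>M\<^esub> \<zero>\<^bsub>R\<^esub>) = (\<Oplus>\<^bsub>M\<^esub>s\<in>S. \<zero>\<^bsub>M\<^esub>)"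
        using S by (intro M.finsum_cong') (auto intro!: ract_zero_right)
      then show ?thesis by (auto intro!: exI[of _ "\<lambda>_. \<zero>\<^bsub>R\<^esub>"])
    qed
  next
    fix x y assume "x \<in> ?L" "y \<in> ?L"
    then obtain c d where c: "c \<in> S \<rightarrow> carrier R" "x = (\<Oplus>\<^bsub>M\<^esub>s\<in>S. s \<odot>r\<^bsub>M\<^esub> c s)"
      and d: "d \<in> S \<rightarrow> carrier R" "y = (\<Oplus>\<^bsub>M\<^esub>s\<in>S. s \<odot>r\<^bsub>M\<^esub> d s)" by blast
    have "x \<oplus>\<^bsub>M\<^esub> y = (\<Oplus>\<^bsub>M\<^esub>s\<in>S. s \<odot>r\<^bsub>M\<^esub> c s \<oplus>\<^bsub>M\<^esub> s \<odot>r\<^bsub>M\<^esub> d s)"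
      unfolding c(2) d(2) using cl c d by (intro M.finsum_addf[symmetric]) auto
    also have "\<dots> = (\<Oplus>\<^bsub>M\<^esub>s\<in>S. s \<odot>r\<^bsub>M\<^esub> (c s \<oplus>\<^bsub>R\<^esub> d s))"
      using c d S by (intro M.finsum_cong') (auto simp: Pi_iff intro!: ract_r_distr[symmetric] ract_closed)
    finally show "x \<oplus>\<^bsub>M\<^esub> y \<in> ?L" using c d by (auto intro!: exI[of _ "\<lambda>s. c s \<oplus>\<^bsub>R\<^esub> d s"])
  next
    fix x a assume "x \<in> ?L" and a: "a \<in> carrier R"
    then obtain c where c: "c \<in> S \<rightarrow> carrier R" "x = (\<Oplus>\<^bsub>M\<^esub>s\<in>S. s \<odot>r\<^bsub>M\<^esub> c s)" by blast
    have "x \<odot>r\<^bsub>M\<^esub> a = (\<Oplus>\<^bsub>M\<^esub>s\<in>S. s \<odot>r\<^bsub>M\<^esub> c s \<odot>r\<^bsub>M\<^esub> a)"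
      unfolding c(2) using cl c a by (intro ract_finsum) auto
    also have "\<dots> = (\<Oplus>\<^bsub>M\<^esub>s\<in>S. s \<odot>r\<^bsub>M\<^esub> (c s \<otimes>\<^bsub>R\<^esub> a))"
      using c a S by (intro M.finsum_cong') (auto simp: Pi_iff intro!: ract_assoc[symmetric] ract_closed)
    finally show "x \<odot>r\<^bsub>M\<^esub> a \<in> ?L" using c a by (auto intro!: exI[of _ "\<lambda>s. c s \<otimes>\<^bsub>R\<^esub> a"])
  qed
  moreover have "S \<subseteq> ?L"
  proof
    fix s assume s: "s \<in> S"
    have "(\<Oplus>\<^bsub>M\<^esub>t\<in>S. t \<odot>r\<^bsub>M\<^esub> (if s = t then \<one>\<^bsub>R\<^esub> else \<zero>\<^bsub>R\<^esub>)) = (\<Oplus>\<^bsub>M\<^esub>t\<in>S. if s = t then t else \<zero>\<^bsub>M\<^esub>)"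
      using S by (intro M.finsum_cong') (auto simp: ract_one)
    also have "\<dots> = s" using M.add.finprod_singleton[OF s S(1), of "\<lambda>t. t"] S(2) by (auto simp: finsum_def)
    finally show "s \<in> ?L" by (intro CollectI exI[of _ "\<lambda>t. if s = t then \<one>\<^bsub>R\<^esub> else \<zero>\<^bsub>R\<^esub>"]) auto
  qed
  ultimately have "carrier M \<subseteq> ?L" by (rule gen)
  then show ?thesis unfolding fin_gen_def using S by (intro exI[of _ S]) blast
qed

lemma fin_genE:
  assumes "fin_gen R M"
  obtains S where "finite S" "S \<subseteq> carrier M"
    "\<And>L. submodule R M L \<Longrightarrow> S \<subseteq> L \<Longrightarrow> carrier M \<subseteq> L"
proof -
  obtain S where S: "finite S" "S \<subseteq> carrier M"
    and gen: "\<And>x. x \<in> carrier M \<Longrightarrow> \<exists>c. c \<in> S \<rightarrow> carrier R \<and> x = (\<Oplus>\<^bsub>M\<^esub>s\<in>S. s \<odot>r\<^bsub>M\<^esub> c s)"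
    using \<open>fin_gen R M\<close> unfolding fin_gen_def by blast
  show ?thesis
  proof (rule that[OF S], rule subsetI)
    fix L x assume L: "submodule R M L" "S \<subseteq> L" and "x \<in> carrier M"
    then obtain c where c: "c \<in> S \<rightarrow> carrier R" "x = (\<Oplus>\<^bsub>M\<^esub>s\<in>S. s \<odot>r\<^bsub>M\<^esub> c s)" using gen by blast
    show "x \<in> L" unfolding c(2) using L c(1) submoduleD(5)[OF L(1)] by (intro submodule_finsum) auto
  qed
qed

lemma submodule_right_module:
  assumes "submodule R M L"
  shows "right_module R (M\<lparr>carrier := L\<rparr>)"
proof -
  note D = submoduleD[OF assms]
  have "abelian_group (M\<lparr>carrier := L\<rparr>)"
  proof (rule abelian_groupI)
    fix x assume "x \<in> carrier (M\<lparr>carrier := L\<rparr>)"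
    then show "\<exists>y\<in>carrier (M\<lparr>carrier := L\<rparr>). y \<oplus>\<^bsub>M\<lparr>carrier := L\<rparr>\<^esub> x = \<zero>\<^bsub>M\<lparr>carrier := L\<rparr>\<^esub>"
      using D(2,6) by (intro bexI[of _ "\<ominus>\<^bsub>M\<^esub> x"]) (auto simp: M.l_neg)
  qed (use D(2-6) in \<open>auto simp: M.a_ac\<close>)
  then show ?thesis
    by (intro right_module.intro right_module_axioms.intro R.ring_axioms)
      (use D(2-6) in \<open>auto simp: ract_l_distr ract_r_distr ract_assoc ract_one\<close>)
qed

end

section \<open>Homomorphisms, kernels and images\<close>

lemma rmod_hom_inv:
  assumes "right_module A M" and f: "f \<in> rmod_hom A M N" "bij_betw f (carrier M) (carrier N)"
  shows "the_inv_into (carrier M) f \<in> rmod_hom A N M"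
    and "bij_betw (the_inv_into (carrier M) f) (carrier N) (carrier M)"
proof -
  interpret M: right_module A M by fact
  show "bij_betw (the_inv_into (carrier M) f) (carrier N) (carrier M)"
    by (rule bij_betw_the_inv_into[OF f(2)])
  have inj: "inj_on f (carrier M)" and im: "f ` carrier M = carrier N" using f(2) by (auto simp: bij_betw_def)
  show "the_inv_into (carrier M) f \<in> rmod_hom A N M"
  proof (rule rmod_homI)
    fix x assume "x \<in> carrier N"
    then obtain m where m: "m \<in> carrier M" "x = f m" using im by auto
    then show "the_inv_into (carrier M) f x \<in> carrier M" using inj by (simp add: the_inv_into_f_f)
    fix a assume a: "a \<in> carrier A"
    have "x \<odot>r\<^bsub>N\<^esub> a = f (m \<odot>r\<^bsub>M\<^esub> a)" using rmod_homD(3)[OF f(1)] m a by simp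
    then show "the_inv_into (carrier M) f (x \<odot>r\<^bsub>N\<^esub> a) = the_inv_into (carrier M) f x \<odot>r\<^bsub>M\<^esub> a"
      using m a inj by (simp add: the_inv_into_f_f M.ract_closed)
  next
    fix x y assume "x \<in> carrier N" "y \<in> carrier N"
    then obtain m m' where m: "m \<in> carrier M" "x = f m" "m' \<in> carrier M" "y = f m'" using im by blast
    have "x \<oplus>\<^bsub>N\<^esub> y = f (m \<oplus>\<^bsub>M\<^esub> m')" using rmod_homD(2)[OF f(1)] m by simp
    then show "the_inv_into (carrier M) f (x \<oplus>\<^bsub>N\<^esub> y)
      = the_inv_into (carrier M) f x \<oplus>\<^bsub>M\<^esub> the_inv_into (carrier M) f y"
      using m inj by (simp add: the_inv_into_f_f)
  qed
qed

lemma rmod_iso_sym: "right_module A M \<Longrightarrow> rmod_iso A M N \<Longrightarrow> rmod_iso A N M"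
  by (meson rmod_hom_inv rmod_isoE rmod_isoI)

lemma rmod_hom_diff:
  assumes "right_module A M" "right_module A N" "f \<in> rmod_hom A M N" "x \<in> carrier M" "y \<in> carrier M"
  shows "f (x \<ominus>\<^bsub>M\<^esub> y) = f x \<ominus>\<^bsub>N\<^esub> f y"
proof -
  interpret M: right_module A M by fact
  interpret N: right_module A N by fact
  have "f (\<ominus>\<^bsub>M\<^esub> y) = \<ominus>\<^bsub>N\<^esub> f y"
    using rmod_homD(1,3)[OF assms(3)] assms(5)
    by (simp flip: M.ract_minus_one N.ract_minus_one)
  then show ?thesis using rmod_homD(2)[OF assms(3)] assms(4,5) by (simp add: a_minus_def)
qed

lemma (in abelian_group) eq_if_minus_zero:
  assumes "x \<in> carrier G" "y \<in> carrier G" "x \<ominus> y = \<zero>"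
  shows "x = y"
proof -
  have "x = (x \<ominus> y) \<oplus> y" using assms(1,2) by (simp add: a_minus_def a_assoc l_neg)
  then show ?thesis using assms by simp
qed

lemma rmod_hom_injI:
  assumes "right_module A M" "right_module A N" "f \<in> rmod_hom A M N"
    and "\<And>x. x \<in> carrier M \<Longrightarrow> f x = \<zero>\<^bsub>N\<^esub> \<Longrightarrow> x = \<zero>\<^bsub>M\<^esub>"
  shows "inj_on f (carrier M)"
proof (rule inj_onI)
  interpret M: right_module A M by fact
  interpret N: right_module A N by fact
  fix x y assume xy: "x \<in> carrier M" "y \<in> carrier M" "f x = f y"
  have "f (x \<ominus>\<^bsub>M\<^esub> y) = f x \<ominus>\<^bsub>N\<^esub> f y" by (rule rmod_hom_diff[OF assms(1-3) xy(1,2)])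
  also have "\<dots> = \<zero>\<^bsub>N\<^esub>" using xy(3) rmod_homD(1)[OF assms(3) xy(2)] by (simp add: N.M.minus_eq N.M.r_neg)
  finally have "x \<ominus>\<^bsub>M\<^esub> y = \<zero>\<^bsub>M\<^esub>" by (rule assms(4)[OF M.M.minus_closed[OF xy(1,2)]])
  then show "x = y" by (rule M.M.eq_if_minus_zero[OF xy(1,2)])
qed

lemma kernel_submodule:
  assumes "right_module A M" "right_module A N" "f \<in> rmod_hom A M N"
  shows "submodule A M (a_kernel M N f)"
proof -
  interpret M: right_module A M by fact
  interpret N: right_module A N by fact
  show ?thesis using rmod_homD[OF assms(3)] rmod_hom_zero[OF assms]
    by (intro M.submoduleI) (auto simp: a_kernel_def' M.ract_closed)
qed

lemma kernel_module_simps [simp]: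
  "carrier (kernel_module M N f) = {x \<in> carrier M. f x = \<zero>\<^bsub>N\<^esub>}"
  "ring.zero (kernel_module M N f) = ring.zero M" "ring.add (kernel_module M N f) = ring.add M"
  "ract (kernel_module M N f) = ract M"
  by (auto simp: kernel_module_def a_kernel_def')

lemma kernel_right_module:
  assumes "right_module A M" "right_module A N" "f \<in> rmod_hom A M N"
  shows "right_module A (kernel_module M N f)"
  unfolding kernel_module_def
  by (intro right_module.submodule_right_module kernel_submodule assms)

lemma image_submodule:
  assumes "right_module A M" "right_module A N" "f \<in> rmod_hom A M N" "submodule A M L"
  shows "submodule A N (f ` L)"
proof -
  interpret M: right_module A M by fact
  interpret N: right_module A N by fact
  note L = M.submoduleD[OF assms(4)] and f = rmod_homD[OF assms(3)]
  show ?thesis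
  proof (rule N.submoduleI)
    show "f ` L \<subseteq> carrier N" using f(1) L(1) by auto
    show "\<zero>\<^bsub>N\<^esub> \<in> f ` L" using rmod_hom_zero[OF assms(1-3)] L(3) by (metis imageI)
    fix x y assume "x \<in> f ` L" "y \<in> f ` L"
    then obtain m m' where m: "m \<in> L" "x = f m" "m' \<in> L" "y = f m'" by blast
    then have "x \<oplus>\<^bsub>N\<^esub> y = f (m \<oplus>\<^bsub>M\<^esub> m')" using f(2) L(2) by auto
    then show "x \<oplus>\<^bsub>N\<^esub> y \<in> f ` L" using m L(4) by auto
  next
    fix x a assume "x \<in> f ` L" "a \<in> carrier A"
    then obtain m where "m \<in> L" "x = f m" by blast
    then have "x \<odot>r\<^bsub>N\<^esub> a = f (m \<odot>r\<^bsub>M\<^esub> a)" using f(3) L(2) \<open>a \<in> carrier A\<close> by auto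
    then show "x \<odot>r\<^bsub>N\<^esub> a \<in> f ` L" using \<open>m \<in> L\<close> L(5) \<open>a \<in> carrier A\<close> by auto
  qed
qed

lemma vimage_submodule:
  assumes "right_module A M" "right_module A N" "f \<in> rmod_hom A M N" "submodule A N L"
  shows "submodule A M {x \<in> carrier M. f x \<in> L}"
proof -
  interpret M: right_module A M by fact
  interpret N: right_module A N by fact
  show ?thesis using rmod_homD[OF assms(3)] N.submoduleD[OF assms(4)] rmod_hom_zero[OF assms(1-3)]
    by (intro M.submoduleI) (auto simp: M.ract_closed)
qed

section \<open>Direct sums and copies in \<open>mod A\<close>\<close>

lemma dsum_simps [simp]:
  "carrier (dsum M N) = carrier M \<times> carrier N"
  "\<zero>\<^bsub>dsum M N\<^esub> = (\<zero>\<^bsub>M\<^esub>, \<zero>\<^bsub>N\<^esub>)"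
  "(x, y) \<oplus>\<^bsub>dsum M N\<^esub> (x', y') = (x \<oplus>\<^bsub>M\<^esub> x', y \<oplus>\<^bsub>N\<^esub> y')"
  "(x, y) \<odot>r\<^bsub>dsum M N\<^esub> a = (x \<odot>r\<^bsub>M\<^esub> a, y \<odot>r\<^bsub>N\<^esub> a)"
  by (auto simp: dsum_def)

lemma dsum_right_module:
  assumes "right_module A M" "right_module A N"
  shows "right_module A (dsum M N)"
proof -
  interpret M: right_module A M by fact
  interpret N: right_module A N by fact
  have "abelian_group (dsum M N)"
  proof (rule abelian_groupI)
    fix x assume "x \<in> carrier (dsum M N)"
    then show "\<exists>y\<in>carrier (dsum M N). y \<oplus>\<^bsub>dsum M N\<^esub> x = \<zero>\<^bsub>dsum M N\<^esub>"
      by (intro bexI[of _ "(\<ominus>\<^bsub>M\<^esub> fst x, \<ominus>\<^bsub>N\<^esub> snd x)"]) (auto simp: M.M.l_neg N.M.l_neg)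
  qed (auto simp: M.M.a_ac N.M.a_ac)
  then show ?thesis
    by (intro right_module.intro right_module_axioms.intro M.R.ring_axioms)
      (auto simp: M.ract_l_distr M.ract_r_distr M.ract_assoc M.ract_one M.ract_closed
        N.ract_l_distr N.ract_r_distr N.ract_assoc N.ract_one N.ract_closed)
qed

lemma dsum_inj_hom:
  assumes "right_module A M" "right_module A N"
  shows "(\<lambda>x. (x, \<zero>\<^bsub>N\<^esub>)) \<in> rmod_hom A M (dsum M N)" "(\<lambda>y. (\<zero>\<^bsub>M\<^esub>, y)) \<in> rmod_hom A N (dsum M N)"
    and "fst \<in> rmod_hom A (dsum M N) M" "snd \<in> rmod_hom A (dsum M N) N"
proof -
  interpret M: right_module A M by fact
  interpret N: right_module A N by fact
  show "(\<lambda>x. (x, \<zero>\<^bsub>N\<^esub>)) \<in> rmod_hom A M (dsum M N)" "(\<lambda>y. (\<zero>\<^bsub>M\<^esub>, y)) \<in> rmod_hom A N (dsum M N)"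
    and "fst \<in> rmod_hom A (dsum M N) M" "snd \<in> rmod_hom A (dsum M N) N"
    by (auto intro!: rmod_homI)
qed

lemma dsum_fgm:
  assumes "fgm A M" "fgm A N"
  shows "fgm A (dsum M N)"
proof -
  interpret M: right_module A M using assms by (simp add: fgm_def)
  interpret N: right_module A N using assms by (simp add: fgm_def)
  interpret D: right_module A "dsum M N" by (rule dsum_right_module) unfold_locales
  obtain S where S: "finite S" "S \<subseteq> carrier M" "\<And>L. submodule A M L \<Longrightarrow> S \<subseteq> L \<Longrightarrow> carrier M \<subseteq> L"
    using M.fin_genE assms by (metis fgm_def)
  obtain T where T: "finite T" "T \<subseteq> carrier N" "\<And>L. submodule A N L \<Longrightarrow> T \<subseteq> L \<Longrightarrow> carrier N \<subseteq> L"
    using N.fin_genE assms by (metis fgm_def)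
  note h = dsum_inj_hom[OF M.right_module_axioms N.right_module_axioms]
  have "fin_gen A (dsum M N)"
  proof (rule D.fin_genI)
    let ?ST = "(\<lambda>x. (x, \<zero>\<^bsub>N\<^esub>)) ` S \<union> (\<lambda>y. (\<zero>\<^bsub>M\<^esub>, y)) ` T"
    show "finite ?ST" "?ST \<subseteq> carrier (dsum M N)"
      using S T by auto
    fix L assume L: "submodule A (dsum M N) L" "?ST \<subseteq> L"
    have "carrier M \<subseteq> {x \<in> carrier M. (x, \<zero>\<^bsub>N\<^esub>) \<in> L}"
      using L S by (intro S(3) vimage_submodule[OF M.right_module_axioms D.right_module_axioms h(1)]) auto
    moreover have "carrier N \<subseteq> {x \<in> carrier N. (\<zero>\<^bsub>M\<^esub>, x) \<in> L}"
      using L T by (intro T(3) vimage_submodule[OF N.right_module_axioms D.right_module_axioms h(2)]) auto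
    ultimately show "carrier (dsum M N) \<subseteq> L"
    proof clarsimp
      fix x y assume "x \<in> carrier M" "y \<in> carrier N"
        "carrier M \<subseteq> {x \<in> carrier M. (x, \<zero>\<^bsub>N\<^esub>) \<in> L}" "carrier N \<subseteq> {x \<in> carrier N. (\<zero>\<^bsub>M\<^esub>, x) \<in> L}"
      then have "(x, \<zero>\<^bsub>N\<^esub>) \<oplus>\<^bsub>dsum M N\<^esub> (\<zero>\<^bsub>M\<^esub>, y) \<in> L" by (intro D.submoduleD(4)[OF L(1)]) auto
      then show "(x, y) \<in> L" using \<open>x \<in> carrier M\<close> \<open>y \<in> carrier N\<close> by simp
    qed
  qed
  then show ?thesis by (simp add: fgm_def D.right_module_axioms)
qed

text \<open>Subcategories, syzygies and \<open>K0\<close> speak about \<open>fg_modules\<close>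
  only; \<open>rep\<close> carries modules over other element types there. The choice is harmless
  since everything that is said about it is invariant under isomorphism.\<close>

definition rep :: "('a, 'c) ring_scheme \<Rightarrow> ('a, 'm) rmodule \<Rightarrow> 'a fg_module" where
  "rep A M = (SOME N. N \<in> fg_modules A \<and> rmod_iso A M N)"

lemma rep:
  assumes "fgm A M"
  shows "rep A M \<in> fg_modules A" "rmod_iso A M (rep A M)" "rmod_iso A (rep A M) M" "fgm A (rep A M)"
proof -
  have "\<exists>N. N \<in> fg_modules A \<and> rmod_iso A M N"
    using fg_modules_representative assms by (auto simp: fgm_def)
  then have "rep A M \<in> fg_modules A \<and> rmod_iso A M (rep A M)" unfolding rep_def by (rule someI_ex)
  then show "rep A M \<in> fg_modules A" "rmod_iso A M (rep A M)" "rmod_iso A (rep A M) M" "fgm A (rep A M)"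
    using assms by (auto simp: fgm_def fg_modules_def intro: rmod_iso_sym)
qed

lemma dsum_iso_cong:
  assumes "rmod_iso A M M'" "rmod_iso A N N'"
  shows "rmod_iso A (dsum M N) (dsum M' N')"
proof -
  obtain f g where f: "f \<in> rmod_hom A M M'" "bij_betw f (carrier M) (carrier M')"
    and g: "g \<in> rmod_hom A N N'" "bij_betw g (carrier N) (carrier N')"
    using assms by (auto simp: rmod_iso_def)
  show ?thesis
    using rmod_homD[OF f(1)] rmod_homD[OF g(1)] bij_betw_map_prod[OF f(2) g(2)]
    by (intro rmod_isoI[of "map_prod f g"] rmod_homI) (auto simp: map_prod_def)
qed

text \<open>With this, any statement about direct sums yields one about isomorphic modules;
  invariance under isomorphism is always derived from additivity in this way.\<close>

lemma dsum_zero_iso: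
  assumes "right_module A M" "right_module A N" "carrier N = {\<zero>\<^bsub>N\<^esub>}"
  shows "rmod_iso A M (dsum M N)"
  using dsum_inj_hom(1)[OF assms(1,2)] assms(3)
  by (intro rmod_isoI) (auto simp: bij_betw_def inj_on_def image_def)

text \<open>For \<open>n\<close> in \<open>N\<close> pick \<open>x\<close> with
  \<open>p (i x) = p n\<close>; then \<open>n - i x\<close> lies in the kernel of \<open>p\<close>.
  Bijectivity of the composite is assumed instead of \<open>p (i x) = x\<close>, because in the
  application the composite is only triangular with respect to path length.\<close>

lemma retract_dsum_iso:
  assumes "right_module A M" "right_module A N"
    and i: "i \<in> rmod_hom A M N" and p: "p \<in> rmod_hom A N M"
    and bij: "bij_betw (\<lambda>x. p (i x)) (carrier M) (carrier M)"
  shows "rmod_iso A N (dsum M (kernel_module N M p))"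
proof -
  interpret M: right_module A M by fact
  interpret N: right_module A N by fact
  let ?K = "kernel_module N M p"
  interpret K: right_module A ?K by (rule kernel_right_module[OF assms(2,1) p])
  interpret D: right_module A "dsum M ?K" by (rule dsum_right_module) unfold_locales
  note i' = rmod_homD[OF i] and p' = rmod_homD[OF p]
  note i0 = rmod_hom_zero[OF assms(1,2) i] and p0 = rmod_hom_zero[OF assms(2,1) p]
  define h where "h = (\<lambda>(x, z). i x \<oplus>\<^bsub>N\<^esub> z)"
  have hom: "h \<in> rmod_hom A (dsum M ?K) N"
  proof (rule rmod_homI; clarify)
    fix x z assume xz: "(x, z) \<in> carrier (dsum M ?K)"
    then show "h (x, z) \<in> carrier N" using i' by (simp add: h_def)
    fix x' z' assume "(x', z') \<in> carrier (dsum M ?K)"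
    then show "h ((x, z) \<oplus>\<^bsub>dsum M ?K\<^esub> (x', z')) = h (x, z) \<oplus>\<^bsub>N\<^esub> h (x', z')"
      using xz i'(1)[of x] i'(1)[of x'] i'(2)[of x x'] by (simp add: h_def N.M.a_ac)
  next
    fix x z a assume "(x, z) \<in> carrier (dsum M ?K)" "a \<in> carrier A"
    then show "h ((x, z) \<odot>r\<^bsub>dsum M ?K\<^esub> a) = h (x, z) \<odot>r\<^bsub>N\<^esub> a"
      using i'(1)[of x] i'(3)[of x a] by (simp add: h_def N.ract_l_distr)
  qed
  have ph: "p (h (x, z)) = p (i x)" if "x \<in> carrier M" "z \<in> carrier ?K" for x z
    using that p' i' by (simp add: h_def)
  have "inj_on h (carrier (dsum M ?K))"
  proof (rule inj_onI; clarify)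
    fix x z x' z' assume *: "(x, z) \<in> carrier (dsum M ?K)" "(x', z') \<in> carrier (dsum M ?K)" "h (x, z) = h (x', z')"
    then have "p (i x) = p (i x')" using ph[of x z] ph[of x' z'] by auto
    then have "x = x'" using bij * by (auto simp: bij_betw_def dest: inj_onD)
    moreover from this have "z = z'" using * i' by (auto simp: h_def)
    ultimately show "x = x' \<and> z = z'" by simp
  qed
  moreover have "h ` carrier (dsum M ?K) = carrier N"
  proof (intro equalityI subsetI)
    fix n assume n: "n \<in> carrier N"
    then have "p n \<in> (\<lambda>x. p (i x)) ` carrier M" using bij p' by (auto simp: bij_betw_def)
    then obtain x where x: "x \<in> carrier M" "p n = p (i x)" by blast
    let ?z = "n \<ominus>\<^bsub>N\<^esub> i x"
    have "p ?z = \<zero>\<^bsub>M\<^esub>" using rmod_hom_diff[OF assms(2,1) p] x n i' p'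
      by (simp add: M.M.minus_eq M.M.r_neg)
    then have "(x, ?z) \<in> carrier (dsum M ?K)" using x n i' by simp
    moreover have "n = h (x, ?z)"
    proof -
      have *: "i x \<in> carrier N" "\<ominus>\<^bsub>N\<^esub> i x \<in> carrier N" using i'(1)[OF x(1)] by auto
      have "i x \<oplus>\<^bsub>N\<^esub> (n \<oplus>\<^bsub>N\<^esub> \<ominus>\<^bsub>N\<^esub> i x) = n \<oplus>\<^bsub>N\<^esub> (i x \<oplus>\<^bsub>N\<^esub> \<ominus>\<^bsub>N\<^esub> i x)"
        by (rule N.M.a_lcomm[OF *(1) n *(2)])
      also have "\<dots> = n" by (simp only: N.M.r_neg[OF *(1)] N.M.r_zero[OF n])
      finally show ?thesis by (simp add: h_def a_minus_def)
    qed
    ultimately show "n \<in> h ` carrier (dsum M ?K)" by blast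
  qed (use rmod_homD(1)[OF hom] in auto)
  ultimately have "rmod_iso A (dsum M ?K) N" using hom by (intro rmod_isoI) (auto simp: bij_betw_def)
  then show ?thesis by (rule rmod_iso_sym[OF D.right_module_axioms])
qed

section \<open>Convolution along paths\<close>

text \<open>The sum of \<open>f l s\<close> over all ways to cut the list as \<open>l @ s\<close>,
  that is, the coefficient of a path in a convolution product. The recursive form permits induction
  on the path with \<open>f\<close> arbitrary.\<close>

primrec splitsum :: "('e list \<Rightarrow> 'e list \<Rightarrow> 'k::ring) \<Rightarrow> 'e list \<Rightarrow> 'k" where
  "splitsum f [] = f [] []"
| "splitsum f (a # p) = f [] (a # p) + splitsum (\<lambda>l s. f (a # l) s) p"

lemma splitsum_cong:
  "(\<And>l s. l @ s = p \<Longrightarrow> f l s = g l s) \<Longrightarrow> splitsum f p = splitsum g p"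
proof (induction p arbitrary: f g)
  case (Cons a p)
  have "splitsum (\<lambda>l s. f (a # l) s) p = splitsum (\<lambda>l s. g (a # l) s) p"
    by (rule Cons.IH) (simp add: Cons.prems)
  then show ?case using Cons.prems[of "[]" "a # p"] by simp
qed simp

lemma splitsum_add: "splitsum (\<lambda>l s. f l s + g l s) p = splitsum f p + splitsum g p"
  by (induction p arbitrary: f g) simp_all

lemma splitsum_mult_left: "splitsum (\<lambda>l s. c * f l s) p = c * splitsum f p"
  by (induction p arbitrary: f) (simp_all add: distrib_left)

lemma splitsum_mult_right: "splitsum (\<lambda>l s. f l s * c) p = splitsum f p * c"
  by (induction p arbitrary: f) (simp_all add: distrib_right)

lemma splitsum_zero: "splitsum (\<lambda>l s. 0) p = 0"
  by (induction p) simp_all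

lemma splitsum_eq_0: "(\<And>l s. l @ s = p \<Longrightarrow> f l s = 0) \<Longrightarrow> splitsum f p = 0"
  using splitsum_cong[of p f "\<lambda>_ _. 0"] by (simp add: splitsum_zero)

lemma splitsum_neq_0E:
  assumes "splitsum f p \<noteq> 0"
  obtains l s where "l @ s = p" "f l s \<noteq> 0"
  using splitsum_eq_0 assms by metis

text \<open>Both sides run over the cuts into three pieces. All associativity laws below, of rings
  and of module actions, reduce to this.\<close>

lemma splitsum_assoc:
  "splitsum (\<lambda>l s. splitsum (\<lambda>a b. g a b s) l) p = splitsum (\<lambda>a s. splitsum (\<lambda>b c. g a b c) s) p"
proof (induction p arbitrary: g)
  case (Cons x p)
  then show ?case by (simp add: splitsum_add add.assoc)
qed simp

lemma splitsum_first: "(\<And>l s. l \<noteq> [] \<Longrightarrow> f l s = 0) \<Longrightarrow> splitsum f p = f [] p"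
  by (cases p) (auto simp: splitsum_zero)

lemma splitsum_last: "(\<And>l s. s \<noteq> [] \<Longrightarrow> f l s = 0) \<Longrightarrow> splitsum f p = f p []"
  by (induction p arbitrary: f) auto

text \<open>Only cuts at or behind the end of \<open>q\<close> contribute. It applies to elements
  without terms of degree below \<open>length q\<close>.\<close>

lemma splitsum_prefix:
  "(\<And>l s. length l < length q \<Longrightarrow> f l s = 0) \<Longrightarrow> splitsum f (q @ p) = splitsum (\<lambda>l s. f (q @ l) s) p"
  by (induction q arbitrary: f) auto

section \<open>Walks by recursion\<close>

primrec walk :: "('v, 'e) pre_digraph \<Rightarrow> 'v \<Rightarrow> 'e list \<Rightarrow> bool" where
  "walk Q u [] \<longleftrightarrow> u \<in> verts Q"
| "walk Q u (a # p) \<longleftrightarrow> a \<in> arcs Q \<and> tail Q a = u \<and> walk Q (head Q a) p"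

text \<open>Total on all lists of arrows, so that convolution formulas may mention the end of a list
  that is not known to be a walk; the coefficient next to it vanishes in that case.\<close>

primrec tgt :: "('v, 'e) pre_digraph \<Rightarrow> 'v \<Rightarrow> 'e list \<Rightarrow> 'v" where
  "tgt Q u [] = u"
| "tgt Q u (a # p) = tgt Q (head Q a) p"

lemma tgt_append [simp]: "tgt Q u (p @ q) = tgt Q (tgt Q u p) q"
  by (induction p arbitrary: u) auto

context wf_digraph
begin

lemma walk_source: "walk G u p \<Longrightarrow> u \<in> verts G"
  by (cases p) auto

lemma walk_append [simp]: "walk G u (p @ q) \<longleftrightarrow> walk G u p \<and> walk G (tgt G u p) q"
  by (induction p arbitrary: u) (auto dest: walk_source)

lemma walk_target: "walk G u p \<Longrightarrow> tgt G u p \<in> verts G"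
  by (induction p arbitrary: u) auto

lemma awalk_iff_walk: "awalk u p v \<longleftrightarrow> walk G u p \<and> tgt G u p = v"
  by (induction p arbitrary: u) (auto simp: awalk_Cons_iff awalk_Nil_iff)

end

lemma (in fin_digraph) finite_walks:
  "finite {p. walk G u p \<and> length p < n}"
proof (rule finite_subset)
  have "set p \<subseteq> arcs G" if "walk G u p" for p using that by (induction p arbitrary: u) auto
  then show "{p. walk G u p \<and> length p < n} \<subseteq> {p. set p \<subseteq> arcs G \<and> length p \<le> n}" by auto
  show "finite {p. set p \<subseteq> arcs G \<and> length p \<le> n}" by (rule finite_lists_length_le) simp
qed

text \<open>Used at several types: for submodules, whose elements are functions on paths, and for
  spaces of functionals on a module.\<close>

interpretation fs: vector_space "\<lambda>(c::'k::field) (f::'x \<Rightarrow> 'k) t. c * f t"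
  by unfold_locales (auto simp: fun_eq_iff algebra_simps plus_fun_def)

lemma fs_span_indicators:
  fixes f :: "'x \<Rightarrow> 'k::field"
  assumes "finite T" "\<And>s. s \<notin> T \<Longrightarrow> f s = 0"
  shows "f \<in> fs.span ((\<lambda>t s. if s = t then 1 else 0) ` T)"
proof -
  have "f = (\<Sum>t\<in>T. (\<lambda>s. f t * (if s = t then 1 else 0)))"
  proof
    fix s
    have "sum (\<lambda>t s. f t * (if s = t then 1 else 0)) T s = (\<Sum>t\<in>T. f t * (if s = t then 1 else 0))"
      by (induction T rule: infinite_finite_induct) (auto simp: plus_fun_def zero_fun_def)
    also have "\<dots> = (\<Sum>t\<in>T. if s = t then f t else 0)" by (rule sum.cong) auto
    also have "\<dots> = f s" using assms by auto
    finally show "f s = sum (\<lambda>t s. f t * (if s = t then 1 else 0)) T s" by simp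
  qed
  also have "\<dots> \<in> fs.span ((\<lambda>t s. if s = t then 1 else 0) ` T)"
    by (intro fs.span_sum fs.span_scale fs.span_base) auto
  finally show ?thesis .
qed

text \<open>\<open>coef\<close> identifies \<open>A\<close> with the functions on the paths of length less than \<open>k\<close>,
  multiplied by convolution. It lets all computations avoid the cosets in the quotient ring.\<close>

locale trunc_alg = fin_digraph Q + A?: ring A
  for Q :: "('v, 'e) pre_digraph" and A :: "('a, 'c) ring_scheme" +
  fixes k :: nat and coef :: "'a \<Rightarrow> 'v \<times> 'e list \<Rightarrow> 'k::field"
  assumes k_pos: "0 < k"
    and coef_bij: "bij_betw coef (carrier A) {c. \<forall>u p. c (u, p) \<noteq> 0 \<longrightarrow> walk Q u p \<and> length p < k}"
    and coef_add: "\<lbrakk>a \<in> carrier A; b \<in> carrier A\<rbrakk> \<Longrightarrow> coef (a \<oplus>\<^bsub>A\<^esub> b) t = coef a t + coef b t"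
    and coef_mult: "\<lbrakk>a \<in> carrier A; b \<in> carrier A; length p < k\<rbrakk> \<Longrightarrow>
      coef (a \<otimes>\<^bsub>A\<^esub> b) (u, p) = splitsum (\<lambda>l s. coef a (u, l) * coef b (tgt Q u l, s)) p"
    and coef_one: "coef \<one>\<^bsub>A\<^esub> (u, p) = (if u \<in> verts Q \<and> p = [] then 1 else 0)"
begin

lemma coef_inj: "a \<in> carrier A \<Longrightarrow> b \<in> carrier A \<Longrightarrow> (\<And>u p. coef a (u, p) = coef b (u, p)) \<Longrightarrow> a = b"
  using coef_bij by (auto simp: bij_betw_def inj_on_def fun_eq_iff)

lemma coef_supp: "a \<in> carrier A \<Longrightarrow> coef a (u, p) \<noteq> 0 \<Longrightarrow> walk Q u p"
  and coef_len: "a \<in> carrier A \<Longrightarrow> coef a (u, p) \<noteq> 0 \<Longrightarrow> length p < k"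
  using coef_bij by (auto simp: bij_betw_def)

lemma coef_zero [simp]: "coef \<zero>\<^bsub>A\<^esub> t = 0"
  using coef_add[of "\<zero>\<^bsub>A\<^esub>" "\<zero>\<^bsub>A\<^esub>" t] by (metis A.l_zero A.zero_closed add_cancel_right_right)

lemma coef_minus: "a \<in> carrier A \<Longrightarrow> coef (\<ominus>\<^bsub>A\<^esub> a) t = - coef a t"
  using coef_add[of a "\<ominus>\<^bsub>A\<^esub> a" t] by (simp add: A.r_neg eq_neg_iff_add_eq_0 add.commute)

lemma coef_diff: "a \<in> carrier A \<Longrightarrow> b \<in> carrier A \<Longrightarrow> coef (a \<ominus>\<^bsub>A\<^esub> b) t = coef a t - coef b t"
  by (simp add: a_minus_def coef_add coef_minus)

definition el :: "('v \<times> 'e list \<Rightarrow> 'k) \<Rightarrow> 'a" where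
  "el c = the_inv_into (carrier A) coef c"

lemma el:
  assumes "\<And>u p. c (u, p) \<noteq> 0 \<Longrightarrow> walk Q u p \<and> length p < k"
  shows el_closed: "el c \<in> carrier A" and coef_el: "coef (el c) = c"
proof -
  have "c \<in> coef ` carrier A" using assms coef_bij by (auto simp: bij_betw_def)
  then show "el c \<in> carrier A" "coef (el c) = c"
    using coef_bij unfolding el_def bij_betw_def
    by (blast intro: the_inv_into_into, blast intro: f_the_inv_into_f)
qed

lemma coef_finsum:
  assumes "f \<in> S \<rightarrow> carrier A"
  shows "finite S \<Longrightarrow> coef (\<Oplus>\<^bsub>A\<^esub>s\<in>S. f s) t = (\<Sum>s\<in>S. coef (f s) t)"
  using assms by (induction S rule: infinite_finite_induct) (auto simp: Pi_iff coef_add)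

definition idem :: "'v \<Rightarrow> 'a" where
  "idem u = el (\<lambda>(w, p). if w = u \<and> p = [] then 1 else 0)"

lemma idem:
  assumes "u \<in> verts Q"
  shows idem_closed: "idem u \<in> carrier A" and coef_idem: "coef (idem u) (w, p) = (if w = u \<and> p = [] then 1 else 0)"
proof -
  have *: "walk Q w p \<and> length p < k" if "(\<lambda>(w, p). if w = u \<and> p = [] then 1 else (0::'k)) (w, p) \<noteq> 0" for w p
    using that assms k_pos by (auto split: if_splits)
  show "idem u \<in> carrier A" unfolding idem_def by (rule el_closed[OF *])
  show "coef (idem u) (w, p) = (if w = u \<and> p = [] then 1 else 0)"
    unfolding idem_def by (subst coef_el[OF *]) auto
qed

lemma one_eq_sum_idem: "\<one>\<^bsub>A\<^esub> = (\<Oplus>\<^bsub>A\<^esub>u\<in>verts Q. idem u)"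
proof (rule coef_inj)
  show "(\<Oplus>\<^bsub>A\<^esub>u\<in>verts Q. idem u) \<in> carrier A" by (auto intro!: A.finsum_closed idem_closed)
  fix w p
  have "coef (\<Oplus>\<^bsub>A\<^esub>u\<in>verts Q. idem u) (w, p) = (\<Sum>u\<in>verts Q. coef (idem u) (w, p))"
    by (rule coef_finsum) (auto intro: idem_closed)
  also have "\<dots> = (\<Sum>u\<in>verts Q. if w = u then (if p = [] then 1 else 0) else 0)"
    by (rule sum.cong) (auto simp: coef_idem)
  finally show "coef \<one>\<^bsub>A\<^esub> (w, p) = coef (\<Oplus>\<^bsub>A\<^esub>u\<in>verts Q. idem u) (w, p)"
    by (simp add: coef_one)
qed auto

text \<open>The locale knows \<open>A\<close> only as a ring. The scalar \<open>c\<close> is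
  recovered as \<open>c\<close> times the identity, so submodules are closed under scalars because
  they are closed under the action.\<close>

definition scal :: "'k \<Rightarrow> 'a" where
  "scal c = el (\<lambda>(w, p). if w \<in> verts Q \<and> p = [] then c else 0)"

lemma scal_closed: "scal c \<in> carrier A" and coef_scal: "coef (scal c) (w, p) = (if w \<in> verts Q \<and> p = [] then c else 0)"
proof -
  have *: "walk Q w p \<and> length p < k" if "(\<lambda>(w, p). if w \<in> verts Q \<and> p = [] then c else (0::'k)) (w, p) \<noteq> 0" for w p
    using that k_pos by (auto split: if_splits)
  show "scal c \<in> carrier A" unfolding scal_def by (rule el_closed[OF *])
  show "coef (scal c) (w, p) = (if w \<in> verts Q \<and> p = [] then c else 0)"
    unfolding scal_def by (subst coef_el[OF *]) auto
qed

text \<open>\<open>FM I v r\<close> is the direct sum over \<open>i \<in> I\<close> of the modules \<open>e A / e J\<^sup>r\<close>, where \<open>e\<close> is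
  the idempotent of the vertex \<open>v i\<close>.\<close>

definition FM :: "'i set \<Rightarrow> ('i \<Rightarrow> 'v) \<Rightarrow> nat \<Rightarrow> ('a, 'i \<times> 'e list \<Rightarrow> 'k) rmodule" where
  "FM I v r = \<lparr>carrier = {x. \<forall>i p. x (i, p) \<noteq> 0 \<longrightarrow> i \<in> I \<and> walk Q (v i) p \<and> length p < r},
     monoid.mult = undefined, monoid.one = undefined,
     ring.zero = (\<lambda>_. 0), ring.add = (\<lambda>x y t. x t + y t),
     ract = (\<lambda>x a (i, p). if length p < r
       then splitsum (\<lambda>l s. x (i, l) * coef a (tgt Q (v i) l, s)) p else 0)\<rparr>"

lemma FM_simps [simp]:
  "\<zero>\<^bsub>FM I v r\<^esub> = (\<lambda>_. 0)" "x \<oplus>\<^bsub>FM I v r\<^esub> y = (\<lambda>t. x t + y t)"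
  by (simp_all add: FM_def)

lemma FM_carrier: "x \<in> carrier (FM I v r) \<longleftrightarrow> (\<forall>i p. x (i, p) \<noteq> 0 \<longrightarrow> i \<in> I \<and> walk Q (v i) p \<and> length p < r)"
  by (simp add: FM_def)

lemma FM_ract: "(x \<odot>r\<^bsub>FM I v r\<^esub> a) (i, p) = (if length p < r
       then splitsum (\<lambda>l s. x (i, l) * coef a (tgt Q (v i) l, s)) p else 0)"
  by (simp add: FM_def)

lemma FM_right_module:
  assumes "r \<le> k"
  shows "right_module A (FM I v r)"
proof -
  have "abelian_group (FM I v r)"
  proof (rule abelian_groupI)
    fix x assume "x \<in> carrier (FM I v r)"
    then show "\<exists>y\<in>carrier (FM I v r). y \<oplus>\<^bsub>FM I v r\<^esub> x = \<zero>\<^bsub>FM I v r\<^esub>"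
      by (intro bexI[of _ "\<lambda>t. - x t"]) (auto simp: FM_carrier)
  next
    fix x y assume "x \<in> carrier (FM I v r)" "y \<in> carrier (FM I v r)"
    then show "x \<oplus>\<^bsub>FM I v r\<^esub> y \<in> carrier (FM I v r)"
      unfolding FM_carrier FM_simps by (metis add.left_neutral)
  qed (auto simp: FM_carrier algebra_simps)
  then show ?thesis
  proof (intro right_module.intro right_module_axioms.intro A.ring_axioms)
    fix x a assume x: "x \<in> carrier (FM I v r)" and a: "a \<in> carrier A"
    show "x \<odot>r\<^bsub>FM I v r\<^esub> a \<in> carrier (FM I v r)"
      unfolding FM_carrier
    proof (intro allI impI)
      fix i p assume *: "(x \<odot>r\<^bsub>FM I v r\<^esub> a) (i, p) \<noteq> 0"
      then have r: "length p < r" by (simp add: FM_ract split: if_splits)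
      with * have "splitsum (\<lambda>l s. x (i, l) * coef a (tgt Q (v i) l, s)) p \<noteq> 0" by (simp add: FM_ract)
      then obtain l s where ls: "l @ s = p" "x (i, l) * coef a (tgt Q (v i) l, s) \<noteq> 0"
        by (rule splitsum_neq_0E)
      with x coef_supp[OF a, of "tgt Q (v i) l" s] r show "i \<in> I \<and> walk Q (v i) p \<and> length p < r"
        by (auto simp: FM_carrier)
    qed
    fix b assume b: "b \<in> carrier A"
    show "x \<odot>r\<^bsub>FM I v r\<^esub> (a \<oplus>\<^bsub>A\<^esub> b) = x \<odot>r\<^bsub>FM I v r\<^esub> a \<oplus>\<^bsub>FM I v r\<^esub> x \<odot>r\<^bsub>FM I v r\<^esub> b"
      using a b by (auto simp: FM_ract coef_add distrib_left splitsum_add)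
    show "x \<odot>r\<^bsub>FM I v r\<^esub> (a \<otimes>\<^bsub>A\<^esub> b) = (x \<odot>r\<^bsub>FM I v r\<^esub> a) \<odot>r\<^bsub>FM I v r\<^esub> b"
    proof (rule ext, clarify)
      fix i p
      show "(x \<odot>r\<^bsub>FM I v r\<^esub> (a \<otimes>\<^bsub>A\<^esub> b)) (i, p) = ((x \<odot>r\<^bsub>FM I v r\<^esub> a) \<odot>r\<^bsub>FM I v r\<^esub> b) (i, p)"
      proof (cases "length p < r")
        case True
        let ?g = "\<lambda>m n s. x (i, m) * coef a (tgt Q (v i) m, n) * coef b (tgt Q (tgt Q (v i) m) n, s)"
        have "(x \<odot>r\<^bsub>FM I v r\<^esub> (a \<otimes>\<^bsub>A\<^esub> b)) (i, p) = splitsum (\<lambda>m s. splitsum (\<lambda>n c. ?g m n c) s) p"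
          unfolding FM_ract if_P[OF True]
        proof (rule splitsum_cong)
          fix m s assume "m @ s = p"
          \<comment> \<open>The product formula \<open>coef_mult\<close> is restricted to paths
            shorter than \<open>k\<close>; here \<open>r \<le> k\<close> enters.\<close>
          then have "length s < k" using True assms by auto
          then show "x (i, m) * coef (a \<otimes>\<^bsub>A\<^esub> b) (tgt Q (v i) m, s) = splitsum (\<lambda>n c. ?g m n c) s"
            by (simp only: coef_mult[OF a b] mult.assoc
                splitsum_mult_left[of "x (i, m)" "\<lambda>n c. coef a (tgt Q (v i) m, n) * coef b (tgt Q (tgt Q (v i) m) n, c)"])
        qed
        also have "\<dots> = splitsum (\<lambda>l s. splitsum (\<lambda>m n. ?g m n s) l) p" by (rule splitsum_assoc[symmetric])
        also have "\<dots> = splitsum (\<lambda>l s. splitsum (\<lambda>m n. x (i, m) * coef a (tgt Q (v i) m, n)) l * coef b (tgt Q (v i) l, s)) p"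
          by (intro splitsum_cong) (auto simp flip: splitsum_mult_right intro!: splitsum_cong)
        also have "\<dots> = ((x \<odot>r\<^bsub>FM I v r\<^esub> a) \<odot>r\<^bsub>FM I v r\<^esub> b) (i, p)"
          using True by (subst FM_ract) (auto simp: FM_ract intro!: splitsum_cong)
        finally show ?thesis .
      qed (simp add: FM_ract)
    qed
  next
    fix x y a assume "x \<in> carrier (FM I v r)" "y \<in> carrier (FM I v r)"
    show "(x \<oplus>\<^bsub>FM I v r\<^esub> y) \<odot>r\<^bsub>FM I v r\<^esub> a = x \<odot>r\<^bsub>FM I v r\<^esub> a \<oplus>\<^bsub>FM I v r\<^esub> y \<odot>r\<^bsub>FM I v r\<^esub> a"
      by (auto simp: FM_ract distrib_right splitsum_add)
  next
    fix x assume x: "x \<in> carrier (FM I v r)"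
    show "x \<odot>r\<^bsub>FM I v r\<^esub> \<one>\<^bsub>A\<^esub> = x"
    proof (rule ext, clarify)
      fix i p
      have "splitsum (\<lambda>l s. x (i, l) * coef \<one>\<^bsub>A\<^esub> (tgt Q (v i) l, s)) p = x (i, p) * coef \<one>\<^bsub>A\<^esub> (tgt Q (v i) p, [])"
        by (rule splitsum_last) (simp add: coef_one)
      moreover have "walk Q (v i) p \<and> length p < r" if "x (i, p) \<noteq> 0" using x that by (auto simp: FM_carrier)
      ultimately show "(x \<odot>r\<^bsub>FM I v r\<^esub> \<one>\<^bsub>A\<^esub>) (i, p) = x (i, p)"
        using walk_target[of "v i" p] by (auto simp: FM_ract coef_one)
    qed
  qed
qed

lemma FM_finsum:
  assumes "r \<le> k" "f \<in> S \<rightarrow> carrier (FM I v r)"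
  shows "finite S \<Longrightarrow> (\<Oplus>\<^bsub>FM I v r\<^esub>s\<in>S. f s) t = (\<Sum>s\<in>S. f s t)"
proof -
  interpret F: right_module A "FM I v r" by (rule FM_right_module) fact
  show "finite S \<Longrightarrow> ?thesis" using assms(2)
    by (induction S rule: infinite_finite_induct) (auto simp: Pi_iff F.M.finsum_insert)
qed

lemma FM_minus:
  assumes "r \<le> k" "x \<in> carrier (FM I v r)" "y \<in> carrier (FM I v r)"
  shows "(x \<ominus>\<^bsub>FM I v r\<^esub> y) t = x t - y t" "(\<ominus>\<^bsub>FM I v r\<^esub> y) t = - y t"
proof -
  interpret F: right_module A "FM I v r" by (rule FM_right_module) fact
  have "y t + (\<ominus>\<^bsub>FM I v r\<^esub> y) t = 0" using fun_cong[OF F.M.r_neg[OF assms(3)], of t] by simp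
  then show *: "(\<ominus>\<^bsub>FM I v r\<^esub> y) t = - y t" by (simp add: eq_neg_iff_add_eq_0 add.commute)
  show "(x \<ominus>\<^bsub>FM I v r\<^esub> y) t = x t - y t" by (simp add: a_minus_def *)
qed

section \<open>Generators, coordinates and homomorphisms out of \<open>FM\<close>\<close>

definition bas :: "'i \<Rightarrow> 'i \<times> 'e list \<Rightarrow> 'k" where
  "bas i = (\<lambda>(j, p). if j = i \<and> p = [] then 1 else 0)"

lemma bas_closed: "0 < r \<Longrightarrow> i \<in> I \<Longrightarrow> v i \<in> verts Q \<Longrightarrow> bas i \<in> carrier (FM I v r)"
  by (auto simp: bas_def FM_carrier)

text \<open>The coordinate \<open>i\<close> of \<open>y\<close>, lifted from
  \<open>e A / e J\<^sup>r\<close> to \<open>e A\<close> by filling up with zeros, where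
  \<open>e\<close> is the idempotent of \<open>v i\<close>. The lift is additive but in general not
  compatible with the action.\<close>

definition cmp :: "('i \<Rightarrow> 'v) \<Rightarrow> ('i \<times> 'e list \<Rightarrow> 'k) \<Rightarrow> 'i \<Rightarrow> 'a" where
  "cmp v y i = el (\<lambda>(u, p). if u = v i then y (i, p) else 0)"

lemma cmp:
  assumes "r \<le> k" "y \<in> carrier (FM I v r)"
  shows cmp_closed: "cmp v y i \<in> carrier A"
    and coef_cmp: "coef (cmp v y i) (u, p) = (if u = v i then y (i, p) else 0)"
proof -
  have *: "walk Q u p \<and> length p < k" if "(\<lambda>(u, p). if u = v i then y (i, p) else 0) (u, p) \<noteq> 0" for u p
    using that assms by (fastforce simp: FM_carrier split: if_splits)
  show "cmp v y i \<in> carrier A" unfolding cmp_def by (rule el_closed[OF *])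
  show "coef (cmp v y i) (u, p) = (if u = v i then y (i, p) else 0)"
    unfolding cmp_def by (subst coef_el[OF *]) auto
qed

lemma cmp_add:
  assumes "r \<le> k" "x \<in> carrier (FM I v r)" "y \<in> carrier (FM I v r)"
  shows "cmp v (\<lambda>t. x t + y t) i = cmp v x i \<oplus>\<^bsub>A\<^esub> cmp v y i"
proof -
  interpret F: right_module A "FM I v r" by (rule FM_right_module) fact
  have "(\<lambda>t. x t + y t) \<in> carrier (FM I v r)" using F.M.a_closed[OF assms(2,3)] by simp
  then show ?thesis using assms by (intro coef_inj) (auto simp: cmp coef_add)
qed

lemma bas_ract:
  assumes "0 < r" "r \<le> k" "i \<in> I"
  shows "(bas i \<odot>r\<^bsub>FM I v r\<^esub> a) (j, p) = (if j = i \<and> length p < r then coef a (v i, p) else 0)"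
proof -
  have "splitsum (\<lambda>l s. bas i (j, l) * coef a (tgt Q (v j) l, s)) p = bas i (j, []) * coef a (v j, p)"
    by (subst splitsum_first) (auto simp: bas_def)
  then show ?thesis by (auto simp: FM_ract bas_def)
qed

lemma bas_idem:
  assumes "0 < r" "r \<le> k" "i \<in> I" "v i \<in> verts Q"
  shows "bas i \<odot>r\<^bsub>FM I v r\<^esub> idem (v i) = bas i"
proof (rule ext, clarify)
  fix j p
  show "(bas i \<odot>r\<^bsub>FM I v r\<^esub> idem (v i)) (j, p) = bas i (j, p)"
    by (subst bas_ract) (use assms in \<open>auto simp: coef_idem bas_def\<close>)
qed

lemma FM_expand:
  assumes "0 < r" "r \<le> k" "finite I" "\<And>i. i \<in> I \<Longrightarrow> v i \<in> verts Q" "y \<in> carrier (FM I v r)"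
  shows "y = (\<Oplus>\<^bsub>FM I v r\<^esub>i\<in>I. bas i \<odot>r\<^bsub>FM I v r\<^esub> cmp v y i)"
proof -
  interpret F: right_module A "FM I v r" by (rule FM_right_module) fact
  have c: "(\<lambda>i. bas i \<odot>r\<^bsub>FM I v r\<^esub> cmp v y i) \<in> I \<rightarrow> carrier (FM I v r)"
    using assms by (auto intro!: F.ract_closed bas_closed cmp_closed)
  show ?thesis
  proof (rule ext, clarify)
    fix j p
    have "(\<Oplus>\<^bsub>FM I v r\<^esub>i\<in>I. bas i \<odot>r\<^bsub>FM I v r\<^esub> cmp v y i) (j, p)
      = (\<Sum>i\<in>I. (bas i \<odot>r\<^bsub>FM I v r\<^esub> cmp v y i) (j, p))"
      by (rule FM_finsum[OF assms(2) c assms(3)])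
    also have "\<dots> = (\<Sum>i\<in>I. if j = i then (if length p < r then y (j, p) else 0) else 0)"
      using assms by (intro sum.cong) (auto simp: bas_ract coef_cmp)
    also have "\<dots> = y (j, p)" using assms(3,5) by (auto simp: FM_carrier)
    finally show "y (j, p) = (\<Oplus>\<^bsub>FM I v r\<^esub>i\<in>I. bas i \<odot>r\<^bsub>FM I v r\<^esub> cmp v y i) (j, p)" by simp
  qed
qed

lemma FM_hom_expand:
  assumes "0 < r" "r \<le> k" "finite I" "\<And>i. i \<in> I \<Longrightarrow> v i \<in> verts Q"
    and "right_module A N" "h \<in> rmod_hom A (FM I v r) N" "y \<in> carrier (FM I v r)"
  shows "h y = (\<Oplus>\<^bsub>N\<^esub>i\<in>I. h (bas i) \<odot>r\<^bsub>N\<^esub> cmp v y i)"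
proof -
  interpret F: right_module A "FM I v r" by (rule FM_right_module) fact
  interpret N: right_module A N by fact
  note h = rmod_homD[OF assms(6)]
  have b: "bas i \<in> carrier (FM I v r)" if "i \<in> I" for i using assms that by (intro bas_closed)
  have "h y = h (\<Oplus>\<^bsub>FM I v r\<^esub>i\<in>I. bas i \<odot>r\<^bsub>FM I v r\<^esub> cmp v y i)"
    using FM_expand[OF assms(1-4,7)] by simp
  also have "\<dots> = (\<Oplus>\<^bsub>N\<^esub>i\<in>I. h (bas i \<odot>r\<^bsub>FM I v r\<^esub> cmp v y i))"
    using assms b by (intro rmod_hom_finsum[OF F.right_module_axioms assms(5,6,3)]) (auto intro!: F.ract_closed cmp_closed)
  also have "\<dots> = (\<Oplus>\<^bsub>N\<^esub>i\<in>I. h (bas i) \<odot>r\<^bsub>N\<^esub> cmp v y i)"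
    using b h(1) h(3)[OF b cmp_closed[OF assms(2,7)]] cmp_closed[OF assms(2,7)]
    by (intro N.M.finsum_cong') (auto intro!: N.ract_closed)
  finally show ?thesis .
qed

text \<open>\<open>N J\<^sup>r = 0\<close>, where \<open>J\<^sup>r\<close> consists of the elements
  without terms of length below \<open>r\<close>.\<close>

definition killed :: "nat \<Rightarrow> ('a, 'm) rmodule \<Rightarrow> bool" where
  "killed r N \<longleftrightarrow> (\<forall>x\<in>carrier N. \<forall>a\<in>carrier A.
     (\<forall>u p. length p < r \<longrightarrow> coef a (u, p) = 0) \<longrightarrow> x \<odot>r\<^bsub>N\<^esub> a = \<zero>\<^bsub>N\<^esub>)"

lemma killed_k: "right_module A N \<Longrightarrow> killed k N"
proof -
  assume "right_module A N"
  then interpret N: right_module A N .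
  have "a = \<zero>\<^bsub>A\<^esub>" if "a \<in> carrier A" "\<forall>u p. length p < k \<longrightarrow> coef a (u, p) = 0" for a
  proof (rule coef_inj)
    fix u p
    show "coef a (u, p) = coef \<zero>\<^bsub>A\<^esub> (u, p)"
      using that coef_len[OF that(1), of u p] by (cases "length p < k") auto
  qed (use that in auto)
  then show "killed k N" unfolding killed_def using N.ract_zero_right by blast
qed

lemma killed_FM: "r \<le> k \<Longrightarrow> killed r (FM I v r)"
  by (fastforce simp: killed_def FM_ract fun_eq_iff intro: splitsum_eq_0)

lemma killed_eq:
  assumes "right_module A N" "killed r N" "x \<in> carrier N" "a \<in> carrier A" "b \<in> carrier A"
    and "\<And>u p. length p < r \<Longrightarrow> coef a (u, p) = coef b (u, p)"
  shows "x \<odot>r\<^bsub>N\<^esub> a = x \<odot>r\<^bsub>N\<^esub> b"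
proof -
  interpret N: right_module A N by fact
  have "x \<odot>r\<^bsub>N\<^esub> (a \<ominus>\<^bsub>A\<^esub> b) = \<zero>\<^bsub>N\<^esub>"
    using assms by (auto simp: killed_def coef_diff)
  moreover have "a = b \<oplus>\<^bsub>A\<^esub> (a \<ominus>\<^bsub>A\<^esub> b)" using assms(4,5) by (simp add: A.minus_eq A.a_lcomm A.r_neg)
  ultimately show ?thesis using assms(3-5) N.ract_r_distr[of x b "a \<ominus>\<^bsub>A\<^esub> b"] N.ract_closed by simp
qed

text \<open>The candidate for the homomorphism \<open>FM I v r \<rightarrow> N\<close> with
  prescribed values on generators. Since \<open>cmp v y i\<close> lies in \<open>e A\<close>, the
  value at \<open>bas i\<close> is \<open>xs i\<close> if \<open>xs i\<close> is fixed by the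
  idempotent \<open>e\<close> of \<open>v i\<close>.\<close>

definition lin :: "('a, 'm) rmodule \<Rightarrow> 'i set \<Rightarrow> ('i \<Rightarrow> 'v) \<Rightarrow> ('i \<Rightarrow> 'm) \<Rightarrow> ('i \<times> 'e list \<Rightarrow> 'k) \<Rightarrow> 'm" where
  "lin N I v xs y = (\<Oplus>\<^bsub>N\<^esub>i\<in>I. xs i \<odot>r\<^bsub>N\<^esub> cmp v y i)"

lemma lin_hom:
  assumes r: "r \<le> k" "finite I" and N: "right_module A N" "killed r N"
    and xs: "\<And>i. i \<in> I \<Longrightarrow> xs i \<in> carrier N"
  shows "lin N I v xs \<in> rmod_hom A (FM I v r) N"
proof -
  interpret F: right_module A "FM I v r" by (rule FM_right_module) fact
  interpret N: right_module A N by fact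
  have cl: "xs i \<odot>r\<^bsub>N\<^esub> cmp v y i \<in> carrier N" if "i \<in> I" "y \<in> carrier (FM I v r)" for i y
    using that xs r by (auto intro!: N.ract_closed cmp_closed)
  show ?thesis
  proof (rule rmod_homI)
    show "lin N I v xs x \<in> carrier N" if "x \<in> carrier (FM I v r)" for x
      unfolding lin_def using cl that by (intro N.M.finsum_closed) auto
    fix x y assume xy: "x \<in> carrier (FM I v r)" "y \<in> carrier (FM I v r)"
    have "lin N I v xs (x \<oplus>\<^bsub>FM I v r\<^esub> y) = (\<Oplus>\<^bsub>N\<^esub>i\<in>I. xs i \<odot>r\<^bsub>N\<^esub> cmp v x i \<oplus>\<^bsub>N\<^esub> xs i \<odot>r\<^bsub>N\<^esub> cmp v y i)"
      unfolding lin_def using xs xy r cl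
      by (intro N.M.finsum_cong')
        (auto simp: cmp_add[OF r(1) xy] intro!: N.ract_r_distr cmp_closed[of r])
    then show "lin N I v xs (x \<oplus>\<^bsub>FM I v r\<^esub> y) = lin N I v xs x \<oplus>\<^bsub>N\<^esub> lin N I v xs y"
      unfolding lin_def using cl xy by (subst (asm) N.M.finsum_addf) auto
  next
    fix x a assume x: "x \<in> carrier (FM I v r)" and a: "a \<in> carrier A"
    have "xs i \<odot>r\<^bsub>N\<^esub> cmp v (x \<odot>r\<^bsub>FM I v r\<^esub> a) i = xs i \<odot>r\<^bsub>N\<^esub> cmp v x i \<odot>r\<^bsub>N\<^esub> a" if i: "i \<in> I" for i
    proof -
      \<comment> \<open>The lift of a product and the product with the lift agree only on paths
        shorter than \<open>r\<close>, which suffices because \<open>J\<^sup>r\<close> acts as zero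
        on \<open>N\<close>.\<close>
      have "xs i \<odot>r\<^bsub>N\<^esub> cmp v (x \<odot>r\<^bsub>FM I v r\<^esub> a) i = xs i \<odot>r\<^bsub>N\<^esub> (cmp v x i \<otimes>\<^bsub>A\<^esub> a)"
      proof (rule killed_eq[OF N xs[OF i]])
        show "cmp v (x \<odot>r\<^bsub>FM I v r\<^esub> a) i \<in> carrier A" by (rule cmp_closed[OF r(1) F.ract_closed[OF x a]])
        show "cmp v x i \<otimes>\<^bsub>A\<^esub> a \<in> carrier A" using cmp_closed[OF r(1) x] a by simp
        fix u and p :: "'e list" assume "length p < r"
        then show "coef (cmp v (x \<odot>r\<^bsub>FM I v r\<^esub> a) i) (u, p) = coef (cmp v x i \<otimes>\<^bsub>A\<^esub> a) (u, p)"
          using r(1) x a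
          by (auto simp: coef_cmp[OF r(1) F.ract_closed[OF x a]] coef_mult cmp_closed[OF r(1) x]
              coef_cmp[OF r(1) x] FM_ract splitsum_zero)
      qed
      then show ?thesis using i xs a cmp_closed[OF r(1) x] by (simp add: N.ract_assoc)
    qed
    then have "lin N I v xs (x \<odot>r\<^bsub>FM I v r\<^esub> a) = (\<Oplus>\<^bsub>N\<^esub>i\<in>I. xs i \<odot>r\<^bsub>N\<^esub> cmp v x i \<odot>r\<^bsub>N\<^esub> a)"
      unfolding lin_def using cl x a by (intro N.M.finsum_cong') (auto intro!: N.ract_closed[OF cl])
    also have "\<dots> = lin N I v xs x \<odot>r\<^bsub>N\<^esub> a"
      unfolding lin_def using cl x a by (subst N.ract_finsum) auto
    finally show "lin N I v xs (x \<odot>r\<^bsub>FM I v r\<^esub> a) = lin N I v xs x \<odot>r\<^bsub>N\<^esub> a" .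
  qed
qed

lemma lin_bas:
  assumes r: "0 < r" "r \<le> k" "finite I" "\<And>i. i \<in> I \<Longrightarrow> v i \<in> verts Q" and N: "right_module A N"
    and xs: "\<And>i. i \<in> I \<Longrightarrow> xs i \<in> carrier N" "\<And>i. i \<in> I \<Longrightarrow> xs i \<odot>r\<^bsub>N\<^esub> idem (v i) = xs i"
    and i: "i \<in> I"
  shows "lin N I v xs (bas i) = xs i"
proof -
  interpret N: right_module A N by fact
  have b: "bas i \<in> carrier (FM I v r)" using r i by (intro bas_closed)
  have c: "cmp v (bas i) j = (if j = i then idem (v i) else \<zero>\<^bsub>A\<^esub>)" if "j \<in> I" for j
    using b r i that
    by (intro coef_inj) (auto simp: cmp[OF r(2)] idem bas_def)
  have "lin N I v xs (bas i) = (\<Oplus>\<^bsub>N\<^esub>j\<in>I. if i = j then xs j else \<zero>\<^bsub>N\<^esub>)"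
    unfolding lin_def using c xs i by (intro N.M.finsum_cong') auto
  then show ?thesis using N.M.add.finprod_singleton[OF i r(3), of xs] xs by (simp add: finsum_def)
qed

text \<open>\<open>FM I v r\<close> is projective relative to the modules annihilated by
  \<open>J\<^sup>r\<close>. For \<open>r = k\<close> these are all modules; smaller \<open>r\<close>
  serves to analyse the summands of \<open>FM I v r\<close>.\<close>

lemma FM_lift:
  assumes r: "0 < r" "r \<le> k" "finite I" "\<And>i. i \<in> I \<Longrightarrow> v i \<in> verts Q"
    and M: "right_module A M" "killed r M" and N: "right_module A N"
    and f: "f \<in> rmod_hom A (FM I v r) N" and g: "g \<in> rmod_hom A M N" "g ` carrier M = carrier N"
  obtains h where "h \<in> rmod_hom A (FM I v r) M" "\<And>y. y \<in> carrier (FM I v r) \<Longrightarrow> g (h y) = f y"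
proof -
  interpret F: right_module A "FM I v r" by (rule FM_right_module) fact
  interpret M: right_module A M by fact
  interpret N: right_module A N by fact
  have b: "bas i \<in> carrier (FM I v r)" if "i \<in> I" for i using r that by (intro bas_closed)
  have "\<exists>m\<in>carrier M. g m = f (bas i)" if "i \<in> I" for i
    using rmod_homD(1)[OF f b[OF that]] g(2) by (metis imageE)
  then obtain m where m: "\<And>i. i \<in> I \<Longrightarrow> m i \<in> carrier M" "\<And>i. i \<in> I \<Longrightarrow> g (m i) = f (bas i)" by metis
  let ?h = "lin M I v (\<lambda>i. m i \<odot>r\<^bsub>M\<^esub> idem (v i))"
  have me: "m i \<odot>r\<^bsub>M\<^esub> idem (v i) \<in> carrier M" if "i \<in> I" for i
    using m r that by (auto intro!: M.ract_closed idem_closed)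
  have ge: "g (m i \<odot>r\<^bsub>M\<^esub> idem (v i)) = f (bas i)" if "i \<in> I" for i
  proof -
    note e = idem_closed[OF r(4)[OF that]]
    have "g (m i \<odot>r\<^bsub>M\<^esub> idem (v i)) = f (bas i) \<odot>r\<^bsub>N\<^esub> idem (v i)"
      using rmod_homD(3)[OF g(1) m(1)[OF that] e] m(2)[OF that] by simp
    also have "\<dots> = f (bas i)"
      using rmod_homD(3)[OF f b[OF that] e] bas_idem[where v = v, OF r(1,2) that r(4)[OF that]] by simp
    finally show ?thesis .
  qed
  show ?thesis
  proof
    show h: "?h \<in> rmod_hom A (FM I v r) M" by (rule lin_hom[OF r(2,3) M me])
    fix y assume y: "y \<in> carrier (FM I v r)"
    have cl: "cmp v y i \<in> carrier A" for i by (rule cmp_closed[OF r(2) y])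
    have "g (?h y) = (\<Oplus>\<^bsub>N\<^esub>i\<in>I. g (m i \<odot>r\<^bsub>M\<^esub> idem (v i) \<odot>r\<^bsub>M\<^esub> cmp v y i))"
      unfolding lin_def using me cl by (intro rmod_hom_finsum[OF M(1) N g(1) r(3)]) (auto intro!: M.ract_closed[OF me])
    also have "\<dots> = (\<Oplus>\<^bsub>N\<^esub>i\<in>I. f (bas i) \<odot>r\<^bsub>N\<^esub> cmp v y i)"
      using me cl ge rmod_homD(3)[OF g(1)] rmod_homD(1)[OF f] b
      by (intro N.M.finsum_cong') (auto intro!: N.ract_closed)
    also have "\<dots> = f y" by (rule FM_hom_expand[OF r N f y, symmetric])
    finally show "g (?h y) = f y" .
  qed
qed

lemma FM_fgm:
  assumes "0 < r" "r \<le> k" "finite I" "\<And>i. i \<in> I \<Longrightarrow> v i \<in> verts Q"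
  shows "fgm A (FM I v r)"
proof -
  interpret F: right_module A "FM I v r" by (rule FM_right_module) fact
  have "fin_gen A (FM I v r)"
  proof (rule F.fin_genI[of "bas ` I"])
    show "finite (bas ` I)" "bas ` I \<subseteq> carrier (FM I v r)" using assms by (auto intro!: bas_closed)
    fix L assume L: "submodule A (FM I v r) L" "bas ` I \<subseteq> L"
    show "carrier (FM I v r) \<subseteq> L"
    proof
      fix y assume y: "y \<in> carrier (FM I v r)"
      have "(\<Oplus>\<^bsub>FM I v r\<^esub>i\<in>I. bas i \<odot>r\<^bsub>FM I v r\<^esub> cmp v y i) \<in> L"
        using L y assms by (intro F.submodule_finsum) (auto intro!: F.submoduleD(5)[OF L(1)] cmp_closed)
      then show "y \<in> L" using FM_expand[OF assms y] by simp
    qed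
  qed
  then show ?thesis by (simp add: fgm_def F.right_module_axioms)
qed

lemma FM_scal:
  assumes "r \<le> k" "x \<in> carrier (FM I v r)"
  shows "x \<odot>r\<^bsub>FM I v r\<^esub> scal c = (\<lambda>t. c * x t)"
proof (rule ext, clarify)
  fix i p
  have "splitsum (\<lambda>l s. x (i, l) * coef (scal c) (tgt Q (v i) l, s)) p
    = x (i, p) * coef (scal c) (tgt Q (v i) p, [])"
    by (rule splitsum_last) (simp add: coef_scal)
  then show "(x \<odot>r\<^bsub>FM I v r\<^esub> scal c) (i, p) = c * x (i, p)"
    using assms(2) walk_target[of "v i" p] by (auto simp: FM_ract FM_carrier coef_scal)
qed

text \<open>Submodules of \<open>FM I v r\<close> are subspaces of a finite-dimensional vector space.\<close>

lemma FM_submodule_fin_gen: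
  assumes "r \<le> k" "finite I" and L: "submodule A (FM I v r) L"
  shows "fin_gen A ((FM I v r)\<lparr>carrier := L\<rparr>)"
proof -
  interpret F: right_module A "FM I v r" by (rule FM_right_module) fact
  interpret L: right_module A "(FM I v r)\<lparr>carrier := L\<rparr>" by (rule F.submodule_right_module[OF L])
  define T where "T = {(i, p). i \<in> I \<and> walk Q (v i) p \<and> length p < r}"
  have "T = (\<Union>i\<in>I. Pair i ` {p. walk Q (v i) p \<and> length p < r})" by (auto simp: T_def)
  then have finT: "finite T" using assms(2) finite_walks by auto
  define W where "W = (\<lambda>t s. if s = t then 1 else (0::'k)) ` T"
  have span: "x \<in> fs.span W" if "x \<in> carrier (FM I v r)" for x
    unfolding W_def using that by (intro fs_span_indicators[OF finT]) (auto simp: FM_carrier T_def)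
  obtain B where B: "B \<subseteq> L" "fs.independent B" "L \<subseteq> fs.span B"
    using fs.maximal_independent_subset by metis
  have "B \<subseteq> fs.span W" using span B(1) F.submoduleD(1)[OF L] by auto
  moreover have "finite W" using finT by (simp add: W_def)
  ultimately have finB: "finite B" using fs.independent_span_bound[OF _ B(2)] by blast
  show ?thesis
  proof (rule L.fin_genI[of B])
    show "finite B" "B \<subseteq> carrier ((FM I v r)\<lparr>carrier := L\<rparr>)" using finB B by auto
    fix S assume S: "submodule A ((FM I v r)\<lparr>carrier := L\<rparr>) S" "B \<subseteq> S"
    have SL: "S \<subseteq> carrier (FM I v r)" using L.submoduleD(1)[OF S(1)] F.submoduleD(1)[OF L] by auto
    have "fs.subspace S"
      \<comment> \<open>Closure under scalars is closure under the action of
        \<open>scal c\<close>.\<close>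
      unfolding fs.subspace_def
    proof (intro conjI ballI allI)
      show "0 \<in> S" using L.submoduleD(3)[OF S(1)] by (simp add: zero_fun_def)
      show "x + y \<in> S" if "x \<in> S" "y \<in> S" for x y
        using L.submoduleD(4)[OF S(1) that] by (simp add: plus_fun_def)
      show "(\<lambda>t. c * x t) \<in> S" if "x \<in> S" for c x
        using L.submoduleD(5)[OF S(1) that scal_closed[of c]] SL that FM_scal[OF assms(1), of x I v c] by auto
    qed
    then have "fs.span B \<subseteq> S" using S(2) by (rule fs.span_minimal[rotated])
    then show "carrier ((FM I v r)\<lparr>carrier := L\<rparr>) \<subseteq> S" using B(3) by auto
  qed
qed

lemma FM_kernel_fgm:
  assumes "r \<le> k" "finite I" "right_module A N" "f \<in> rmod_hom A (FM I v r) N"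
  shows "fgm A (kernel_module (FM I v r) N f)"
  unfolding fgm_def kernel_module_def
  using FM_submodule_fin_gen[OF assms(1,2)] kernel_submodule[OF FM_right_module[OF assms(1)] assms(3,4)]
    right_module.submodule_right_module[OF FM_right_module[OF assms(1)]] by blast

text \<open>Iterating \<open>x = l + x a\<close> replaces \<open>a\<close> by \<open>a\<^sup>2\<close>, which vanishes eventually.\<close>

lemma nakayama_elem:
  assumes N: "right_module A N" and L: "submodule A N L" and x: "x \<in> carrier N"
    and "l \<in> L" "a \<in> carrier A" "\<And>u. coef a (u, []) = 0" "x = l \<oplus>\<^bsub>N\<^esub> x \<odot>r\<^bsub>N\<^esub> a"
  shows "x \<in> L"
proof -
  interpret N: right_module A N by fact
  note Ld = N.submoduleD[OF L]
  \<comment> \<open>Squaring \<open>a\<close> doubles its order of vanishing; the induction only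
    claims that the order grows by one.\<close>
  have "\<exists>l\<in>L. \<exists>a\<in>carrier A. (\<forall>u p. length p < Suc t \<longrightarrow> coef a (u, p) = 0) \<and> x = l \<oplus>\<^bsub>N\<^esub> x \<odot>r\<^bsub>N\<^esub> a" for t
  proof (induction t)
    case 0
    show ?case using assms(4-7) by (intro bexI[of _ l] bexI[of _ a]) auto
  next
    case (Suc t)
    then obtain l a where la: "l \<in> L" "a \<in> carrier A" "\<And>u p. length p < Suc t \<Longrightarrow> coef a (u, p) = 0"
      and eq: "x = l \<oplus>\<^bsub>N\<^esub> x \<odot>r\<^bsub>N\<^esub> a" by blast
    let ?l = "l \<oplus>\<^bsub>N\<^esub> l \<odot>r\<^bsub>N\<^esub> a"
    have l: "?l \<in> L" using la Ld by auto
    have xa: "x \<odot>r\<^bsub>N\<^esub> a = l \<odot>r\<^bsub>N\<^esub> a \<oplus>\<^bsub>N\<^esub> x \<odot>r\<^bsub>N\<^esub> (a \<otimes>\<^bsub>A\<^esub> a)"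
      using N.ract_l_distr[of l "x \<odot>r\<^bsub>N\<^esub> a" a] la x Ld(2) eq N.ract_closed by (metis N.ract_assoc)
    have cl: "l \<in> carrier N" "l \<odot>r\<^bsub>N\<^esub> a \<in> carrier N" "x \<odot>r\<^bsub>N\<^esub> (a \<otimes>\<^bsub>A\<^esub> a) \<in> carrier N"
      using la x Ld(2) by (auto intro!: N.ract_closed)
    have "x = ?l \<oplus>\<^bsub>N\<^esub> x \<odot>r\<^bsub>N\<^esub> (a \<otimes>\<^bsub>A\<^esub> a)"
      by (subst eq, subst xa) (rule N.M.a_assoc[OF cl, symmetric])
    moreover have "coef (a \<otimes>\<^bsub>A\<^esub> a) (u, p) = 0" if "length p < Suc (Suc t)" for u p
    proof (cases "length p < k")
      case True
      have "coef a (u, m) * coef a (tgt Q u m, s) = 0" if "m @ s = p" for m s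
      proof (cases "length m < Suc t")
        case False
        then have "length s < Suc t" using that \<open>length p < Suc (Suc t)\<close> by auto
        then show ?thesis using la(3) by simp
      qed (simp add: la(3))
      then show ?thesis using True la(2) by (simp add: coef_mult splitsum_eq_0)
    next
      case False
      then show ?thesis using coef_len[of "a \<otimes>\<^bsub>A\<^esub> a"] la(2) by auto
    qed
    ultimately show ?case using l la(2) by (intro bexI[of _ ?l] bexI[of _ "a \<otimes>\<^bsub>A\<^esub> a"]) auto
  qed
  \<comment> \<open>Now \<open>a\<close> has no terms of length below \<open>k\<close>, so it acts
    as zero and \<open>x = l\<close>.\<close>
  from this[of k] obtain l a where la: "l \<in> L" "a \<in> carrier A" "\<And>u p. length p < Suc k \<Longrightarrow> coef a (u, p) = 0"
    and eq: "x = l \<oplus>\<^bsub>N\<^esub> x \<odot>r\<^bsub>N\<^esub> a" by blast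
  have "x \<odot>r\<^bsub>N\<^esub> a = \<zero>\<^bsub>N\<^esub>" using killed_k[OF N] x la unfolding killed_def by (metis less_SucI)
  then show ?thesis using eq la(1) Ld(2) by simp
qed

text \<open>Inside the carrier of \<open>FM I v r\<close> this cuts out the radical: the elements
  without terms at trivial paths.\<close>

definition rad :: "('i \<times> 'e list \<Rightarrow> 'k) set" where
  "rad = {y. \<forall>i. y (i, []) = 0}"

text \<open>Nakayama's lemma by degree: write \<open>bas i = l i + z i\<close> with
  \<open>z i\<close> in the radical. Substituting this into the expansion of a remainder of degree
  at least \<open>t\<close> leaves one of degree at least \<open>t + 1\<close>, and from degree
  \<open>r\<close> on nothing is left.\<close>

lemma rad_superfluous:
  assumes r: "0 < r" "r \<le> k" "finite I" "\<And>i. i \<in> I \<Longrightarrow> v i \<in> verts Q"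
    and K: "K \<subseteq> carrier (FM I v r)" "K \<subseteq> rad"
  shows "superfluous A (FM I v r) K"
  unfolding superfluous_def
proof (intro allI impI; elim conjE)
  interpret F: right_module A "FM I v r" by (rule FM_right_module) fact
  fix L assume L: "submodule A (FM I v r) L" and LK: "L <+>\<^bsub>FM I v r\<^esub> K = carrier (FM I v r)"
  note Ld = F.submoduleD[OF L]
  have "\<exists>l\<in>L. \<exists>z\<in>K. bas i = (\<lambda>t. l t + z t)" if "i \<in> I" for i
  proof -
    have "bas i \<in> L <+>\<^bsub>FM I v r\<^esub> K" unfolding LK using r that by (intro bas_closed) auto
    then show ?thesis by (auto simp: set_add_def set_mult_def)
  qed
  then obtain l z where lz: "\<And>i. i \<in> I \<Longrightarrow> l i \<in> L" "\<And>i. i \<in> I \<Longrightarrow> z i \<in> K"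
    "\<And>i. i \<in> I \<Longrightarrow> bas i = (\<lambda>t. l i t + z i t)" by metis
  have "\<exists>x\<in>L. \<exists>w\<in>carrier (FM I v r). (\<forall>i p. length p < t \<longrightarrow> w (i, p) = 0) \<and> y = (\<lambda>t. x t + w t)"
    if "y \<in> carrier (FM I v r)" for y t
  proof (induction t)
    case 0
    show ?case using that Ld(3) by (intro bexI[of _ "\<lambda>_. 0"] bexI[of _ y]) auto
  next
    case (Suc t)
    then obtain x w where xw: "x \<in> L" "w \<in> carrier (FM I v r)" "\<And>i p. length p < t \<Longrightarrow> w (i, p) = 0"
      and y: "y = (\<lambda>t. x t + w t)" by blast
    note c = cmp_closed[OF r(2) xw(2)]
    have cl: "(\<lambda>i. l i \<odot>r\<^bsub>FM I v r\<^esub> cmp v w i) \<in> I \<rightarrow> L" using lz(1) c Ld(5) by auto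
    have cz: "(\<lambda>i. z i \<odot>r\<^bsub>FM I v r\<^esub> cmp v w i) \<in> I \<rightarrow> carrier (FM I v r)"
      using lz(2) c K(1) by (auto intro!: F.ract_closed)
    let ?x = "\<Oplus>\<^bsub>FM I v r\<^esub>i\<in>I. l i \<odot>r\<^bsub>FM I v r\<^esub> cmp v w i"
    let ?w = "\<Oplus>\<^bsub>FM I v r\<^esub>i\<in>I. z i \<odot>r\<^bsub>FM I v r\<^esub> cmp v w i"
    have bz: "bas i \<odot>r\<^bsub>FM I v r\<^esub> cmp v w i = l i \<odot>r\<^bsub>FM I v r\<^esub> cmp v w i \<oplus>\<^bsub>FM I v r\<^esub> z i \<odot>r\<^bsub>FM I v r\<^esub> cmp v w i"
      if "i \<in> I" for i
      using F.ract_l_distr[of "l i" "z i" "cmp v w i"] lz[OF that] c K(1) Ld(1) by auto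
    have "w = (\<Oplus>\<^bsub>FM I v r\<^esub>i\<in>I. bas i \<odot>r\<^bsub>FM I v r\<^esub> cmp v w i)"
      by (rule FM_expand[OF r xw(2)])
    also have "\<dots> = (\<Oplus>\<^bsub>FM I v r\<^esub>i\<in>I. l i \<odot>r\<^bsub>FM I v r\<^esub> cmp v w i \<oplus>\<^bsub>FM I v r\<^esub> z i \<odot>r\<^bsub>FM I v r\<^esub> cmp v w i)"
      using cl cz Ld(1) bz by (intro F.M.finsum_cong') (auto simp: Pi_iff simp del: FM_simps intro!: F.M.a_closed)
    also have "\<dots> = ?x \<oplus>\<^bsub>FM I v r\<^esub> ?w"
      using cl cz Ld(1) by (intro F.M.finsum_addf) auto
    finally have w: "w = (\<lambda>t. ?x t + ?w t)" by simp
    have x: "?x \<in> L" by (rule F.submodule_finsum[OF L cl])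
    have w0: "?w (j, p) = 0" if p: "length p < Suc t" for j p
    proof -
      have "?w (j, p) = (\<Sum>i\<in>I. (z i \<odot>r\<^bsub>FM I v r\<^esub> cmp v w i) (j, p))"
        by (rule FM_finsum[OF r(2) cz r(3)])
      also have "\<dots> = 0"
      proof (rule sum.neutral, rule ballI)
        fix i assume i: "i \<in> I"
        have "splitsum (\<lambda>m s. z i (j, m) * coef (cmp v w i) (tgt Q (v j) m, s)) p = 0"
        proof (rule splitsum_eq_0)
          fix m s assume ms: "m @ s = p"
          show "z i (j, m) * coef (cmp v w i) (tgt Q (v j) m, s) = 0"
          proof (cases m)
            case Nil
            then show ?thesis using lz(2)[OF i] K(2) by (auto simp: rad_def)
          next
            case Cons
            then have "length s < t" using ms p by auto
            then show ?thesis using xw(3) by (simp add: coef_cmp[OF r(2) xw(2)])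
          qed
        qed
        then show "(z i \<odot>r\<^bsub>FM I v r\<^esub> cmp v w i) (j, p) = 0" by (simp add: FM_ract)
      qed
      finally show ?thesis .
    qed
    have "y = (\<lambda>t. (x \<oplus>\<^bsub>FM I v r\<^esub> ?x) t + ?w t)"
      unfolding y by (subst w) (simp add: add.assoc)
    then show ?case using x xw(1) w0 cz Ld(4) by (intro bexI[of _ "x \<oplus>\<^bsub>FM I v r\<^esub> ?x"] bexI[of _ ?w]) (auto intro!: F.M.finsum_closed)
  qed
  note this[of _ r]
  moreover have "w = (\<lambda>_. 0)" if "w \<in> carrier (FM I v r)" "\<forall>i p. length p < r \<longrightarrow> w (i, p) = 0" for w
    using that by (fastforce simp: FM_carrier)
  ultimately have "carrier (FM I v r) \<subseteq> L" by (force simp: subset_eq)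
  then show "L = carrier (FM I v r)" using Ld(1) by auto
qed

lemma ract_sum_idem:
  assumes "right_module A N" "x \<in> carrier N"
  shows "x = (\<Oplus>\<^bsub>N\<^esub>u\<in>verts Q. x \<odot>r\<^bsub>N\<^esub> idem u)"
proof -
  interpret N: right_module A N by fact
  have "x \<odot>r\<^bsub>N\<^esub> (\<Oplus>\<^bsub>A\<^esub>u\<in>S. idem u) = (\<Oplus>\<^bsub>N\<^esub>u\<in>S. x \<odot>r\<^bsub>N\<^esub> idem u)"
    if "finite S" "S \<subseteq> verts Q" for S
    using that
  proof (induction S)
    case (insert u S)
    have i: "idem ` S \<subseteq> carrier A" "idem u \<in> carrier A" using insert.prems idem_closed by auto
    then have "(\<lambda>u. x \<odot>r\<^bsub>N\<^esub> idem u) \<in> S \<rightarrow> carrier N" "x \<odot>r\<^bsub>N\<^esub> idem u \<in> carrier N"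
      using assms(2) by (auto intro!: N.ract_closed)
    then show ?case using insert i assms(2)
      by (simp add: image_subset_iff_funcset N.ract_r_distr N.M.finsum_insert A.finsum_closed)
  qed (use assms(2) in simp)
  from this[of "verts Q"] show ?thesis using one_eq_sum_idem N.ract_one[OF assms(2)] by simp
qed

text \<open>Take a generating set of minimal cardinality among those consisting of vectors fixed by
  the idempotent of a vertex: a relation with an invertible coefficient would make one generator
  superfluous.\<close>

lemma minimal_cover:
  assumes r: "0 < r" "r \<le> k" and N: "fgm A N" "killed r N"
  obtains T :: "('v \<times> 'm) set" and f where
    "finite T" "\<And>i. i \<in> T \<Longrightarrow> fst i \<in> verts Q" "f \<in> rmod_hom A (FM T fst r) (N :: ('a, 'm) rmodule)"
    "f ` carrier (FM T fst r) = carrier N"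
    "\<And>y. y \<in> carrier (FM T fst r) \<Longrightarrow> f y = \<zero>\<^bsub>N\<^esub> \<Longrightarrow> y \<in> rad"
proof -
  interpret N: right_module A N using N(1) by (simp add: fgm_def)
  define gens where "gens T \<longleftrightarrow> finite T \<and>
    (\<forall>(u, x)\<in>T. u \<in> verts Q \<and> x \<in> carrier N \<and> x \<odot>r\<^bsub>N\<^esub> idem u = x) \<and>
    (\<forall>L. submodule A N L \<longrightarrow> snd ` T \<subseteq> L \<longrightarrow> carrier N \<subseteq> L)" for T
  obtain S where S: "finite S" "S \<subseteq> carrier N" "\<And>L. submodule A N L \<Longrightarrow> S \<subseteq> L \<Longrightarrow> carrier N \<subseteq> L"
    using N.fin_genE N(1) by (metis fgm_def)
  have "gens ((\<lambda>(u, x). (u, x \<odot>r\<^bsub>N\<^esub> idem u)) ` (verts Q \<times> S))"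
    unfolding gens_def
  proof (intro conjI allI impI)
    have "idem u \<otimes>\<^bsub>A\<^esub> idem u = idem u" if u: "u \<in> verts Q" for u
    proof (rule coef_inj)
      fix w p
      show "coef (idem u \<otimes>\<^bsub>A\<^esub> idem u) (w, p) = coef (idem u) (w, p)"
      proof (cases "length p < k")
        case True
        have "splitsum (\<lambda>l s. coef (idem u) (w, l) * coef (idem u) (tgt Q w l, s)) p
          = coef (idem u) (w, []) * coef (idem u) (w, p)"
          by (subst splitsum_first) (auto simp: coef_idem[OF u])
        then show ?thesis using True u by (simp add: coef_mult idem)
      next
        case False
        then have "coef (idem u \<otimes>\<^bsub>A\<^esub> idem u) (w, p) = 0" "coef (idem u) (w, p) = 0"
          using coef_len[of "idem u \<otimes>\<^bsub>A\<^esub> idem u" w p] idem_closed[OF u] coef_len[of "idem u" w p] A.m_closed by blast+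
        then show ?thesis by simp
      qed
    qed (use u idem_closed in auto)
    then show "\<forall>(u, x)\<in>(\<lambda>(u, x). (u, x \<odot>r\<^bsub>N\<^esub> idem u)) ` (verts Q \<times> S).
        u \<in> verts Q \<and> x \<in> carrier N \<and> x \<odot>r\<^bsub>N\<^esub> idem u = x"
      using S(2) idem_closed by (auto simp flip: N.ract_assoc intro!: N.ract_closed)
    fix L assume L: "submodule A N L" "snd ` (\<lambda>(u, x). (u, x \<odot>r\<^bsub>N\<^esub> idem u)) ` (verts Q \<times> S) \<subseteq> L"
    have "x \<in> L" if x: "x \<in> S" for x
    proof -
      have "(\<Oplus>\<^bsub>N\<^esub>u\<in>verts Q. x \<odot>r\<^bsub>N\<^esub> idem u) \<in> L"
        using L(2) x by (intro N.submodule_finsum[OF L(1)]) force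
      then show ?thesis using ract_sum_idem[OF N.right_module_axioms] x S(2) by auto
    qed
    then show "carrier N \<subseteq> L" using S(3)[OF L(1)] by auto
  qed (use S in auto)
  then obtain T where T: "gens T" and min: "\<And>T'. gens T' \<Longrightarrow> card T \<le> card T'"
    using ex_has_least_nat[of gens "(\<lambda>(u, x). (u, x \<odot>r\<^bsub>N\<^esub> idem u)) ` (verts Q \<times> S)" card] by blast
  have finT: "finite T" and vT: "\<And>i. i \<in> T \<Longrightarrow> fst i \<in> verts Q" and xT: "\<And>i. i \<in> T \<Longrightarrow> snd i \<in> carrier N"
    and eT: "\<And>i. i \<in> T \<Longrightarrow> snd i \<odot>r\<^bsub>N\<^esub> idem (fst i) = snd i"
    and gT: "\<And>L. submodule A N L \<Longrightarrow> snd ` T \<subseteq> L \<Longrightarrow> carrier N \<subseteq> L"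
    using T by (auto simp: gens_def)
  interpret F: right_module A "FM T fst r" by (rule FM_right_module) fact
  let ?f = "lin N T fst snd"
  have f: "?f \<in> rmod_hom A (FM T fst r) N"
    by (rule lin_hom[OF r(2) finT N.right_module_axioms N(2) xT])
  have fb: "?f (bas i) = snd i" if "i \<in> T" for i
    by (rule lin_bas[OF r finT vT N.right_module_axioms xT eT that])
  have bc: "bas i \<in> carrier (FM T fst r)" if "i \<in> T" for i
    using r(1) that vT by (intro bas_closed)
  show ?thesis
  proof (rule that[OF finT vT f])
    have "snd ` T \<subseteq> ?f ` carrier (FM T fst r)" using fb bc by force
    then show "?f ` carrier (FM T fst r) = carrier N"
      using gT image_submodule[OF F.right_module_axioms N.right_module_axioms f F.submodule_carrier]
        rmod_homD(1)[OF f] by (metis N.submoduleD(1) subset_antisym)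
    fix y assume y: "y \<in> carrier (FM T fst r)" and fy: "?f y = \<zero>\<^bsub>N\<^esub>"
    show "y \<in> rad"
    proof (rule ccontr)
      assume "y \<notin> rad"
      then obtain i where yi: "y (i, []) \<noteq> 0" by (auto simp: rad_def)
      then have i: "i \<in> T" using y by (cases i) (auto simp: FM_carrier)
      let ?c = "y (i, [])"
      note cm = cmp_closed[OF r(2) y]
      have "gens (T - {i})"
        unfolding gens_def
      proof (intro conjI allI impI)
        fix L assume L: "submodule A N L" "snd ` (T - {i}) \<subseteq> L"
        note Ld = N.submoduleD[OF L(1)]
        let ?s = "\<Oplus>\<^bsub>N\<^esub>j\<in>T - {i}. snd j \<odot>r\<^bsub>N\<^esub> cmp fst y j"
        have s: "?s \<in> L" using L(2) cm Ld(5) by (intro N.submodule_finsum[OF L(1)]) auto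
        have "?f y = (\<Oplus>\<^bsub>N\<^esub>j\<in>insert i (T - {i}). snd j \<odot>r\<^bsub>N\<^esub> cmp fst y j)"
          unfolding lin_def using i by (simp add: insert_absorb)
        also have "\<dots> = snd i \<odot>r\<^bsub>N\<^esub> cmp fst y i \<oplus>\<^bsub>N\<^esub> ?s"
          by (rule N.M.finsum_insert) (use finT in simp, simp, use xT cm i N.ract_closed in blast, use xT cm i N.ract_closed in blast)
        finally have rel: "snd i \<odot>r\<^bsub>N\<^esub> cmp fst y i \<oplus>\<^bsub>N\<^esub> ?s = \<zero>\<^bsub>N\<^esub>" using fy by simp
        \<comment> \<open>Scaling turns the constant term of the relation's coefficient at
          \<open>i\<close> into that of the idempotent, so \<open>a\<close> lies in the radical.
          Then \<open>snd i\<close> is the sum of \<open>snd i\<close> acted on by \<open>b\<close>,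
          which the relation places in \<open>L\<close>, and \<open>snd i\<close> acted on by
          \<open>a\<close>; this is the form required by \<open>nakayama_elem\<close>.\<close>
        define b where "b = cmp fst y i \<otimes>\<^bsub>A\<^esub> scal (inverse ?c)"
        define a where "a = idem (fst i) \<ominus>\<^bsub>A\<^esub> b"
        have bcl: "b \<in> carrier A" and acl: "a \<in> carrier A"
          using cm idem_closed[OF vT[OF i]] scal_closed by (auto simp: a_def b_def)
        have "coef b (u, []) = coef (idem (fst i)) (u, [])" for u
          using vT[OF i] yi k_pos by (auto simp: b_def coef_mult cm scal_closed coef_scal coef_cmp[OF r(2) y] coef_idem)
        then have a0: "coef a (u, []) = 0" for u
          by (simp add: a_def coef_diff bcl idem_closed[OF vT[OF i]])
        have "idem (fst i) = b \<oplus>\<^bsub>A\<^esub> a"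
          unfolding a_def using bcl idem_closed[OF vT[OF i]] by (simp add: A.minus_eq A.a_lcomm[of b] A.r_neg)
        then have "snd i = snd i \<odot>r\<^bsub>N\<^esub> b \<oplus>\<^bsub>N\<^esub> snd i \<odot>r\<^bsub>N\<^esub> a"
          using eT[OF i] N.ract_r_distr[OF xT[OF i] bcl acl] by simp
        moreover have "snd i \<odot>r\<^bsub>N\<^esub> b \<in> L"
        proof -
          have xc: "snd i \<odot>r\<^bsub>N\<^esub> cmp fst y i \<in> carrier N" using N.ract_closed[OF xT[OF i] cm] .
          have "\<ominus>\<^bsub>N\<^esub> ?s = snd i \<odot>r\<^bsub>N\<^esub> cmp fst y i" by (rule N.M.minus_equality[OF rel Ld(2)[OF s] xc])
          then have "snd i \<odot>r\<^bsub>N\<^esub> cmp fst y i \<in> L" using Ld(6)[OF s] by simp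
          then show ?thesis unfolding b_def N.ract_assoc[OF xT[OF i] cm scal_closed] by (rule Ld(5)[OF _ scal_closed])
        qed
        ultimately have "snd i \<in> L"
          using nakayama_elem[OF N.right_module_axioms L(1) xT[OF i] _ acl a0] by blast
        then have "snd ` T \<subseteq> L" using L(2) by blast
        then show "carrier N \<subseteq> L" by (rule gT[OF L(1)])
      qed (use T in \<open>auto simp: gens_def\<close>)
      then have "card T \<le> card (T - {i})" by (rule min)
      then show False using card_Diff1_less[OF finT i] by simp
    qed
  qed
qed

end

section \<open>Projective covers and syzygies\<close>

lemma projective_lift:
  assumes "P \<in> projective_modules A" "M \<in> fg_modules A" "N \<in> fg_modules A"
    and "g \<in> rmod_hom A M N" "g ` carrier M = carrier N" "f \<in> rmod_hom A P N"
  obtains h where "h \<in> rmod_hom A P M" "\<And>x. x \<in> carrier P \<Longrightarrow> g (h x) = f x"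
proof -
  have "\<exists>h\<in>rmod_hom A P M. \<forall>x\<in>carrier P. g (h x) = f x"
    using assms by (simp add: projective_modules_def)
  then show ?thesis using that by blast
qed

lemma bij_betw_fibre:
  assumes "bij_betw s X Y" "\<And>x. x \<in> X \<Longrightarrow> g (s x) = f x"
  shows "bij_betw s {x \<in> X. f x = c} {y \<in> Y. g y = c}"
proof (rule bij_betw_subset[OF assms(1)])
  show "s ` {x \<in> X. f x = c} = {y \<in> Y. g y = c}"
  proof (intro equalityI subsetI)
    fix y assume y: "y \<in> {y \<in> Y. g y = c}"
    then obtain x where "x \<in> X" "y = s x" using assms(1) by (auto simp: bij_betw_def)
    then show "y \<in> s ` {x \<in> X. f x = c}" using y assms(2) by auto
  qed (use assms in \<open>auto simp: bij_betw_def\<close>)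
qed auto

lemma superfluous_surj:
  assumes "right_module A P''" "right_module A P" "right_module A M"
    and f: "f \<in> rmod_hom A P M" and sup: "superfluous A P (a_kernel P M f)"
    and h: "h \<in> rmod_hom A P'' P" and im: "(\<lambda>x. f (h x)) ` carrier P'' = f ` carrier P"
  shows "h ` carrier P'' = carrier P"
proof -
  interpret P'': right_module A P'' by fact
  interpret P: right_module A P by fact
  interpret M: right_module A M by fact
  have L: "submodule A P (h ` carrier P'')"
    by (rule image_submodule[OF assms(1,2) h P''.submodule_carrier])
  have "h ` carrier P'' <+>\<^bsub>P\<^esub> a_kernel P M f = carrier P"
  proof (intro equalityI subsetI)
    fix x assume x: "x \<in> carrier P"
    then obtain y where y: "y \<in> carrier P''" "f x = f (h y)" using im by blast
    have hy: "h y \<in> carrier P" using rmod_homD(1)[OF h y(1)] .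
    have "f (x \<ominus>\<^bsub>P\<^esub> h y) = f x \<ominus>\<^bsub>M\<^esub> f (h y)" by (rule rmod_hom_diff[OF assms(2,3) f x hy])
    then have "x \<ominus>\<^bsub>P\<^esub> h y \<in> a_kernel P M f"
      using x hy y rmod_homD(1)[OF f hy] by (simp add: a_kernel_def' M.M.minus_eq M.M.r_neg)
    moreover have "x = h y \<oplus>\<^bsub>P\<^esub> (x \<ominus>\<^bsub>P\<^esub> h y)" using x hy by (simp add: P.M.minus_eq P.M.a_lcomm[of "h y"] P.M.r_neg)
    ultimately show "x \<in> h ` carrier P'' <+>\<^bsub>P\<^esub> a_kernel P M f"
      using y(1) by (auto simp: set_add_def set_mult_def)
  qed (use P.submoduleD(1)[OF L] in \<open>auto simp: set_add_def set_mult_def a_kernel_def'\<close>)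
  then show ?thesis using sup L by (auto simp: superfluous_def)
qed

lemma projective_cover_unique:
  assumes M: "M \<in> fg_modules A" and "projective_cover A M P f" "projective_cover A M P' f'"
  shows "rmod_iso A (kernel_module P' M f') (kernel_module P M f)"
proof -
  have P: "P \<in> projective_modules A" "P \<in> fg_modules A" "f \<in> rmod_hom A P M" "f ` carrier P = carrier M"
      "superfluous A P (a_kernel P M f)"
    and P': "P' \<in> projective_modules A" "P' \<in> fg_modules A" "f' \<in> rmod_hom A P' M" "f' ` carrier P' = carrier M"
      "superfluous A P' (a_kernel P' M f')"
    using assms(2,3) by (auto simp: projective_cover_def projective_modules_def)
  interpret M: right_module A M using M by (simp add: fg_modules_def)
  interpret P: right_module A P using P by (simp add: fg_modules_def)
  interpret P': right_module A P' using P' by (simp add: fg_modules_def)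
  obtain h where h: "h \<in> rmod_hom A P P'" "\<And>x. x \<in> carrier P \<Longrightarrow> f' (h x) = f x"
    using projective_lift[OF P(1) P'(2) M P'(3,4) P(3)] by blast
  have hs: "h ` carrier P = carrier P'"
    using h(2) P(4) P'(4)
    by (intro superfluous_surj[OF P.right_module_axioms P'.right_module_axioms M.right_module_axioms P'(3,5) h(1)]) force
  have "(\<lambda>x. x) \<in> rmod_hom A P' P'" by (auto simp: rmod_hom_def)
  then obtain s where s: "s \<in> rmod_hom A P' P" "\<And>x. x \<in> carrier P' \<Longrightarrow> h (s x) = x"
    using projective_lift[OF P'(1) P(2) P'(2) h(1) hs] by blast
  have fs: "f (s x) = f' x" if "x \<in> carrier P'" for x
    using h(2)[of "s x"] s(2)[OF that] rmod_homD(1)[OF s(1) that] by simp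
  have ss: "s ` carrier P' = carrier P"
    using fs P(4) P'(4)
    by (intro superfluous_surj[OF P'.right_module_axioms P.right_module_axioms M.right_module_axioms P(3,5) s(1)]) force
  have inj: "inj_on s (carrier P')" using s(2) by (metis inj_onI)
  show ?thesis
  proof (rule rmod_isoI)
    show "s \<in> rmod_hom A (kernel_module P' M f') (kernel_module P M f)"
      using rmod_homD[OF s(1)] fs by (intro rmod_homI) auto
    show "bij_betw s (carrier (kernel_module P' M f')) (carrier (kernel_module P M f))"
      unfolding kernel_module_simps using inj ss fs by (intro bij_betw_fibre) (auto simp: bij_betw_def)
  qed
qed

lemma is_syzygy_unique:
  assumes "M \<in> fg_modules A" "is_syzygy A M N" "is_syzygy A M N'"
  shows "rmod_iso A N N'"
proof -
  obtain P f P' f' where "projective_cover A M P f" "rmod_iso A N (kernel_module P M f)"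
    "projective_cover A M P' f'" "rmod_iso A N' (kernel_module P' M f')" "N' \<in> fg_modules A"
    using assms(2,3) by (auto simp: is_syzygy_def)
  then show ?thesis
    using projective_cover_unique[OF assms(1)] rmod_iso_trans rmod_iso_sym
    by (metis (no_types, lifting) fg_modules_def mem_Collect_eq)
qed

lemma zero_module_projective:
  assumes "M \<in> fg_modules A" "carrier M = {\<zero>\<^bsub>M\<^esub>}"
  shows "M \<in> projective_modules A"
  unfolding projective_modules_def
proof (intro CollectI conjI ballI impI assms(1))
  fix X N g f assume X: "X \<in> fg_modules A" "N \<in> fg_modules A" "g \<in> rmod_hom A X N" "f \<in> rmod_hom A M N"
  interpret X: right_module A X using X by (simp add: fg_modules_def)
  interpret N: right_module A N using X by (simp add: fg_modules_def)
  interpret M: right_module A M using assms by (simp add: fg_modules_def)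
  have "(\<lambda>x. \<zero>\<^bsub>X\<^esub>) \<in> rmod_hom A M X" by (intro rmod_homI) auto
  moreover have "g \<zero>\<^bsub>X\<^esub> = f x" if "x \<in> carrier M" for x
    using rmod_hom_zero[OF X.right_module_axioms N.right_module_axioms X(3)]
      rmod_hom_zero[OF M.right_module_axioms N.right_module_axioms X(4)] that assms(2) by auto
  ultimately show "\<exists>h\<in>rmod_hom A M X. \<forall>x\<in>carrier M. g (h x) = f x"
    by (intro bexI[of _ "\<lambda>x. \<zero>\<^bsub>X\<^esub>"] ballI)
qed

text \<open>The identity is a projective cover of \<open>P\<close>.\<close>

lemma syzygy_of_projective:
  assumes P: "P \<in> projective_modules A" and N: "N \<in> fg_modules A" "carrier N = {\<zero>\<^bsub>N\<^esub>}"
  shows "is_syzygy A P N"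
proof -
  interpret P: right_module A P using P by (auto simp: projective_modules_def fg_modules_def)
  interpret N: right_module A N using N by (auto simp: fg_modules_def)
  have k: "a_kernel P P (\<lambda>x. x) = {\<zero>\<^bsub>P\<^esub>}" by (auto simp: a_kernel_def')
  have "L = carrier P" if "submodule A P L" "L <+>\<^bsub>P\<^esub> {\<zero>\<^bsub>P\<^esub>} = carrier P" for L
  proof -
    have "L <+>\<^bsub>P\<^esub> {\<zero>\<^bsub>P\<^esub>} = L" using P.submoduleD(2)[OF that(1)] by (force simp: set_add_def set_mult_def)
    then show ?thesis using that by simp
  qed
  then have "projective_cover A P P (\<lambda>x. x)"
    using P by (auto simp: projective_cover_def k superfluous_def rmod_hom_def)
  moreover have "rmod_iso A N (kernel_module P P (\<lambda>x. x))"
    using N(2) by (intro rmod_isoI[of "\<lambda>_. \<zero>\<^bsub>P\<^esub>"] rmod_homI) (auto simp: bij_betw_def)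
  ultimately show ?thesis using N by (auto simp: is_syzygy_def)
qed

lemma dsum_kernel:
  assumes f: "f \<in> rmod_hom A P M" and g: "g \<in> rmod_hom A P' M'"
  shows "map_prod f g \<in> rmod_hom A (dsum P P') (dsum M M')"
    and "rmod_iso A (dsum (kernel_module P M f) (kernel_module P' M' g))
      (kernel_module (dsum P P') (dsum M M') (map_prod f g))"
proof -
  show "map_prod f g \<in> rmod_hom A (dsum P P') (dsum M M')"
    using rmod_homD[OF f] rmod_homD[OF g] by (intro rmod_homI) auto
  show "rmod_iso A (dsum (kernel_module P M f) (kernel_module P' M' g))
      (kernel_module (dsum P P') (dsum M M') (map_prod f g))"
    by (rule rmod_isoI[of "\<lambda>x. x"]) (auto simp: bij_betw_def intro!: rmod_homI)
qed

lemma kernel_iso_transport: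
  assumes "\<theta> \<in> rmod_hom A P F" "bij_betw \<theta> (carrier P) (carrier F)"
  shows "rmod_iso A (kernel_module P M (\<lambda>x. f (\<theta> x))) (kernel_module F M f)"
proof (rule rmod_isoI)
  show "\<theta> \<in> rmod_hom A (kernel_module P M (\<lambda>x. f (\<theta> x))) (kernel_module F M f)"
    using rmod_homD[OF assms(1)] by (intro rmod_homI) auto
  show "bij_betw \<theta> (carrier (kernel_module P M (\<lambda>x. f (\<theta> x)))) (carrier (kernel_module F M f))"
    unfolding kernel_module_simps by (rule bij_betw_fibre[OF assms(2) refl])
qed

lemma kernel_iso_transport':
  assumes "right_module A M" "right_module A M'" "f \<in> rmod_hom A P M"
    and "\<theta> \<in> rmod_hom A M M'" "bij_betw \<theta> (carrier M) (carrier M')"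
  shows "kernel_module P M' (\<lambda>x. \<theta> (f x)) = kernel_module P M f"
proof -
  interpret M: right_module A M by fact
  have "\<theta> (f x) = \<zero>\<^bsub>M'\<^esub> \<longleftrightarrow> f x = \<zero>\<^bsub>M\<^esub>" if "x \<in> carrier P" for x
    using rmod_hom_zero[OF assms(1,2,4)] rmod_homD(1)[OF assms(3) that] assms(5)
    by (metis M.M.zero_closed bij_betw_def inj_onD)
  then have "{x \<in> carrier P. \<theta> (f x) = \<zero>\<^bsub>M'\<^esub>} = {x \<in> carrier P. f x = \<zero>\<^bsub>M\<^esub>}" by blast
  then show ?thesis by (simp only: kernel_module_def a_kernel_def')
qed

section \<open>Projective covers and syzygies from maps out of \<open>FM I v k\<close>\<close>

context trunc_alg
begin

lemma FM_projective:
  assumes "finite I" "\<And>i. i \<in> I \<Longrightarrow> v i \<in> verts Q" "P \<in> fg_modules A" "rmod_iso A P (FM I v k)"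
  shows "P \<in> projective_modules A"
  unfolding projective_modules_def
proof (intro CollectI conjI ballI impI assms(3))
  interpret F: right_module A "FM I v k" by (rule FM_right_module) simp
  interpret P: right_module A P using assms by (simp add: fg_modules_def)
  fix M N g f assume MN: "M \<in> fg_modules A" "N \<in> fg_modules A" and g: "g \<in> rmod_hom A M N" "g ` carrier M = carrier N"
    and f: "f \<in> rmod_hom A P N"
  have M: "right_module A M" and N: "right_module A N" using MN by (auto simp: fg_modules_def)
  obtain \<theta> where \<theta>: "\<theta> \<in> rmod_hom A P (FM I v k)" "bij_betw \<theta> (carrier P) (carrier (FM I v k))"
    using assms(4) by (rule rmod_isoE)
  note inv = rmod_hom_inv[OF P.right_module_axioms \<theta>]
  obtain h where h: "h \<in> rmod_hom A (FM I v k) M"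
    "\<And>y. y \<in> carrier (FM I v k) \<Longrightarrow> g (h y) = f (the_inv_into (carrier P) \<theta> y)"
    by (rule FM_lift[OF k_pos order_refl assms(1,2) M killed_k[OF M] N rmod_hom_comp[OF inv(1) f] g]) blast+
  have "g (h (\<theta> x)) = f x" if "x \<in> carrier P" for x
    using h(2)[OF rmod_homD(1)[OF \<theta>(1) that]] \<theta>(2) that by (simp add: the_inv_into_f_f bij_betw_def)
  then show "\<exists>h\<in>rmod_hom A P M. \<forall>x\<in>carrier P. g (h x) = f x"
    using rmod_hom_comp[OF \<theta>(1) h(1)] by (intro bexI[of _ "\<lambda>x. h (\<theta> x)"] ballI)
qed

text \<open>The working criterion for syzygies: an epimorphism from \<open>FM I v k\<close> with
  kernel in the radical is a projective cover. Since \<open>is_syzygy\<close> admits only modules of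
  \<open>mod A\<close>, the cover has to be moved along isomorphisms at its source and at its
  target.\<close>

lemma syzygyI:
  assumes I: "finite I" "\<And>i. i \<in> I \<Longrightarrow> v i \<in> verts Q"
    and M: "M \<in> fg_modules A" "rmod_iso A M M'" "right_module A M'"
    and \<phi>: "\<phi> \<in> rmod_hom A (FM I v k) M'" "\<phi> ` carrier (FM I v k) = carrier M'"
      "\<And>y. y \<in> carrier (FM I v k) \<Longrightarrow> \<phi> y = \<zero>\<^bsub>M'\<^esub> \<Longrightarrow> y \<in> rad"
    and N: "N \<in> fg_modules A" "rmod_iso A N (kernel_module (FM I v k) M' \<phi>)"
  shows "is_syzygy A M N"
proof -
  interpret M: right_module A M using M by (simp add: fg_modules_def)
  obtain j where j: "j \<in> rmod_hom A M' M" "bij_betw j (carrier M') (carrier M)"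
    using rmod_iso_sym[OF M.right_module_axioms M(2)] by (rule rmod_isoE)
  have fgF: "fgm A (FM I v k)" by (rule FM_fgm[OF k_pos order_refl I])
  let ?F = "FM I v k" and ?P = "rep A (FM I v k)"
  interpret F: right_module A ?F by (rule FM_right_module) simp
  note P = rep[OF fgF]
  interpret P: right_module A ?P using P by (simp add: fg_modules_def)
  obtain \<theta> where \<theta>: "\<theta> \<in> rmod_hom A ?P ?F" "bij_betw \<theta> (carrier ?P) (carrier ?F)"
    using P(3) by (rule rmod_isoE)
  let ?f = "\<lambda>x. j (\<phi> (\<theta> x))"
  have \<phi>\<theta>: "(\<lambda>x. \<phi> (\<theta> x)) \<in> rmod_hom A ?P M'" by (rule rmod_hom_comp[OF \<theta>(1) \<phi>(1)])
  have hom: "?f \<in> rmod_hom A ?P M" by (rule rmod_hom_comp[OF \<phi>\<theta> j(1)])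
  have ker: "kernel_module ?P M ?f = kernel_module ?P M' (\<lambda>x. \<phi> (\<theta> x))"
    by (rule kernel_iso_transport'[OF M(3) M.right_module_axioms \<phi>\<theta> j])
  have aker: "a_kernel ?P M ?f = {x \<in> carrier ?P. \<phi> (\<theta> x) = \<zero>\<^bsub>M'\<^esub>}"
  proof -
    have "carrier (kernel_module ?P M ?f) = carrier (kernel_module ?P M' (\<lambda>x. \<phi> (\<theta> x)))" by (simp only: ker)
    then show ?thesis by (simp only: kernel_module_simps a_kernel_def')
  qed
  let ?K = "{y \<in> carrier ?F. \<phi> y = \<zero>\<^bsub>M'\<^esub>}"
  have supF: "superfluous A ?F ?K"
    using \<phi>(3) by (intro rad_superfluous k_pos order_refl I) auto
  have "superfluous A ?P (a_kernel ?P M ?f)"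
    unfolding superfluous_def
  proof (intro allI impI; elim conjE)
    fix L assume L: "submodule A ?P L" and eq: "L <+>\<^bsub>?P\<^esub> a_kernel ?P M ?f = carrier ?P"
    note LP = P.submoduleD(1)[OF L]
    have sub: "submodule A ?F (\<theta> ` L)" by (rule image_submodule[OF P.right_module_axioms F.right_module_axioms \<theta>(1) L])
    have "\<theta> ` L <+>\<^bsub>?F\<^esub> ?K = carrier ?F"
    proof (intro equalityI subsetI)
      fix y assume "y \<in> carrier ?F"
      then obtain x where x: "x \<in> carrier ?P" "y = \<theta> x" using \<theta>(2) by (auto simp: bij_betw_def)
      then have "x \<in> L <+>\<^bsub>?P\<^esub> a_kernel ?P M ?f" using eq by simp
      then obtain l z where lz: "l \<in> L" "z \<in> carrier ?P" "\<phi> (\<theta> z) = \<zero>\<^bsub>M'\<^esub>" "x = l \<oplus>\<^bsub>?P\<^esub> z"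
        unfolding aker by (auto simp: set_add_def set_mult_def)
      then have "y = \<theta> l \<oplus>\<^bsub>?F\<^esub> \<theta> z" using rmod_homD(2)[OF \<theta>(1), of l z] LP x by auto
      moreover have "\<theta> z \<in> ?K" using lz rmod_homD(1)[OF \<theta>(1)] by auto
      ultimately show "y \<in> \<theta> ` L <+>\<^bsub>?F\<^esub> ?K" using lz(1) unfolding set_add_def set_mult_def by auto
    next
      fix y assume "y \<in> \<theta> ` L <+>\<^bsub>?F\<^esub> ?K"
      then obtain l z where "l \<in> L" "z \<in> carrier ?F" "y = \<theta> l \<oplus>\<^bsub>?F\<^esub> z"
        unfolding set_add_def set_mult_def by auto
      then show "y \<in> carrier ?F" using F.M.a_closed rmod_homD(1)[OF \<theta>(1)] LP by blast
    qed
    then have "\<theta> ` L = carrier ?F" using supF sub by (auto simp: superfluous_def)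
    then have im: "\<theta> ` L = \<theta> ` carrier ?P" using \<theta>(2) by (simp add: bij_betw_def)
    show "L = carrier ?P"
      using \<theta>(2) by (intro inj_on_image_eq_iff[THEN iffD1, OF _ LP order_refl im]) (auto simp: bij_betw_def)
  qed
  moreover have "?f ` carrier ?P = carrier M"
  proof -
    have "?f ` carrier ?P = j ` \<phi> ` \<theta> ` carrier ?P" by (simp add: image_image)
    then show ?thesis using \<theta>(2) \<phi>(2) j(2) by (simp add: bij_betw_def)
  qed
  ultimately have "projective_cover A M ?P ?f"
    using hom FM_projective[OF I P(1,3)] by (auto simp: projective_cover_def)
  moreover have "rmod_iso A N (kernel_module ?P M ?f)"
  proof -
    have "rmod_iso A (kernel_module ?P M' (\<lambda>x. \<phi> (\<theta> x))) (kernel_module ?F M' \<phi>)"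
      by (rule kernel_iso_transport[OF \<theta>])
    then have "rmod_iso A (kernel_module ?F M' \<phi>) (kernel_module ?P M ?f)"
      unfolding ker by (rule rmod_iso_sym[OF kernel_right_module[OF P.right_module_axioms M(3) \<phi>\<theta>]])
    then show ?thesis using N(2) rmod_iso_trans by blast
  qed
  ultimately show ?thesis using N(1) unfolding is_syzygy_def by blast
qed

lemma syzygy_exists:
  assumes "M \<in> fg_modules A"
  obtains N where "is_syzygy A M N"
proof -
  have M: "fgm A M" "right_module A M" using assms by (auto simp: fgm_def fg_modules_def)
  obtain T :: "('v \<times> (nat \<Rightarrow> 'a) set) set" and f where T: "finite T" "\<And>i. i \<in> T \<Longrightarrow> fst i \<in> verts Q" "f \<in> rmod_hom A (FM T fst k) M"
    "f ` carrier (FM T fst k) = carrier M"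
    "\<And>y. y \<in> carrier (FM T fst k) \<Longrightarrow> f y = \<zero>\<^bsub>M\<^esub> \<Longrightarrow> y \<in> rad"
    by (rule minimal_cover[OF k_pos order_refl M(1) killed_k[OF M(2)]]) blast
  note K = FM_kernel_fgm[OF order_refl T(1) M(2) T(3)]
  show ?thesis
    by (rule that, rule syzygyI[OF T(1,2) assms rmod_iso_refl M(2) T(3,4,5) rep(1,3)[OF K]])
qed

lemma FM_plus_iso:
  fixes I :: "'i set" and J :: "'j set"
  assumes "r \<le> k"
  defines "\<psi> \<equiv> \<lambda>y :: ('i + 'j) \<times> 'e list \<Rightarrow> 'k. (\<lambda>(i, p). y (Inl i, p), \<lambda>(i, p). y (Inr i, p))"
  shows "\<psi> \<in> rmod_hom A (FM (I <+> J) (case_sum v w) r) (dsum (FM I v r) (FM J w r))"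
    and "bij_betw \<psi> (carrier (FM (I <+> J) (case_sum v w) r)) (carrier (dsum (FM I v r) (FM J w r)))"
proof -
  have cl: "\<psi> y \<in> carrier (dsum (FM I v r) (FM J w r))" if "y \<in> carrier (FM (I <+> J) (case_sum v w) r)" for y
  proof -
    have y: "y (s, p) \<noteq> 0 \<Longrightarrow> s \<in> I <+> J \<and> walk Q (case_sum v w s) p \<and> length p < r" for s p
      using that by (auto simp: FM_carrier)
    show ?thesis using y[of "Inl _"] y[of "Inr _"] by (auto simp: \<psi>_def FM_carrier)
  qed
  show "\<psi> \<in> rmod_hom A (FM (I <+> J) (case_sum v w) r) (dsum (FM I v r) (FM J w r))"
  proof (rule rmod_homI[OF cl])
    show "\<psi> (x \<oplus>\<^bsub>FM (I <+> J) (case_sum v w) r\<^esub> y) = \<psi> x \<oplus>\<^bsub>dsum (FM I v r) (FM J w r)\<^esub> \<psi> y" for x y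
      by (auto simp: \<psi>_def)
    show "\<psi> (x \<odot>r\<^bsub>FM (I <+> J) (case_sum v w) r\<^esub> a) = \<psi> x \<odot>r\<^bsub>dsum (FM I v r) (FM J w r)\<^esub> a" for x a
      by (auto simp: \<psi>_def FM_ract fun_eq_iff)
  qed
  define \<psi>' :: "('i \<times> 'e list \<Rightarrow> 'k) \<times> ('j \<times> 'e list \<Rightarrow> 'k) \<Rightarrow> _"
    where "\<psi>' = (\<lambda>(x, y) (s, p). case s of Inl i \<Rightarrow> x (i, p) | Inr j \<Rightarrow> y (j, p))"
  have inv: "\<psi>' (\<psi> y) = y" "\<psi> (\<psi>' z) = z" for y z
    by (auto simp: \<psi>_def \<psi>'_def fun_eq_iff split: sum.splits prod.splits)
  have cl': "\<psi>' z \<in> carrier (FM (I <+> J) (case_sum v w) r)" if "z \<in> carrier (dsum (FM I v r) (FM J w r))" for z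
    using that by (auto simp: \<psi>'_def FM_carrier split: sum.splits)
  show "bij_betw \<psi> (carrier (FM (I <+> J) (case_sum v w) r)) (carrier (dsum (FM I v r) (FM J w r)))"
    using cl cl' inv by (intro bij_betwI[of _ _ _ \<psi>']) auto
qed

lemma FM_reindex_iso:
  assumes "r \<le> k" and inj: "inj_on \<beta> I" and v: "\<And>i. i \<in> I \<Longrightarrow> w (\<beta> i) = v i"
  shows "rmod_iso A (FM (\<beta> ` I) w r) (FM I v r)"
proof -
  define \<psi> where "\<psi> = (\<lambda>(y :: _ \<times> 'e list \<Rightarrow> 'k) (i, p). if i \<in> I then y (\<beta> i, p) else (0::'k))"
  have cl: "\<psi> y \<in> carrier (FM I v r)" if "y \<in> carrier (FM (\<beta> ` I) w r)" for y
    using that v by (fastforce simp: \<psi>_def FM_carrier split: if_splits)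
  have hom: "\<psi> \<in> rmod_hom A (FM (\<beta> ` I) w r) (FM I v r)"
  proof (rule rmod_homI[OF cl])
    show "\<psi> (x \<oplus>\<^bsub>FM (\<beta> ` I) w r\<^esub> y) = \<psi> x \<oplus>\<^bsub>FM I v r\<^esub> \<psi> y" for x y
      by (auto simp: \<psi>_def fun_eq_iff)
    show "\<psi> (x \<odot>r\<^bsub>FM (\<beta> ` I) w r\<^esub> a) = \<psi> x \<odot>r\<^bsub>FM I v r\<^esub> a" for x a
      by (auto simp: \<psi>_def FM_ract fun_eq_iff v splitsum_zero)
  qed
  define \<psi>' where "\<psi>' = (\<lambda>(y :: _ \<times> 'e list \<Rightarrow> 'k) (j, p). if j \<in> \<beta> ` I then y (the_inv_into I \<beta> j, p) else (0::'k))"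
  note ti = the_inv_into_f_f[OF inj]
  have cl': "\<psi>' y \<in> carrier (FM (\<beta> ` I) w r)" if "y \<in> carrier (FM I v r)" for y
    using that by (fastforce simp: \<psi>'_def FM_carrier ti v split: if_splits)
  have "\<psi>' (\<psi> y) = y" if y: "y \<in> carrier (FM (\<beta> ` I) w r)" for y
  proof (rule ext, clarify)
    fix j p
    have "y (j, p) = 0" if "j \<notin> \<beta> ` I" using y that by (auto simp: FM_carrier)
    then show "\<psi>' (\<psi> y) (j, p) = y (j, p)" by (auto simp: \<psi>_def \<psi>'_def ti)
  qed
  moreover have "\<psi> (\<psi>' y) = y" if y: "y \<in> carrier (FM I v r)" for y
  proof (rule ext, clarify)
    fix j p
    have "y (j, p) = 0" if "j \<notin> I" using y that by (auto simp: FM_carrier)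
    then show "\<psi> (\<psi>' y) (j, p) = y (j, p)" by (auto simp: \<psi>_def \<psi>'_def ti)
  qed
  ultimately have "bij_betw \<psi> (carrier (FM (\<beta> ` I) w r)) (carrier (FM I v r))"
    using cl cl' by (intro bij_betwI[of _ _ _ \<psi>']) auto
  with hom show ?thesis by (rule rmod_isoI)
qed

text \<open>Indexing by the unit type makes a single summand an instance of
  \<open>FM\<close>.\<close>

definition MS :: "'v \<Rightarrow> nat \<Rightarrow> ('a, unit \<times> 'e list \<Rightarrow> 'k) rmodule" where
  "MS u r = FM UNIV (\<lambda>_. u) r"

text \<open>Renaming \<open>i\<close> to the element of the unit type turns
  \<open>insert i I\<close> into a disjoint sum, to which \<open>FM_plus_iso\<close>
  applies.\<close>

lemma FM_insert_iso:
  assumes "r \<le> k" "i \<notin> I"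
  shows "rmod_iso A (FM (insert i I) v r) (dsum (MS (v i) r) (FM I v r))"
proof -
  let ?\<beta> = "case_sum (\<lambda>_::unit. i) (\<lambda>j. j)" and ?w = "case_sum (\<lambda>_::unit. v i) v"
  have im: "?\<beta> ` (UNIV <+> I) = insert i I"
    unfolding Plus_def image_Un image_image by auto
  have "rmod_iso A (FM (?\<beta> ` (UNIV <+> I)) v r) (FM (UNIV <+> I) ?w r)"
    using assms by (intro FM_reindex_iso) (auto simp: inj_on_def)
  moreover have "rmod_iso A (FM (UNIV <+> I) ?w r) (dsum (MS (v i) r) (FM I v r))"
    unfolding MS_def using FM_plus_iso[OF assms(1)] by (rule rmod_isoI)
  ultimately show ?thesis unfolding im by (rule rmod_iso_trans)
qed

text \<open>The sum of two covers with kernels in the radical is again such a cover, and its kernel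
  is the sum of the kernels; uniqueness of syzygies does the rest.\<close>

lemma syzygy_dsum:
  assumes L: "L \<in> fg_modules A" "M \<in> fg_modules A" "M' \<in> fg_modules A" "rmod_iso A L (dsum M M')"
    and N: "is_syzygy A M N" "is_syzygy A M' N'" "is_syzygy A L X"
  shows "rmod_iso A X (dsum N N')"
proof -
  have M: "fgm A M" "right_module A M" "fgm A M'" "right_module A M'"
    using L by (auto simp: fgm_def fg_modules_def)
  have N': "fgm A N" "fgm A N'" using N by (auto simp: is_syzygy_def fgm_def fg_modules_def)
  obtain S :: "('v \<times> (nat \<Rightarrow> 'a) set) set" and f where S: "finite S" "\<And>i. i \<in> S \<Longrightarrow> fst i \<in> verts Q" "f \<in> rmod_hom A (FM S fst k) M"
    "f ` carrier (FM S fst k) = carrier M"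
    "\<And>y. y \<in> carrier (FM S fst k) \<Longrightarrow> f y = \<zero>\<^bsub>M\<^esub> \<Longrightarrow> y \<in> rad"
    by (rule minimal_cover[OF k_pos order_refl M(1) killed_k[OF M(2)]]) blast
  obtain T :: "('v \<times> (nat \<Rightarrow> 'a) set) set" and g where T: "finite T" "\<And>i. i \<in> T \<Longrightarrow> fst i \<in> verts Q" "g \<in> rmod_hom A (FM T fst k) M'"
    "g ` carrier (FM T fst k) = carrier M'"
    "\<And>y. y \<in> carrier (FM T fst k) \<Longrightarrow> g y = \<zero>\<^bsub>M'\<^esub> \<Longrightarrow> y \<in> rad"
    by (rule minimal_cover[OF k_pos order_refl M(3) killed_k[OF M(4)]]) blast
  let ?F = "FM S fst k" and ?G = "FM T fst k" and ?H = "FM (S <+> T) (case_sum fst fst) k"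
  note H = FM_right_module[OF order_refl, of "S <+> T" "case_sum fst fst"]
  note D = dsum_right_module[OF FM_right_module[OF order_refl, of S fst] FM_right_module[OF order_refl, of T fst]]
  define \<psi> where "\<psi> = (\<lambda>y :: ('v \<times> (nat \<Rightarrow> 'a) set + 'v \<times> (nat \<Rightarrow> 'a) set) \<times> 'e list \<Rightarrow> 'k.
    (\<lambda>(i, p). y (Inl i, p), \<lambda>(i, p). y (Inr i, p)))"
  have \<psi>: "\<psi> \<in> rmod_hom A ?H (dsum ?F ?G)" "bij_betw \<psi> (carrier ?H) (carrier (dsum ?F ?G))"
    unfolding \<psi>_def by (rule FM_plus_iso[OF order_refl])+
  note k = dsum_kernel[OF S(3) T(3)]
  let ?m = "\<lambda>y. map_prod f g (\<psi> y)"
  have m: "?m \<in> rmod_hom A ?H (dsum M M')" by (rule rmod_hom_comp[OF \<psi>(1) k(1)])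
  note DM = dsum_right_module[OF M(2,4)]
  have surj: "?m ` carrier ?H = carrier (dsum M M')"
  proof -
    have "?m ` carrier ?H = map_prod f g ` \<psi> ` carrier ?H" by (simp add: image_image)
    also have "\<dots> = map_prod f g ` (carrier ?F \<times> carrier ?G)" using \<psi>(2) by (simp add: bij_betw_def)
    finally show ?thesis using map_prod_surj_on[OF S(4) T(4)] by simp
  qed
  have rad: "y \<in> rad" if "y \<in> carrier ?H" "?m y = \<zero>\<^bsub>dsum M M'\<^esub>" for y
  proof -
    have "\<psi> y \<in> carrier (dsum ?F ?G)" using rmod_homD(1)[OF \<psi>(1) that(1)] .
    then have "fst (\<psi> y) \<in> rad" "snd (\<psi> y) \<in> rad"
      using S(5) T(5) that(2) by (auto simp: map_prod_def split: prod.splits)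
    then have "y (s, []) = 0" for s by (cases s) (auto simp: rad_def \<psi>_def)
    then show "y \<in> rad" by (simp add: rad_def)
  qed
  have iN: "rmod_iso A N (kernel_module ?F M f)"
  proof -
    note K = FM_kernel_fgm[OF order_refl S(1) M(2) S(3)]
    have "is_syzygy A M (rep A (kernel_module ?F M f))"
      by (rule syzygyI[OF S(1,2) L(2) rmod_iso_refl M(2) S(3,4,5) rep(1,3)[OF K]])
    then show ?thesis using is_syzygy_unique[OF L(2) N(1)] rep(3)[OF K] rmod_iso_trans by blast
  qed
  have iN': "rmod_iso A N' (kernel_module ?G M' g)"
  proof -
    note K = FM_kernel_fgm[OF order_refl T(1) M(4) T(3)]
    have "is_syzygy A M' (rep A (kernel_module ?G M' g))"
      by (rule syzygyI[OF T(1,2) L(3) rmod_iso_refl M(4) T(3,4,5) rep(1,3)[OF K]])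
    then show ?thesis using is_syzygy_unique[OF L(3) N(2)] rep(3)[OF K] rmod_iso_trans by blast
  qed
  have i1: "rmod_iso A (dsum N N') (dsum (kernel_module ?F M f) (kernel_module ?G M' g))"
    by (rule dsum_iso_cong[OF iN iN'])
  have "rmod_iso A (kernel_module ?H (dsum M M') ?m) (kernel_module (dsum ?F ?G) (dsum M M') (map_prod f g))"
    by (rule kernel_iso_transport[OF \<psi>])
  then have i2: "rmod_iso A (kernel_module (dsum ?F ?G) (dsum M M') (map_prod f g)) (kernel_module ?H (dsum M M') ?m)"
    by (rule rmod_iso_sym[OF kernel_right_module[OF H DM m]])
  have i: "rmod_iso A (dsum N N') (kernel_module ?H (dsum M M') ?m)"
    by (rule rmod_iso_trans[OF i1 rmod_iso_trans[OF k(2) i2]])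
  note R = rep[OF dsum_fgm[OF N']]
  have "is_syzygy A L (rep A (dsum N N'))"
  proof (rule syzygyI[OF _ _ L(1,4) DM m surj rad R(1)])
    show "finite (S <+> T)" using S T by simp
    show "case_sum fst fst i \<in> verts Q" if "i \<in> S <+> T" for i using that S T by auto
    show "rmod_iso A (rep A (dsum N N')) (kernel_module ?H (dsum M M') ?m)"
      using R(3) i rmod_iso_trans by blast
  qed
  then show ?thesis using is_syzygy_unique[OF L(1) N(3)] R(3) rmod_iso_trans by blast
qed

end

section \<open>The group \<open>K0\<close>\<close>

abbreviation FG :: "('a, 'c) ring_scheme \<Rightarrow> ('a fg_module \<Rightarrow>\<^sub>0 int) monoid" where
  "FG A \<equiv> free_Abelian_group (fg_modules A)"

text \<open>The projection of the free abelian group onto \<open>K0\<close>. Computations are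
  carried out with formal sums and pushed down by it.\<close>

definition kc :: "('a, 'c) ring_scheme \<Rightarrow> ('a fg_module \<Rightarrow>\<^sub>0 int) \<Rightarrow> ('a fg_module \<Rightarrow>\<^sub>0 int) set" where
  "kc A c = K0_subgroup A #>\<^bsub>FG A\<^esub> c"

lemma K0_class_kc: "K0_class A M = kc A (frag_of M)"
  by (simp add: K0_class_def kc_def)

lemma K0_relations_carrier: "K0_relations A \<subseteq> carrier (FG A)"
proof -
  have "frag_of M - frag_of M' - frag_of M'' \<in> carrier (FG A)"
    if "M \<in> fg_modules A" "M' \<in> fg_modules A" "M'' \<in> fg_modules A" for M M' M''
    using that keys_diff[of "frag_of M - frag_of M'" "frag_of M''"] keys_diff[of "frag_of M" "frag_of M'"]
    by (auto simp: keys_frag_of)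
  then show ?thesis unfolding K0_relations_def by (auto simp: projective_modules_def keys_frag_of)
qed

lemma K0_subgroup_subgroup: "subgroup (K0_subgroup A) (FG A)"
  unfolding K0_subgroup_def by (rule group.generate_is_subgroup[OF group_free_Abelian_group K0_relations_carrier])

lemma K0_subgroup_normal: "K0_subgroup A \<lhd> FG A"
  by (rule comm_group.subgroup_imp_normal[OF abelian_free_Abelian_group K0_subgroup_subgroup])

lemma K0_comm_group: "comm_group (K0 A)"
  unfolding K0_def by (rule comm_group.abelian_FactGroup[OF abelian_free_Abelian_group K0_subgroup_subgroup])

lemma K0_group: "group (K0 A)"
  using K0_comm_group by (rule comm_group.axioms(2))

lemma kc_hom: "kc A \<in> hom (FG A) (K0 A)"
  using normal.r_coset_hom_Mod[OF K0_subgroup_normal] by (simp add: K0_def kc_def[abs_def])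

lemma kc_add:
  "c \<in> carrier (FG A) \<Longrightarrow> d \<in> carrier (FG A) \<Longrightarrow> kc A (c + d) = kc A c \<otimes>\<^bsub>K0 A\<^esub> kc A d"
  using hom_mult[OF kc_hom, of c A d] by simp

lemma kc_eq_iff:
  assumes "c \<in> carrier (FG A)" "d \<in> carrier (FG A)"
  shows "kc A c = kc A d \<longleftrightarrow> c - d \<in> K0_subgroup A"
proof -
  have "c \<in> kc A d \<longleftrightarrow> c - d \<in> K0_subgroup A"
    using subgroup.rcos_module[OF K0_subgroup_subgroup group_free_Abelian_group assms(2,1)] assms(2)
    by (simp add: kc_def)
  moreover have "kc A c = kc A d \<longleftrightarrow> c \<in> kc A d"
    using group.repr_independence[OF group_free_Abelian_group _ assms(2) K0_subgroup_subgroup, of c]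
      group.rcos_self[OF group_free_Abelian_group assms(1) K0_subgroup_subgroup]
    by (auto simp: kc_def)
  ultimately show ?thesis by simp
qed

lemma frag_cmul_carrier: "c \<in> carrier (free_Abelian_group S) \<Longrightarrow> frag_cmul n c \<in> carrier (free_Abelian_group S)"
  using keys_cmul[of n c] by auto

lemma K0_subgroup_add: "c \<in> K0_subgroup A \<Longrightarrow> d \<in> K0_subgroup A \<Longrightarrow> c + d \<in> K0_subgroup A"
  using subgroup.m_closed[OF K0_subgroup_subgroup] by simp

lemma K0_subgroup_zero: "0 \<in> K0_subgroup A"
  using subgroup.one_closed[OF K0_subgroup_subgroup] by simp

lemma K0_subgroup_cmul: "c \<in> K0_subgroup A \<Longrightarrow> frag_cmul n c \<in> K0_subgroup A"
proof -
  assume c: "c \<in> K0_subgroup A"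
  then have "Poly_Mapping.keys c \<subseteq> fg_modules A" using subgroup.mem_carrier[OF K0_subgroup_subgroup c] by simp
  then show ?thesis
    using group.subgroup_int_pow_closed[OF group_free_Abelian_group K0_subgroup_subgroup c, of n] by simp
qed

lemma kc_sum_cong:
  assumes "finite I" "\<And>i. i \<in> I \<Longrightarrow> x i \<in> carrier (FG A)" "\<And>i. i \<in> I \<Longrightarrow> y i \<in> carrier (FG A)"
    and "\<And>i. i \<in> I \<Longrightarrow> kc A (x i) = kc A (y i)"
  shows "kc A (\<Sum>i\<in>I. frag_cmul (c i) (x i)) = kc A (\<Sum>i\<in>I. frag_cmul (c i) (y i))"
proof -
  have "(\<Sum>i\<in>J. frag_cmul (c i) (x i)) - (\<Sum>i\<in>J. frag_cmul (c i) (y i)) \<in> K0_subgroup A" if "J \<subseteq> I" for J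
    using finite_subset[OF that assms(1)] that
  proof (induction J)
    case (insert j J)
    have "frag_cmul (c j) (x j - y j) \<in> K0_subgroup A"
      using assms(2-4)[of j] insert.prems by (intro K0_subgroup_cmul) (simp add: kc_eq_iff del: carrier_free_Abelian_group_iff)
    then have "frag_cmul (c j) (x j - y j) + ((\<Sum>i\<in>J. frag_cmul (c i) (x i)) - (\<Sum>i\<in>J. frag_cmul (c i) (y i))) \<in> K0_subgroup A"
      using insert.IH insert.prems by (intro K0_subgroup_add) auto
    moreover have "frag_cmul (c j) (x j - y j) = frag_cmul (c j) (x j) - frag_cmul (c j) (y j)"
      by (rule poly_mapping_eqI) (simp add: lookup_minus right_diff_distrib)
    ultimately show ?case using insert.hyps by (simp add: algebra_simps)
  qed (simp add: K0_subgroup_zero)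
  then show ?thesis using assms(1-3)
    by (subst kc_eq_iff) (auto intro!: sum_closed_free_Abelian_group frag_cmul_carrier simp del: carrier_free_Abelian_group_iff)
qed

lemma kc_dsum:
  assumes "M \<in> fg_modules A" "M' \<in> fg_modules A" "M'' \<in> fg_modules A" "rmod_iso A M (dsum M' M'')"
  shows "kc A (frag_of M) = kc A (frag_of M' + frag_of M'')"
proof -
  have "frag_of M - frag_of M' - frag_of M'' \<in> K0_subgroup A"
    unfolding K0_subgroup_def by (rule generate.incl) (use assms in \<open>auto simp: K0_relations_def\<close>)
  moreover have "frag_of M' + frag_of M'' \<in> carrier (FG A)"
    using assms keys_add[of "frag_of M'" "frag_of M''"] by (auto simp: keys_frag_of)
  ultimately show ?thesis using assms(1) by (subst kc_eq_iff) (auto simp: algebra_simps keys_frag_of)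
qed

lemma kc_projective:
  assumes "P \<in> projective_modules A"
  shows "kc A (frag_of P) = kc A 0"
proof -
  have "frag_of P \<in> K0_subgroup A"
    unfolding K0_subgroup_def by (rule generate.incl) (use assms in \<open>auto simp: K0_relations_def\<close>)
  then show ?thesis using assms by (subst kc_eq_iff) (auto simp: keys_frag_of projective_modules_def)
qed

lemma free_hom_eq:
  assumes G: "group G" and h: "h1 \<in> hom (free_Abelian_group S) G" "h2 \<in> hom (free_Abelian_group S) G"
    and eq: "\<And>x. x \<in> S \<Longrightarrow> h1 (frag_of x) = h2 (frag_of x)" and c: "c \<in> carrier (free_Abelian_group S)"
  shows "h1 c = h2 c"
proof -
  interpret h1: group_hom "free_Abelian_group S" G h1 using G h by (simp add: group_hom_def group_hom_axioms_def)
  interpret h2: group_hom "free_Abelian_group S" G h2 using G h by (simp add: group_hom_def group_hom_axioms_def)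
  have "c \<in> carrier (free_Abelian_group S) \<and> h1 c = h2 c"
    using c[unfolded carrier_free_Abelian_group_iff]
  proof (induction c rule: frag_induction)
    case zero
    show ?case using h1.hom_one h2.hom_one by simp
  next
    case (one x)
    then show ?case using eq by (simp add: keys_frag_of)
  next
    case (diff a b)
    then have ab: "a \<in> carrier (free_Abelian_group S)" "b \<in> carrier (free_Abelian_group S)" by auto
    have e: "a - b = a \<otimes>\<^bsub>free_Abelian_group S\<^esub> inv\<^bsub>free_Abelian_group S\<^esub> b" using ab by simp
    have "a - b \<in> carrier (free_Abelian_group S)" unfolding e using ab by (intro h1.G.m_closed h1.G.inv_closed)
    moreover have "h1 (a - b) = h2 (a - b)"
      unfolding e h1.hom_mult[OF ab(1) h1.G.inv_closed[OF ab(2)]] h2.hom_mult[OF ab(1) h1.G.inv_closed[OF ab(2)]]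
        h1.hom_inv[OF ab(2)] h2.hom_inv[OF ab(2)] using diff by simp
    ultimately show ?case by simp
  qed
  then show ?thesis ..
qed

text \<open>The linear extension of the function \<open>g\<close> from modules to formal sums:
  \<open>frag_extend\<close> maps into the free abelian group on one point, which is then identified
  with the integers.\<close>

definition hsum :: "('x \<Rightarrow> int) \<Rightarrow> ('x \<Rightarrow>\<^sub>0 int) \<Rightarrow> int" where
  "hsum g c = Poly_Mapping.lookup (frag_extend (\<lambda>M. frag_cmul (g M) (frag_of ())) c) ()"

lemma hsum_simps:
  "hsum g 0 = 0" "hsum g (frag_of M) = g M" "hsum g (c + d) = hsum g c + hsum g d"
  "hsum g (c - d) = hsum g c - hsum g d" "hsum g (- c) = - hsum g c" "hsum g (frag_cmul n c) = n * hsum g c"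
  by (simp_all add: hsum_def frag_extend_add frag_extend_diff frag_extend_minus frag_extend_cmul
      lookup_add lookup_minus)

lemma hsum_sum: "hsum g (\<Sum>i\<in>I. c i) = (\<Sum>i\<in>I. hsum g (c i))"
  by (induction I rule: infinite_finite_induct) (auto simp: hsum_simps)

text \<open>An integer-valued invariant that is additive and vanishes on projective modules kills
  the defining relations, so it factors through \<open>K0\<close>. Such invariants are used to
  separate classes.\<close>

lemma hsum_kc_eq:
  assumes add: "\<And>M M' M''. \<lbrakk>M \<in> fg_modules A; M' \<in> fg_modules A; M'' \<in> fg_modules A; rmod_iso A M (dsum M' M'')\<rbrakk>
      \<Longrightarrow> g M = g M' + g M''"
    and proj: "\<And>P. P \<in> projective_modules A \<Longrightarrow> g P = 0"
    and c: "c \<in> carrier (FG A)" "d \<in> carrier (FG A)" "kc A c = kc A d"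
  shows "hsum g c = hsum g d"
proof -
  have rel: "hsum g x = 0" if "x \<in> K0_relations A" for x
    using that add proj by (auto simp: K0_relations_def hsum_simps)
  have "hsum g x = 0" if "x \<in> K0_subgroup A" for x
    using that unfolding K0_subgroup_def
  proof (induction rule: generate.induct)
    case (inv h)
    have "Poly_Mapping.keys h \<subseteq> fg_modules A" using subsetD[OF K0_relations_carrier inv] by simp
    then show ?case using rel[OF inv] by (simp add: hsum_simps)
  qed (auto simp: hsum_simps rel)
  then have "hsum g (c - d) = 0" using c by (subst (asm) kc_eq_iff) auto
  then show ?thesis by (simp add: hsum_simps)
qed

section \<open>The syzygy endomorphism of \<open>K0\<close>\<close>

context trunc_alg
begin

lemma rep_FM_empty:
  assumes "0 < r" "r \<le> k"
  shows "rep A (FM {} v r) \<in> fg_modules A" "carrier (rep A (FM {} v r)) = {\<zero>\<^bsub>rep A (FM {} v r)\<^esub>}"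
proof -
  let ?F = "FM {} v r"
  have F: "fgm A ?F" using assms by (intro FM_fgm) auto
  note R = rep[OF F]
  show "rep A ?F \<in> fg_modules A" by (rule R)
  have m: "right_module A ?F" "right_module A (rep A ?F)" using F R(4) by (simp_all add: fgm_def)
  obtain f where f: "f \<in> rmod_hom A ?F (rep A ?F)" "bij_betw f (carrier ?F) (carrier (rep A ?F))"
    using R(2) by (rule rmod_isoE)
  have "carrier ?F = {\<zero>\<^bsub>?F\<^esub>}" by (auto simp: FM_carrier)
  then have "carrier (rep A ?F) = {f \<zero>\<^bsub>?F\<^esub>}" using f(2) by (auto simp: bij_betw_def)
  then show "carrier (rep A ?F) = {\<zero>\<^bsub>rep A ?F\<^esub>}" using rmod_hom_zero[OF m f(1)] by simp
qed

lemma zero_module_exists: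
  obtains Z where "Z \<in> fg_modules A" "carrier Z = {\<zero>\<^bsub>Z\<^esub>}" "right_module A Z"
proof
  note Z = rep_FM_empty[OF k_pos order_refl, of "undefined :: nat \<Rightarrow> 'v"]
  show "rep A (FM {} (undefined :: nat \<Rightarrow> 'v) k) \<in> fg_modules A"
    "carrier (rep A (FM {} (undefined :: nat \<Rightarrow> 'v) k)) = {\<zero>\<^bsub>rep A (FM {} (undefined :: nat \<Rightarrow> 'v) k)\<^esub>}"
    "right_module A (rep A (FM {} (undefined :: nat \<Rightarrow> 'v) k))"
    using Z by (simp_all add: fg_modules_def)
qed

text \<open>The relations of \<open>K0\<close> mention direct sums only; take a zero module as
  second summand, whose class vanishes because it is projective.\<close>

lemma kc_iso:
  assumes "M \<in> fg_modules A" "N \<in> fg_modules A" "rmod_iso A M N"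
  shows "kc A (frag_of M) = kc A (frag_of N)"
proof -
  obtain Z where Z: "Z \<in> fg_modules A" "carrier Z = {\<zero>\<^bsub>Z\<^esub>}" "right_module A Z"
    by (rule zero_module_exists)
  have N: "right_module A N" using assms(2) by (simp add: fg_modules_def)
  have "rmod_iso A M (dsum N Z)"
    by (rule rmod_iso_trans[OF assms(3) dsum_zero_iso[OF N Z(3,2)]])
  then have "kc A (frag_of M) = kc A (frag_of N + frag_of Z)" by (rule kc_dsum[OF assms(1,2) Z(1)])
  also have "\<dots> = kc A (frag_of N) \<otimes>\<^bsub>K0 A\<^esub> kc A (frag_of Z)"
    using assms(2) Z(1) by (intro kc_add) (auto simp: keys_frag_of)
  also have "kc A (frag_of Z) = kc A 0" by (rule kc_projective[OF zero_module_projective[OF Z(1,2)]])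
  also have "kc A (frag_of N) \<otimes>\<^bsub>K0 A\<^esub> kc A 0 = kc A (frag_of N + 0)"
    using assms(2) by (intro kc_add[symmetric]) (auto simp: keys_frag_of)
  finally show ?thesis by simp
qed

definition syz :: "'a fg_module \<Rightarrow> 'a fg_module" where
  "syz M = (SOME N. is_syzygy A M N)"

lemma syz: "M \<in> fg_modules A \<Longrightarrow> is_syzygy A M (syz M)"
  unfolding syz_def by (metis syzygy_exists someI_ex)

lemma syz_fg: "M \<in> fg_modules A \<Longrightarrow> syz M \<in> fg_modules A"
  using syz by (simp add: is_syzygy_def)

lemma frag_extend_syz_hom: "frag_extend (\<lambda>M. frag_of (syz M)) \<in> hom (FG A) (FG A)"
proof (rule homI)
  fix c assume "c \<in> carrier (FG A)"
  then show "frag_extend (\<lambda>M. frag_of (syz M)) c \<in> carrier (FG A)"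
    using keys_frag_extend[of "\<lambda>M. frag_of (syz M)" c] syz_fg by (auto simp: keys_frag_of)
qed (simp add: frag_extend_add)

text \<open>Syzygies are additive on direct sums and vanish on projective modules, up to
  isomorphism. Both kinds of defining relations are therefore respected.\<close>

lemma kc_syz_relation: "x \<in> K0_relations A \<Longrightarrow> kc A (frag_extend (\<lambda>M. frag_of (syz M)) x) = kc A 0"
  unfolding K0_relations_def
proof (elim UnE imageE CollectE exE conjE)
  fix M M' M'' assume x: "x = frag_of M - frag_of M' - frag_of M''"
    and M: "M \<in> fg_modules A" "M' \<in> fg_modules A" "M'' \<in> fg_modules A" "rmod_iso A M (dsum M' M'')"
  have "rmod_iso A (syz M) (dsum (syz M') (syz M''))"
    by (rule syzygy_dsum[OF M syz[OF M(2)] syz[OF M(3)] syz[OF M(1)]])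
  then have "frag_of (syz M) - frag_of (syz M') - frag_of (syz M'') \<in> K0_subgroup A"
    unfolding K0_subgroup_def by (intro generate.incl) (use M syz_fg in \<open>auto simp: K0_relations_def\<close>)
  moreover from this have "frag_of (syz M) - frag_of (syz M') - frag_of (syz M'') \<in> carrier (FG A)"
    using subgroup.subset[OF K0_subgroup_subgroup] by blast
  ultimately show ?thesis by (subst kc_eq_iff) (auto simp: x frag_extend_diff)
next
  fix P assume P: "x = frag_of P" "P \<in> projective_modules A"
  then have Pf: "P \<in> fg_modules A" by (simp add: projective_modules_def)
  obtain Z where Z: "Z \<in> fg_modules A" "carrier Z = {\<zero>\<^bsub>Z\<^esub>}" "right_module A Z"
    by (rule zero_module_exists)
  have "rmod_iso A (syz P) Z"
    by (rule is_syzygy_unique[OF Pf syz[OF Pf] syzygy_of_projective[OF P(2) Z(1,2)]])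
  then have "kc A (frag_of (syz P)) = kc A (frag_of Z)" by (rule kc_iso[OF syz_fg[OF Pf] Z(1)])
  also have "\<dots> = kc A 0" by (rule kc_projective[OF zero_module_projective[OF Z(1,2)]])
  finally show ?thesis using P(1) by simp
qed

text \<open>The linear extension of the chosen syzygies factors through \<open>K0\<close>; any other
  syzygy is isomorphic to the chosen one and has the same class. This gives the \<open>SOME\<close>
  in \<open>syzygy_endo\<close> its meaning.\<close>

lemma syzygy_endo_exists:
  "\<exists>w. w \<in> hom (K0 A) (K0 A) \<and>
     (\<forall>M\<in>fg_modules A. \<forall>N. is_syzygy A M N \<longrightarrow> w (K0_class A M) = K0_class A N)"
proof -
  let ?E = "frag_extend (\<lambda>M. frag_of (syz M))"
  let ?\<psi> = "\<lambda>c. kc A (?E c)"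
  have \<psi>: "?\<psi> \<in> hom (FG A) (K0 A)"
    using hom_compose[OF frag_extend_syz_hom kc_hom] by (simp add: o_def)
  interpret \<psi>: group_hom "FG A" "K0 A" ?\<psi>
    using \<psi> K0_group by (simp add: group_hom_def group_hom_axioms_def)
  have one: "kc A 0 = \<one>\<^bsub>K0 A\<^esub>" using \<psi>.hom_one by simp
  have ker: "?\<psi> x = \<one>\<^bsub>K0 A\<^esub>" if "x \<in> K0_subgroup A" for x
    using that unfolding K0_subgroup_def
  proof (induction rule: generate.induct)
    case one
    then show ?case using \<psi>.hom_one by simp
  next
    case (incl h)
    then show ?case using kc_syz_relation \<open>kc A 0 = \<one>\<^bsub>K0 A\<^esub>\<close> by simp
  next
    case (inv h)
    have "h \<in> carrier (FG A)" by (rule subsetD[OF K0_relations_carrier inv])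
    then show ?case using \<psi>.hom_inv kc_syz_relation[OF inv] \<open>kc A 0 = \<one>\<^bsub>K0 A\<^esub>\<close> by simp
  next
    case (eng h1 h2)
    then have "h1 \<in> carrier (FG A)" "h2 \<in> carrier (FG A)"
      using subgroup.mem_carrier[OF K0_subgroup_subgroup] unfolding K0_subgroup_def by blast+
    then show ?case using \<psi>.hom_mult eng by simp
  qed
  have fac: "?\<psi> c = ?\<psi> d" if cd: "c \<in> carrier (FG A)" "d \<in> carrier (FG A)" "kc A c = kc A d" for c d
  proof -
    have "c - d \<in> K0_subgroup A" using cd kc_eq_iff by blast
    then have s: "c - d \<in> carrier (FG A)" and "?\<psi> (c - d) = \<one>\<^bsub>K0 A\<^esub>"
      using ker subgroup.mem_carrier[OF K0_subgroup_subgroup] by blast+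
    then have "?\<psi> ((c - d) \<otimes>\<^bsub>FG A\<^esub> d) = ?\<psi> d"
      using \<psi>.hom_mult[OF s cd(2)] \<psi>.hom_closed[OF cd(2)] by simp
    then show ?thesis by simp
  qed
  obtain w where w: "w \<in> hom (K0 A) (K0 A)" "\<And>c. c \<in> carrier (FG A) \<Longrightarrow> w (kc A c) = ?\<psi> c"
    using FactGroup_universal[OF \<psi> K0_subgroup_normal] fac unfolding K0_def kc_def by metis
  have "w (K0_class A M) = K0_class A N" if "M \<in> fg_modules A" "is_syzygy A M N" for M N
  proof -
    have "w (K0_class A M) = kc A (frag_of (syz M))"
      unfolding K0_class_kc using w(2)[of "frag_of M"] that(1) by (simp add: keys_frag_of)
    also have "\<dots> = kc A (frag_of N)"
      using that syz[OF that(1)] by (intro kc_iso is_syzygy_unique) (auto simp: is_syzygy_def syz_fg)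
    finally show ?thesis by (simp add: K0_class_kc)
  qed
  then show ?thesis using w(1) by blast
qed

lemma syzygy_endo_hom: "syzygy_endo A \<in> hom (K0 A) (K0 A)"
  and syzygy_endo_class: "M \<in> fg_modules A \<Longrightarrow> is_syzygy A M N \<Longrightarrow> syzygy_endo A (K0_class A M) = K0_class A N"
  using someI_ex[OF syzygy_endo_exists] unfolding syzygy_endo_def by blast+

lemma syzygy_endo_kc:
  assumes "c \<in> carrier (FG A)"
  shows "syzygy_endo A (kc A c) = kc A (frag_extend (\<lambda>M. frag_of (syz M)) c)"
proof (rule free_hom_eq[OF K0_group _ _ _ assms])
  show "(\<lambda>c. syzygy_endo A (kc A c)) \<in> hom (FG A) (K0 A)"
    using hom_compose[OF kc_hom syzygy_endo_hom] by (simp add: o_def)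
  show "(\<lambda>c. kc A (frag_extend (\<lambda>M. frag_of (syz M)) c)) \<in> hom (FG A) (K0 A)"
    using hom_compose[OF frag_extend_syz_hom kc_hom] by (simp add: o_def)
  show "syzygy_endo A (kc A (frag_of M)) = kc A (frag_extend (\<lambda>M. frag_of (syz M)) (frag_of M))"
    if "M \<in> fg_modules A" for M
    using syzygy_endo_class[OF that syz[OF that]] by (simp add: K0_class_kc)
qed

lemma MS_right_module: "r \<le> k \<Longrightarrow> right_module A (MS u r)"
  unfolding MS_def by (rule FM_right_module)

lemma MS_fgm: "0 < r \<Longrightarrow> r \<le> k \<Longrightarrow> u \<in> verts Q \<Longrightarrow> fgm A (MS u r)"
  unfolding MS_def by (rule FM_fgm) auto

lemma sum_frag_carrier:
  "(\<And>i. i \<in> I \<Longrightarrow> M i \<in> S) \<Longrightarrow> (\<Sum>i\<in>I. frag_cmul (c i) (frag_of (M i))) \<in> carrier (free_Abelian_group S)"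
  by (intro sum_closed_free_Abelian_group frag_cmul_carrier) (simp add: keys_frag_of)

lemma kc_FM:
  assumes "0 < r" "r \<le> k" "finite I" "\<And>i. i \<in> I \<Longrightarrow> v i \<in> verts Q"
  shows "kc A (frag_of (rep A (FM I v r))) = kc A (\<Sum>i\<in>I. frag_of (rep A (MS (v i) r)))"
  using assms(3,4)
proof (induction I)
  case empty
  show ?case
    using kc_projective[OF zero_module_projective[OF rep_FM_empty[OF assms(1,2)]]] by simp
next
  case (insert i I)
  have f: "fgm A (FM (insert i I) v r)" "fgm A (FM I v r)" "fgm A (MS (v i) r)"
    using insert assms(1,2) by (auto intro!: FM_fgm MS_fgm)
  note R = rep[OF f(1)] rep[OF f(2)] rep[OF f(3)]
  have "rmod_iso A (dsum (MS (v i) r) (FM I v r)) (dsum (rep A (MS (v i) r)) (rep A (FM I v r)))"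
    using R by (intro dsum_iso_cong)
  then have "rmod_iso A (rep A (FM (insert i I) v r)) (dsum (rep A (MS (v i) r)) (rep A (FM I v r)))"
    by (rule rmod_iso_trans[OF R(3) rmod_iso_trans[OF FM_insert_iso[OF assms(2) insert.hyps(2)]]])
  then have "kc A (frag_of (rep A (FM (insert i I) v r)))
    = kc A (frag_of (rep A (MS (v i) r)) + frag_of (rep A (FM I v r)))"
    by (rule kc_dsum[OF R(1,9,5)])
  also have "\<dots> = kc A (frag_of (rep A (MS (v i) r))) \<otimes>\<^bsub>K0 A\<^esub> kc A (frag_of (rep A (FM I v r)))"
    using R by (intro kc_add) (auto simp: keys_frag_of)
  also have "kc A (frag_of (rep A (FM I v r))) = kc A (\<Sum>i\<in>I. frag_of (rep A (MS (v i) r)))"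
    using insert by auto
  also have "kc A (frag_of (rep A (MS (v i) r))) \<otimes>\<^bsub>K0 A\<^esub> kc A (\<Sum>i\<in>I. frag_of (rep A (MS (v i) r)))
    = kc A (frag_of (rep A (MS (v i) r)) + (\<Sum>i\<in>I. frag_of (rep A (MS (v i) r))))"
  proof (rule kc_add[symmetric])
    show "frag_of (rep A (MS (v i) r)) \<in> carrier (FG A)" using R by (simp add: keys_frag_of)
    have "rep A (MS (v j) r) \<in> fg_modules A" if "j \<in> I" for j
      using insert.prems that assms(1,2) by (intro rep MS_fgm) auto
    then show "(\<Sum>i\<in>I. frag_of (rep A (MS (v i) r))) \<in> carrier (FG A)"
      by (intro sum_closed_free_Abelian_group) (simp add: keys_frag_of)
  qed
  finally show ?case using insert.hyps by simp
qed

end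

section \<open>Multiplicities in the top\<close>

lemma fs_independent_Un:
  fixes S T :: "('x \<Rightarrow> 'k::field) set"
  assumes "fs.independent S" "fs.independent T" "finite S" "finite T" "fs.span S \<inter> fs.span T \<subseteq> {0}"
  shows "S \<inter> T = {}" "fs.independent (S \<union> T)"
proof -
  have "0 \<notin> S" using assms(1) fs.dependent_zero by blast
  moreover have "S \<inter> T \<subseteq> {0}" using assms(5) fs.span_superset by blast
  ultimately show d: "S \<inter> T = {}" by blast
  show "fs.independent (S \<union> T)"
  proof
    assume "fs.dependent (S \<union> T)"
    then obtain u v where u: "v \<in> S \<union> T" "u v \<noteq> 0" "(\<Sum>v\<in>S \<union> T. (\<lambda>t. u v * v t)) = 0"
      using assms(3,4) by (auto simp: fs.dependent_finite)
    let ?s = "\<Sum>v\<in>S. (\<lambda>t. u v * v t)" and ?t = "\<Sum>v\<in>T. (\<lambda>t. u v * v t)"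
    have "?s + ?t = 0" using u(3) by (simp add: sum.union_disjoint[OF assms(3,4) d])
    then have st: "?s = - ?t" by (rule eq_neg_iff_add_eq_0[THEN iffD2])
    have "?s \<in> fs.span S" "?t \<in> fs.span T" by (intro fs.span_sum fs.span_scale fs.span_base; simp)+
    then have "?s = 0" using st assms(5) fs.span_neg[of ?t T] by auto
    moreover from this have "?t = 0" using st by simp
    ultimately have "\<forall>v\<in>S. u v = 0" "\<forall>v\<in>T. u v = 0"
      using assms(1-4) unfolding fs.dependent_finite[OF assms(3)] fs.dependent_finite[OF assms(4)] by blast+
    then show False using u(1,2) by blast
  qed
qed

lemma fs_finite_basis:
  fixes V :: "('x \<Rightarrow> 'k::field) set"
  assumes "fs.subspace V" "V \<subseteq> fs.span W" "finite W"
  obtains B where "finite B" "fs.independent B" "V = fs.span B" "card B = fs.dim V"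
proof -
  obtain B where B: "B \<subseteq> V" "fs.independent B" "V \<subseteq> fs.span B" "card B = fs.dim V"
    by (rule fs.basis_exists)
  have "finite B" using fs.independent_span_bound[OF assms(3) B(2)] B(1) assms(2) by blast
  moreover have "fs.span B = V" using B(1,3) assms(1) fs.span_minimal by blast
  ultimately show ?thesis using that B by blast
qed

text \<open>The images of a basis of \<open>V\<close> and of a basis of \<open>W\<close> together
  form a basis of \<open>U\<close>. The three spaces consist of functions on different types, which
  is why the embeddings are explicit.\<close>

lemma fs_dim_direct_sum:
  fixes V :: "('x \<Rightarrow> 'k::field) set" and W :: "('y \<Rightarrow> 'k) set" and U :: "('z \<Rightarrow> 'k) set"
  assumes V: "fs.subspace V" "V \<subseteq> fs.span V'" "finite V'" and W: "fs.subspace W" "W \<subseteq> fs.span W'" "finite W'"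
    and \<alpha>: "\<And>f g. \<alpha> (f + g) = \<alpha> f + \<alpha> g" "\<And>c f. \<alpha> (\<lambda>t. c * f t) = (\<lambda>t. c * \<alpha> f t)"
    and \<beta>: "\<And>f g. \<beta> (f + g) = \<beta> f + \<beta> g" "\<And>c f. \<beta> (\<lambda>t. c * f t) = (\<lambda>t. c * \<beta> f t)"
    and inj: "inj_on \<alpha> V" "inj_on \<beta> W" and int: "\<alpha> ` V \<inter> \<beta> ` W \<subseteq> {0}"
    and U: "U = {\<alpha> f + \<beta> g | f g. f \<in> V \<and> g \<in> W}"
  shows "fs.dim U = fs.dim V + fs.dim W"
proof -
  interpret \<alpha>: Vector_Spaces.linear "\<lambda>c (f::'x \<Rightarrow> 'k) t. c * f t" "\<lambda>c (f::'z \<Rightarrow> 'k) t. c * f t" \<alpha>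
    by unfold_locales (rule \<alpha>)+
  interpret \<beta>: Vector_Spaces.linear "\<lambda>c (f::'y \<Rightarrow> 'k) t. c * f t" "\<lambda>c (f::'z \<Rightarrow> 'k) t. c * f t" \<beta>
    by unfold_locales (rule \<beta>)+
  obtain B where B: "finite B" "fs.independent B" "V = fs.span B" "card B = fs.dim V"
    by (rule fs_finite_basis[OF V])
  obtain C where C: "finite C" "fs.independent C" "W = fs.span C" "card C = fs.dim W"
    by (rule fs_finite_basis[OF W])
  have ind: "fs.independent (\<alpha> ` B)" "fs.independent (\<beta> ` C)"
    using inj B C \<alpha>.independent_injective_image \<beta>.independent_injective_image by auto
  have sp: "fs.span (\<alpha> ` B) = \<alpha> ` V" "fs.span (\<beta> ` C) = \<beta> ` W"
    using \<alpha>.span_image \<beta>.span_image B C by auto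
  note un = fs_independent_Un[OF ind finite_imageI[OF B(1)] finite_imageI[OF C(1)], unfolded sp, OF int]
  have "fs.span (\<alpha> ` B \<union> \<beta> ` C) = U"
    unfolding fs.span_Un sp U by auto
  then have "fs.dim U = card (\<alpha> ` B \<union> \<beta> ` C)"
    using fs.dim_span_eq_card_independent[OF un(2)] by simp
  also have "\<dots> = card (\<alpha> ` B) + card (\<beta> ` C)"
    using un(1) B C by (intro card_Un_disjoint) auto
  also have "card (\<alpha> ` B) = card B"
    using inj(1) B(3) fs.span_superset by (intro card_image) (blast intro: inj_on_subset)
  also have "card (\<beta> ` C) = card C"
    using inj(2) C(3) fs.span_superset by (intro card_image) (blast intro: inj_on_subset)
  finally show ?thesis using B C by simp
qed

context trunc_alg
begin

text \<open>The largest submodule of \<open>N\<close> that \<open>J\<^sup>r\<close>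
  annihilates.\<close>

definition ann :: "nat \<Rightarrow> ('a, 'm) rmodule \<Rightarrow> 'm set" where
  "ann r N = {x \<in> carrier N. \<forall>a\<in>carrier A. (\<forall>u p. length p < r \<longrightarrow> coef a (u, p) = 0) \<longrightarrow> x \<odot>r\<^bsub>N\<^esub> a = \<zero>\<^bsub>N\<^esub>}"

lemma ann_carrier: "x \<in> ann r N \<Longrightarrow> x \<in> carrier N"
  by (simp add: ann_def)

lemma ann_hom:
  assumes "right_module A M" "right_module A N" "f \<in> rmod_hom A M N" "x \<in> ann r M"
  shows "f x \<in> ann r N"
  using assms(4) rmod_homD[OF assms(3)] rmod_hom_zero[OF assms(1-3)]
  by (auto simp: ann_def simp flip: rmod_homD(3)[OF assms(3)])

text \<open>\<open>tops v N\<close> is \<open>Hom(N, S)\<close> for the simple module \<open>S\<close> at the vertex \<open>v\<close>, and \<open>tops_ann v r N\<close> is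
  its image in \<open>Hom(ann r N, S)\<close>. If there are no sinks and \<open>r < k\<close>, then for a direct sum
  \<open>N\<close> of modules \<open>MS w s\<close> its dimension is the number of summands with \<open>w = v\<close> and \<open>s \<le> r\<close>; it is
  additive and vanishes on projective modules.\<close>

definition tops :: "'v \<Rightarrow> ('a, 'm) rmodule \<Rightarrow> ('m \<Rightarrow> 'k) set" where
  "tops v N = {f. (\<forall>x\<in>carrier N. \<forall>y\<in>carrier N. f (x \<oplus>\<^bsub>N\<^esub> y) = f x + f y) \<and>
     (\<forall>x\<in>carrier N. \<forall>a\<in>carrier A. f (x \<odot>r\<^bsub>N\<^esub> a) = f x * coef a (v, [])) \<and>
     (\<forall>x. x \<notin> carrier N \<longrightarrow> f x = 0)}"

definition restr :: "nat \<Rightarrow> ('a, 'm) rmodule \<Rightarrow> ('m \<Rightarrow> 'k) \<Rightarrow> 'm \<Rightarrow> 'k" where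
  "restr r N f = (\<lambda>x. if x \<in> ann r N then f x else 0)"

definition tops_ann :: "'v \<Rightarrow> nat \<Rightarrow> ('a, 'm) rmodule \<Rightarrow> ('m \<Rightarrow> 'k) set" where
  "tops_ann v r N = restr r N ` tops v N"

definition top_mult :: "'v \<Rightarrow> nat \<Rightarrow> ('a, 'm) rmodule \<Rightarrow> nat" where
  "top_mult v r N = fs.dim (tops_ann v r N)"

lemma restr_linear: "Vector_Spaces.linear (\<lambda>c f t. c * f t) (\<lambda>c f t. c * f t) (restr r N)"
  by unfold_locales (auto simp: restr_def fun_eq_iff plus_fun_def)

lemma tops_subspace: "fs.subspace (tops v N)"
  by (auto simp: fs.subspace_def tops_def plus_fun_def zero_fun_def algebra_simps)

lemma tops_ann_subspace: "fs.subspace (tops_ann v r N)"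
proof -
  interpret l: Vector_Spaces.linear "\<lambda>c f t. c * f t" "\<lambda>c f t. c * f t" "restr r N" by (rule restr_linear)
  show ?thesis unfolding tops_ann_def by (rule l.subspace_image[OF tops_subspace])
qed

lemma tops_zero:
  assumes "right_module A N" "f \<in> tops v N"
  shows "f \<zero>\<^bsub>N\<^esub> = 0"
proof -
  interpret N: right_module A N by fact
  have "f (\<zero>\<^bsub>N\<^esub> \<oplus>\<^bsub>N\<^esub> \<zero>\<^bsub>N\<^esub>) = f \<zero>\<^bsub>N\<^esub> + f \<zero>\<^bsub>N\<^esub>"
    using assms(2) unfolding tops_def by blast
  then show ?thesis by (metis N.M.l_zero N.M.zero_closed add_cancel_right_right)
qed

lemma tops_finsum:
  assumes "right_module A N" "f \<in> tops v N" "finite S" "g \<in> S \<rightarrow> carrier N"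
  shows "f (\<Oplus>\<^bsub>N\<^esub>s\<in>S. g s) = (\<Sum>s\<in>S. f (g s))"
proof -
  interpret N: right_module A N by fact
  have add: "f (x \<oplus>\<^bsub>N\<^esub> y) = f x + f y" if "x \<in> carrier N" "y \<in> carrier N" for x y
    using assms(2) that by (auto simp: tops_def)
  from assms(3,4) show ?thesis
    by (induction S) (auto simp: tops_zero[OF assms(1,2)] add Pi_iff)
qed

text \<open>The zeros of a functional in \<open>tops v N\<close> form a submodule, so the functional
  is determined by its values on a finite generating set. Finiteness passes to the image under
  restriction.\<close>

lemma tops_ann_finite:
  fixes N :: "('a, 'm) rmodule"
  assumes "fgm A N"
  obtains W where "finite W" "tops_ann v r N \<subseteq> fs.span W"
proof -
  interpret N: right_module A N using assms by (simp add: fgm_def)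
  obtain S where S: "finite S" "S \<subseteq> carrier N" "\<And>L. submodule A N L \<Longrightarrow> S \<subseteq> L \<Longrightarrow> carrier N \<subseteq> L"
    using N.fin_genE assms by (metis fgm_def)
  define ev where "ev = (\<lambda>(f :: 'm \<Rightarrow> 'k) s. if s \<in> S then f s else 0)"
  interpret ev: Vector_Spaces.linear "\<lambda>c f t. c * f t" "\<lambda>c f t. c * f t" ev
    by unfold_locales (auto simp: ev_def fun_eq_iff plus_fun_def)
  interpret l: Vector_Spaces.linear "\<lambda>c f t. c * f t" "\<lambda>c f t. c * f t" "restr r N" by (rule restr_linear)
  have "f = 0" if f: "f \<in> tops v N" "ev f = 0" for f
  proof -
    have "submodule A N {x \<in> carrier N. f x = 0}"
      using f(1) tops_zero[OF N.right_module_axioms f(1)]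
      by (intro N.submoduleI) (auto simp: tops_def N.ract_closed)
    moreover have "S \<subseteq> {x \<in> carrier N. f x = 0}"
    proof
      fix s assume "s \<in> S"
      then show "s \<in> {x \<in> carrier N. f x = 0}"
        using S(2) fun_cong[OF f(2), of s] by (auto simp: ev_def)
    qed
    ultimately have "f x = 0" if "x \<in> carrier N" for x using S(3) that by blast
    then show "f = 0" using f(1) by (auto simp: tops_def fun_eq_iff)
  qed
  then have inj: "inj_on ev (tops v N)" by (simp add: ev.inj_on_iff_eq_0[OF tops_subspace])
  obtain B where B: "B \<subseteq> tops v N" "fs.independent B" "tops v N \<subseteq> fs.span B"
    using fs.maximal_independent_subset by metis
  have BH: "fs.span B = tops v N" using B(1,3) tops_subspace fs.span_minimal by blast
  define W where "W = (\<lambda>t s. if s = t then 1 else (0::'k)) ` S"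
  have "ev f \<in> fs.span W" for f
    unfolding W_def by (intro fs_span_indicators[OF S(1)]) (simp add: ev_def)
  then have "ev ` B \<subseteq> fs.span W" by blast
  moreover have "fs.independent (ev ` B)" by (rule ev.independent_injective_image[OF B(2)]) (simp add: BH inj)
  moreover have "finite W" using S(1) by (simp add: W_def)
  ultimately have "finite (ev ` B)" using fs.independent_span_bound by blast
  then have "finite B" using inj B(1) by (metis finite_imageD inj_on_subset)
  moreover have "tops_ann v r N = fs.span (restr r N ` B)"
    unfolding tops_ann_def l.span_image BH ..
  ultimately show ?thesis using that by blast
qed

text \<open>Inclusions and projections of the summands respect both \<open>ann r\<close> and the
  functionals, so the space attached to \<open>M\<close> is the direct sum of the two
  others.\<close>

lemma top_mult_dsum:
  assumes M: "fgm A M" "fgm A M'" "fgm A M''" and iso: "rmod_iso A M (dsum M' M'')"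
  shows "top_mult v r M = top_mult v r M' + top_mult v r M''"
proof -
  interpret M: right_module A M using M by (simp add: fgm_def)
  interpret M': right_module A M' using M by (simp add: fgm_def)
  interpret M'': right_module A M'' using M by (simp add: fgm_def)
  let ?D = "dsum M' M''"
  interpret D: right_module A ?D by (rule dsum_right_module) unfold_locales
  note ax = M.right_module_axioms M'.right_module_axioms M''.right_module_axioms D.right_module_axioms
  obtain \<theta> where \<theta>: "\<theta> \<in> rmod_hom A M ?D" "bij_betw \<theta> (carrier M) (carrier ?D)" using iso by (rule rmod_isoE)
  let ?\<theta>' = "the_inv_into (carrier M) \<theta>"
  have \<theta>': "?\<theta>' \<in> rmod_hom A ?D M" using rmod_hom_inv[OF ax(1) \<theta>] by simp
  have \<theta>\<theta>': "\<theta> (?\<theta>' d) = d" if "d \<in> carrier ?D" for d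
    using that \<theta>(2) by (auto simp: bij_betw_def f_the_inv_into_f)
  have \<theta>'\<theta>: "?\<theta>' (\<theta> m) = m" if "m \<in> carrier M" for m
    using that \<theta>(2) by (auto simp: bij_betw_def the_inv_into_f_f)
  note inj = dsum_inj_hom[OF ax(2,3)]
  define i1 where "i1 = (\<lambda>x. ?\<theta>' (x, \<zero>\<^bsub>M''\<^esub>))"
  define i2 where "i2 = (\<lambda>y. ?\<theta>' (\<zero>\<^bsub>M'\<^esub>, y))"
  define p1 where "p1 = (\<lambda>m. fst (\<theta> m))"
  define p2 where "p2 = (\<lambda>m. snd (\<theta> m))"
  have hom: "i1 \<in> rmod_hom A M' M" "i2 \<in> rmod_hom A M'' M" "p1 \<in> rmod_hom A M M'" "p2 \<in> rmod_hom A M M''"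
    unfolding i1_def i2_def p1_def p2_def
    using rmod_hom_comp[OF inj(1) \<theta>'] rmod_hom_comp[OF inj(2) \<theta>'] rmod_hom_comp[OF \<theta>(1) inj(3)] rmod_hom_comp[OF \<theta>(1) inj(4)]
    by simp_all
  have pi: "p1 (i1 x) = x" "p2 (i1 x) = \<zero>\<^bsub>M''\<^esub>" if "x \<in> carrier M'" for x
    using that \<theta>\<theta>' by (auto simp: p1_def p2_def i1_def)
  have pi': "p1 (i2 x) = \<zero>\<^bsub>M'\<^esub>" "p2 (i2 x) = x" if "x \<in> carrier M''" for x
    using that \<theta>\<theta>' by (auto simp: p1_def p2_def i2_def)
  have ip: "m = i1 (p1 m) \<oplus>\<^bsub>M\<^esub> i2 (p2 m)" if m: "m \<in> carrier M" for m
  proof -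
    have c: "p1 m \<in> carrier M'" "p2 m \<in> carrier M''" using rmod_homD(1)[OF hom(3) m] rmod_homD(1)[OF hom(4) m] .
    have "\<theta> m = (p1 m, \<zero>\<^bsub>M''\<^esub>) \<oplus>\<^bsub>?D\<^esub> (\<zero>\<^bsub>M'\<^esub>, p2 m)" using c by (simp add: p1_def p2_def)
    then have "?\<theta>' (\<theta> m) = i1 (p1 m) \<oplus>\<^bsub>M\<^esub> i2 (p2 m)"
      using rmod_homD(2)[OF \<theta>', of "(p1 m, \<zero>\<^bsub>M''\<^esub>)" "(\<zero>\<^bsub>M'\<^esub>, p2 m)"] c by (simp add: i1_def i2_def)
    then show ?thesis using \<theta>'\<theta>[OF m] by simp
  qed
  note an = ann_hom[OF ax(2,1) hom(1)] ann_hom[OF ax(3,1) hom(2)] ann_hom[OF ax(1,2) hom(3)] ann_hom[OF ax(1,3) hom(4)]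
  \<comment> \<open>Pullback along the projections. The cut-off at \<open>ann r M\<close> is needed
    because members of \<open>tops_ann\<close> are zero outside of it.\<close>
  define \<alpha> where "\<alpha> = (\<lambda>f m. if m \<in> ann r M then f (p1 m) else (0::'k))"
  define \<beta> where "\<beta> = (\<lambda>f m. if m \<in> ann r M then f (p2 m) else (0::'k))"
  have tz: "f x = 0" if "f \<in> tops_ann v r N" "x \<notin> ann r N" for f x and N :: "('a, 'm) rmodule"
    using that by (auto simp: tops_ann_def restr_def)
  have comp: "(\<lambda>x. if x \<in> carrier X then f (h x) else 0) \<in> tops v X"
    if "f \<in> tops v Y" "h \<in> rmod_hom A X Y" "right_module A X" for f h
    and X :: "('a, 'm) rmodule" and Y :: "('a, 'n) rmodule"
  proof -
    interpret X: right_module A X by fact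
    show ?thesis using that(1) rmod_homD[OF that(2)] by (auto simp: tops_def X.ract_closed)
  qed
  obtain V' where V': "finite V'" "tops_ann v r M' \<subseteq> fs.span V'" by (rule tops_ann_finite[OF M(2)])
  obtain W' where W': "finite W'" "tops_ann v r M'' \<subseteq> fs.span W'" by (rule tops_ann_finite[OF M(3)])
  show ?thesis
    unfolding top_mult_def
  proof (rule fs_dim_direct_sum[OF tops_ann_subspace V'(2,1) tops_ann_subspace W'(2,1), where \<alpha> = \<alpha> and \<beta> = \<beta>])
    show "\<alpha> (f + g) = \<alpha> f + \<alpha> g" for f g
      by (auto simp: \<alpha>_def fun_eq_iff plus_fun_def)
    show "\<beta> (f + g) = \<beta> f + \<beta> g" for f g
      by (auto simp: \<beta>_def fun_eq_iff plus_fun_def)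
    show "\<alpha> (\<lambda>t. c * f t) = (\<lambda>t. c * \<alpha> f t)" for c f
      by (auto simp: \<alpha>_def fun_eq_iff)
    show "\<beta> (\<lambda>t. c * f t) = (\<lambda>t. c * \<beta> f t)" for c f
      by (auto simp: \<beta>_def fun_eq_iff)
    have \<alpha>i: "\<alpha> f (i1 x) = f x" if "x \<in> ann r M'" for f x
      using that an(1) pi(1)[OF ann_carrier[OF that]] by (simp add: \<alpha>_def)
    have \<beta>i: "\<beta> f (i2 x) = f x" if "x \<in> ann r M''" for f x
      using that an(2) pi'(2)[OF ann_carrier[OF that]] by (simp add: \<beta>_def)
    show "inj_on \<alpha> (tops_ann v r M')"
    proof (rule inj_onI)
      fix f g assume *: "f \<in> tops_ann v r M'" "g \<in> tops_ann v r M'" "\<alpha> f = \<alpha> g"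
      show "f = g"
      proof
        fix x
        show "f x = g x" using \<alpha>i[of x f] \<alpha>i[of x g] * tz by (cases "x \<in> ann r M'") (auto simp: tops_ann_def restr_def)
      qed
    qed
    show "inj_on \<beta> (tops_ann v r M'')"
    proof (rule inj_onI)
      fix f g assume *: "f \<in> tops_ann v r M''" "g \<in> tops_ann v r M''" "\<beta> f = \<beta> g"
      show "f = g"
      proof
        fix x
        show "f x = g x" using \<beta>i[of x f] \<beta>i[of x g] * by (cases "x \<in> ann r M''") (auto simp: tops_ann_def restr_def)
      qed
    qed
    show "\<alpha> ` tops_ann v r M' \<inter> \<beta> ` tops_ann v r M'' \<subseteq> {0}"
    proof (rule subsetI, elim IntE imageE)
      fix h f g assume f: "h = \<alpha> f" "f \<in> tops_ann v r M'" and g: "h = \<beta> g" "g \<in> tops_ann v r M''"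
      have eq: "\<alpha> f = \<beta> g" using f(1) g(1) by simp
      have "f x = 0" for x
      proof (cases "x \<in> ann r M'")
        case True
        have "f x = \<beta> g (i1 x)" using \<alpha>i[OF True, of f] eq by simp
        also have "\<dots> = g \<zero>\<^bsub>M''\<^esub>" using an(1)[OF True] pi(2)[OF ann_carrier[OF True]] by (simp add: \<beta>_def)
        also have "\<dots> = 0" using g tops_zero[OF ax(3)] by (auto simp: tops_ann_def restr_def)
        finally show ?thesis .
      qed (use f in \<open>auto simp: tops_ann_def restr_def\<close>)
      then have "\<alpha> f = 0" by (simp add: \<alpha>_def fun_eq_iff)
      then show "h \<in> {0}" using f(1) by simp
    qed
    show "tops_ann v r M = {\<alpha> f + \<beta> g | f g. f \<in> tops_ann v r M' \<and> g \<in> tops_ann v r M''}"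
    proof (intro equalityI subsetI)
      fix h assume "h \<in> tops_ann v r M"
      then obtain f where f: "f \<in> tops v M" "h = restr r M f" by (auto simp: tops_ann_def)
      let ?f1 = "\<lambda>x. if x \<in> carrier M' then f (i1 x) else 0" and ?f2 = "\<lambda>x. if x \<in> carrier M'' then f (i2 x) else 0"
      have t: "?f1 \<in> tops v M'" "?f2 \<in> tops v M''"
        using f(1) rmod_homD[OF hom(1)] rmod_homD[OF hom(2)]
        by (auto simp: tops_def M'.ract_closed M''.ract_closed)
      have "h = \<alpha> (restr r M' ?f1) + \<beta> (restr r M'' ?f2)"
      proof
        fix m
        show "h m = (\<alpha> (restr r M' ?f1) + \<beta> (restr r M'' ?f2)) m"
        proof (cases "m \<in> ann r M")
          case True
          then have m: "m \<in> carrier M" by (rule ann_carrier)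
          have c: "p1 m \<in> carrier M'" "p2 m \<in> carrier M''" using rmod_homD(1)[OF hom(3) m] rmod_homD(1)[OF hom(4) m] .
          have "f m = f (i1 (p1 m)) + f (i2 (p2 m))"
            using f(1) rmod_homD(1)[OF hom(1) c(1)] rmod_homD(1)[OF hom(2) c(2)]
            by (subst ip[OF m]) (auto simp: tops_def)
          then show ?thesis using True an(3,4)[OF True] c
            by (simp add: \<alpha>_def \<beta>_def f(2) restr_def plus_fun_def)
        qed (simp add: f(2) restr_def \<alpha>_def \<beta>_def plus_fun_def)
      qed
      then show "h \<in> {\<alpha> f + \<beta> g | f g. f \<in> tops_ann v r M' \<and> g \<in> tops_ann v r M''}"
        using t unfolding tops_ann_def by blast
    next
      fix h assume "h \<in> {\<alpha> f + \<beta> g | f g. f \<in> tops_ann v r M' \<and> g \<in> tops_ann v r M''}"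
      then obtain f g where fg: "f \<in> tops v M'" "g \<in> tops v M''" "h = \<alpha> (restr r M' f) + \<beta> (restr r M'' g)"
        by (auto simp: tops_ann_def)
      let ?h = "\<lambda>m. if m \<in> carrier M then f (p1 m) + g (p2 m) else 0"
      have "?h \<in> tops v M"
        using fg(1,2) rmod_homD[OF hom(3)] rmod_homD[OF hom(4)]
        by (auto simp: tops_def M.ract_closed algebra_simps)
      moreover have "h = restr r M ?h"
        using an(3,4) by (auto simp: fg(3) restr_def \<alpha>_def \<beta>_def plus_fun_def fun_eq_iff dest: ann_carrier)
      ultimately show "h \<in> tops_ann v r M" unfolding tops_ann_def by blast
    qed
  qed
qed

lemma top_mult_eq_0:
  assumes "tops_ann v r N \<subseteq> {0}"
  shows "top_mult v r N = 0"
  using fs.dim_le_card[of "tops_ann v r N" "{}"] assms by (auto simp: top_mult_def)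

lemma top_mult_iso:
  assumes "fgm A M" "fgm A N" "rmod_iso A M N"
  shows "top_mult v r M = top_mult v r N"
proof -
  obtain Z where Z: "Z \<in> fg_modules A" "carrier Z = {\<zero>\<^bsub>Z\<^esub>}" "right_module A Z"
    by (rule zero_module_exists)
  then have Zf: "fgm A Z" by (simp add: fg_modules_iff)
  have N: "right_module A N" using assms(2) by (simp add: fgm_def)
  have "top_mult v r M = top_mult v r N + top_mult v r Z"
    by (rule top_mult_dsum[OF assms(1,2) Zf rmod_iso_trans[OF assms(3) dsum_zero_iso[OF N Z(3,2)]]])
  moreover have "top_mult v r Z = 0"
  proof (rule top_mult_eq_0)
    have "f x = 0" if "f \<in> tops v Z" "x \<in> ann r Z" for f x
      using tops_zero[OF Z(3) that(1)] ann_carrier[OF that(2)] Z(2) by simp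
    then show "tops_ann v r Z \<subseteq> {0}" by (auto simp: tops_ann_def restr_def fun_eq_iff)
  qed
  ultimately show ?thesis by simp
qed

text \<open>A functional vanishes on the radical, so only terms at trivial paths count, and the
  idempotent of \<open>w\<close> selects the summands that start at \<open>w\<close>.\<close>

lemma tops_FM:
  assumes "0 < r" "r \<le> k" "finite I" "\<And>i. i \<in> I \<Longrightarrow> v i \<in> verts Q"
    and "f \<in> tops w (FM I v r)" "y \<in> carrier (FM I v r)"
  shows "f y = (\<Sum>i\<in>I. if w = v i then f (bas i) * y (i, []) else 0)"
proof -
  interpret F: right_module A "FM I v r" by (rule FM_right_module) fact
  have b: "bas i \<in> carrier (FM I v r)" if "i \<in> I" for i using assms that by (intro bas_closed) auto
  have "f y = f (\<Oplus>\<^bsub>FM I v r\<^esub>i\<in>I. bas i \<odot>r\<^bsub>FM I v r\<^esub> cmp v y i)"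
    using FM_expand[OF assms(1-4,6)] by simp
  also have "\<dots> = (\<Sum>i\<in>I. f (bas i \<odot>r\<^bsub>FM I v r\<^esub> cmp v y i))"
    using b cmp_closed[OF assms(2,6)]
    by (intro tops_finsum[OF F.right_module_axioms assms(5,3)]) (auto intro!: F.ract_closed)
  also have "\<dots> = (\<Sum>i\<in>I. f (bas i) * coef (cmp v y i) (w, []))"
    using assms(5) b cmp_closed[OF assms(2,6)] by (intro sum.cong) (auto simp: tops_def)
  also have "\<dots> = (\<Sum>i\<in>I. if w = v i then f (bas i) * y (i, []) else 0)"
    by (intro sum.cong) (auto simp: coef_cmp[OF assms(2,6)])
  finally show ?thesis .
qed

text \<open>All of \<open>MS u r\<close> is annihilated by \<open>J\<^sup>r\<close>, so the
  restriction changes nothing, and the top of \<open>MS u r\<close> is the simple module at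
  \<open>u\<close>.\<close>

lemma top_mult_MS:
  assumes "0 < r" "r \<le> k" "u \<in> verts Q"
  shows "top_mult w r (MS u r) = (if w = u then 1 else 0)"
proof -
  let ?F = "FM (UNIV :: unit set) (\<lambda>_. u) r"
  have ann: "ann r ?F = carrier ?F" using killed_FM[OF assms(2)] by (auto simp: ann_def killed_def)
  interpret F: right_module A ?F by (rule FM_right_module) fact
  have t: "f y = (if w = u then f (bas ()) * y ((), []) else 0)" if "f \<in> tops w ?F" "y \<in> carrier ?F" for f y
    using tops_FM[OF assms(1,2) _ _ that] assms(3) by (simp add: UNIV_unit)
  have ta: "tops_ann w r ?F = tops w ?F"
  proof -
    have "restr r ?F f = f" if "f \<in> tops w ?F" for f
      using that unfolding restr_def ann by (auto simp: tops_def fun_eq_iff)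
    then show ?thesis by (force simp: tops_ann_def)
  qed
  show ?thesis
  proof (cases "w = u")
    case False
    have "f x = 0" if "f \<in> tops w ?F" for f x
      using t[OF that, of x] that False by (cases "x \<in> carrier ?F") (auto simp: tops_def)
    then have "f = 0" if "f \<in> tops w ?F" for f using that by (auto simp: fun_eq_iff)
    then show ?thesis using False top_mult_eq_0[of w r ?F] ta by (auto simp: MS_def)
  next
    case True
    \<comment> \<open>The coefficient at the trivial path; every functional is its multiple by the
      value at \<open>bas ()\<close>.\<close>
    define f0 where "f0 = (\<lambda>y. if y \<in> carrier ?F then y ((), []) else (0::'k))"
    have "f0 \<in> tops w ?F"
      using assms(1) F.M.a_closed[of _ _] F.ract_closed by (auto simp: f0_def tops_def True FM_ract)
    moreover have "f \<in> fs.span {f0}" if "f \<in> tops w ?F" for f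
    proof -
      have "f = (\<lambda>t. f (bas ()) * f0 t)" using t[OF that] that True by (auto simp: fun_eq_iff f0_def tops_def)
      then show ?thesis using fs.span_scale[OF fs.span_base[of f0 "{f0}"], of "f (bas ())"] by simp
    qed
    moreover have "f0 \<noteq> 0"
    proof -
      have "bas () \<in> carrier ?F" using assms by (intro bas_closed) auto
      then have "f0 (bas ()) = 1" by (simp add: f0_def bas_def)
      then show ?thesis by (metis zero_fun_apply zero_neq_one)
    qed
    then have "fs.independent {f0}" by (simp add: fs.dependent_single)
    ultimately have "card {f0} = fs.dim (tops_ann w r ?F)"
      unfolding ta by (intro fs.basis_card_eq_dim) auto
    then show ?thesis using True by (simp add: top_mult_def MS_def)
  qed
qed

lemma long_walk:
  assumes "\<And>u. u \<in> verts Q \<Longrightarrow> \<exists>a\<in>arcs Q. tail Q a = u" "u \<in> verts Q"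
  shows "\<exists>p. walk Q u p \<and> length p = n"
  using assms(2)
proof (induction n arbitrary: u)
  case (Suc n)
  then obtain a where a: "a \<in> arcs Q" "tail Q a = u" using assms(1) by blast
  then obtain p where "walk Q (head Q a) p" "length p = n" using Suc.IH[of "head Q a"] by auto
  then show ?case using a by (intro exI[of _ "a # p"]) auto
qed auto

text \<open>\<open>P\<close> is a retract of some \<open>FM T fst k\<close>. There an element with a
  term at a trivial path is not annihilated by \<open>J\<^sup>r\<close>: without sinks that path
  extends to one of length \<open>r < k\<close>, which acts on it nontrivially. Thus
  \<open>ann r\<close> lies in the radical, where functionals vanish.\<close>

lemma top_mult_projective:
  assumes sink: "\<And>u. u \<in> verts Q \<Longrightarrow> \<exists>a\<in>arcs Q. tail Q a = u" and r: "r < k"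
    and P: "P \<in> projective_modules A"
  shows "top_mult w r P = 0"
proof (rule top_mult_eq_0)
  have Pf: "P \<in> fg_modules A" "fgm A P" "right_module A P"
    using P by (auto simp: projective_modules_def fgm_def fg_modules_def)
  obtain T :: "('v \<times> (nat \<Rightarrow> 'a) set) set" and \<phi> where T: "finite T" "\<And>i. i \<in> T \<Longrightarrow> fst i \<in> verts Q"
    "\<phi> \<in> rmod_hom A (FM T fst k) P" "\<phi> ` carrier (FM T fst k) = carrier P"
    by (rule minimal_cover[OF k_pos order_refl Pf(2) killed_k[OF Pf(3)]]) blast
  let ?F = "FM T fst k"
  interpret F: right_module A ?F by (rule FM_right_module) simp
  have Ff: "fgm A ?F" by (rule FM_fgm[OF k_pos order_refl T(1,2)])
  note R = rep[OF Ff]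
  have Rm: "right_module A (rep A ?F)" using R(4) by (simp add: fgm_def)
  obtain \<theta> where \<theta>: "\<theta> \<in> rmod_hom A (rep A ?F) ?F" "bij_betw \<theta> (carrier (rep A ?F)) (carrier ?F)"
    using R(3) by (rule rmod_isoE)
  have "(\<lambda>x. \<phi> (\<theta> x)) ` carrier (rep A ?F) = carrier P"
    using \<theta>(2) T(4) by (simp add: bij_betw_def flip: image_image)
  moreover have "(\<lambda>x. x) \<in> rmod_hom A P P" by (simp add: rmod_hom_def)
  ultimately obtain s where s: "s \<in> rmod_hom A P (rep A ?F)" "\<And>x. x \<in> carrier P \<Longrightarrow> \<phi> (\<theta> (s x)) = x"
    using projective_lift[OF P R(1) Pf(1) rmod_hom_comp[OF \<theta>(1) T(3)]] by blast
  have zero: "y (i, []) = 0" if y: "y \<in> ann r ?F" for y i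
  proof (rule ccontr)
    assume ne: "y (i, []) \<noteq> 0"
    then have i: "i \<in> T" using ann_carrier[OF y] by (cases i) (auto simp: FM_carrier)
    obtain p where p: "walk Q (fst i) p" "length p = r" using long_walk[OF sink T(2)[OF i]] by blast
    \<comment> \<open>\<open>el c\<close> is the path \<open>p\<close> as an element of
      \<open>A\<close>. It lies in \<open>J\<^sup>r\<close> and moves the coefficient of
      \<open>y\<close> at the trivial path to \<open>p\<close>.\<close>
    define c where "c = (\<lambda>(u, q). if u = fst i \<and> q = p then 1 else (0::'k))"
    have c: "walk Q u q \<and> length q < k" if "c (u, q) \<noteq> 0" for u q
      using that p r by (auto simp: c_def split: if_splits)
    have ce: "coef (el c) = c" by (rule coef_el[OF c])
    have "splitsum (\<lambda>l s. y (i, l) * coef (el c) (tgt Q (fst i) l, s)) p = y (i, []) * coef (el c) (fst i, p)"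
    proof (subst splitsum_cong[where g = "\<lambda>l s. if l = [] then y (i, []) * coef (el c) (fst i, p) else 0"])
      fix l s assume "l @ s = p"
      then show "y (i, l) * coef (el c) (tgt Q (fst i) l, s) = (if l = [] then y (i, []) * coef (el c) (fst i, p) else 0)"
        unfolding ce by (auto simp: c_def)
    next
      show "splitsum (\<lambda>l s. if l = [] then y (i, []) * coef (el c) (fst i, p) else 0) p = y (i, []) * coef (el c) (fst i, p)"
        by (subst splitsum_first) auto
    qed
    then have "(y \<odot>r\<^bsub>?F\<^esub> el c) (i, p) = y (i, [])"
      using p r unfolding FM_ract ce by (simp add: c_def)
    moreover have "y \<odot>r\<^bsub>?F\<^esub> el c = \<zero>\<^bsub>?F\<^esub>"
    proof -
      have "coef (el c) (u, q) = 0" if "length q < r" for u q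
        unfolding ce using that p(2) by (auto simp: c_def)
      then show ?thesis using y el_closed[OF c] unfolding ann_def by blast
    qed
    ultimately show False using ne by simp
  qed
  show "tops_ann w r P \<subseteq> {0}"
  proof
    fix h assume "h \<in> tops_ann w r P"
    then obtain f where f: "f \<in> tops w P" "h = restr r P f" by (auto simp: tops_ann_def)
    have "f x = 0" if x: "x \<in> ann r P" for x
    proof -
      have sx: "\<theta> (s x) \<in> ann r ?F"
        using ann_hom[OF Pf(3) F.right_module_axioms rmod_hom_comp[OF s(1) \<theta>(1)] x] .
      let ?g = "\<lambda>y. if y \<in> carrier ?F then f (\<phi> y) else 0"
      have g: "?g \<in> tops w ?F" using f(1) rmod_homD[OF T(3)]
        by (auto simp: tops_def F.ract_closed simp del: FM_simps)
      have "?g (\<theta> (s x)) = (\<Sum>i\<in>T. if w = fst i then ?g (bas i) * \<theta> (s x) (i, []) else 0)"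
        by (rule tops_FM[OF k_pos order_refl T(1,2) g ann_carrier[OF sx]])
      also have "\<dots> = 0" using zero[OF sx] by (intro sum.neutral) auto
      finally show ?thesis using ann_carrier[OF sx] s(2)[OF ann_carrier[OF x]] by simp
    qed
    then show "h \<in> {0}" by (auto simp: f(2) restr_def fun_eq_iff)
  qed
qed

end

section \<open>The modules \<open>MS u r\<close> in a zero Igusa-Todorov subcategory\<close>

context trunc_alg
begin

lemma FM_retract_iso:
  assumes r: "0 < r" "r \<le> k" and I: "finite I" "\<And>i. i \<in> I \<Longrightarrow> v i \<in> verts Q" and N: "fgm A N"
    and i: "i \<in> rmod_hom A N (FM I v r)" and p: "p \<in> rmod_hom A (FM I v r) N"
    and pi: "\<And>x. x \<in> carrier N \<Longrightarrow> p (i x) = x"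
  shows "\<exists>T :: ('v \<times> 'm) set. finite T \<and> (\<forall>t\<in>T. fst t \<in> verts Q) \<and> rmod_iso A (FM T fst r) (N :: ('a, 'm) rmodule)"
proof -
  interpret N: right_module A N using N by (simp add: fgm_def)
  interpret F: right_module A "FM I v r" by (rule FM_right_module) fact
  have killed: "killed r N"
    unfolding killed_def
  proof (intro ballI impI)
    fix x a assume x: "x \<in> carrier N" and a: "a \<in> carrier A" "\<forall>u p. length p < r \<longrightarrow> coef a (u, p) = 0"
    have ix: "i x \<in> carrier (FM I v r)" by (rule rmod_homD(1)[OF i x])
    have "i x \<odot>r\<^bsub>FM I v r\<^esub> a = \<zero>\<^bsub>FM I v r\<^esub>"
      using killed_FM[OF r(2)] ix a unfolding killed_def by blast
    then have "p (i x) \<odot>r\<^bsub>N\<^esub> a = \<zero>\<^bsub>N\<^esub>"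
      using rmod_homD(3)[OF p ix a(1)] rmod_hom_zero[OF F.right_module_axioms N.right_module_axioms p] by simp
    then show "x \<odot>r\<^bsub>N\<^esub> a = \<zero>\<^bsub>N\<^esub>" using pi[OF x] by simp
  qed
  obtain T :: "('v \<times> 'm) set" and \<phi> where T: "finite T" "\<And>t. t \<in> T \<Longrightarrow> fst t \<in> verts Q"
    and \<phi>: "\<phi> \<in> rmod_hom A (FM T fst r) N" "\<phi> ` carrier (FM T fst r) = carrier N"
    "\<And>y. y \<in> carrier (FM T fst r) \<Longrightarrow> \<phi> y = \<zero>\<^bsub>N\<^esub> \<Longrightarrow> y \<in> rad"
    by (rule minimal_cover[OF r N killed]) blast
  interpret G: right_module A "FM T fst r" by (rule FM_right_module) fact
  obtain q where q: "q \<in> rmod_hom A (FM I v r) (FM T fst r)" "\<And>y. y \<in> carrier (FM I v r) \<Longrightarrow> \<phi> (q y) = p y"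
    by (rule FM_lift[OF r I G.right_module_axioms killed_FM[OF r(2)] N.right_module_axioms p \<phi>(1,2)]) blast+
  let ?s = "\<lambda>x. q (i x)"
  have s: "?s \<in> rmod_hom A N (FM T fst r)" by (rule rmod_hom_comp[OF i q(1)])
  have \<phi>s: "\<phi> (?s x) = x" if "x \<in> carrier N" for x
    using q(2)[OF rmod_homD(1)[OF i that]] pi[OF that] by simp
  have "superfluous A (FM T fst r) (a_kernel (FM T fst r) N \<phi>)"
    using \<phi>(3) by (intro rad_superfluous r T) (auto simp: a_kernel_def')
  then have surj: "?s ` carrier N = carrier (FM T fst r)"
    using \<phi>s \<phi>(2)
    by (intro superfluous_surj[OF N.right_module_axioms G.right_module_axioms N.right_module_axioms \<phi>(1) _ s]) auto
  have "inj_on \<phi> (carrier (FM T fst r))"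
    unfolding surj[symmetric] using \<phi>s by (auto simp: inj_on_def)
  then have "rmod_iso A (FM T fst r) N" using \<phi> by (intro rmod_isoI[OF \<phi>(1)]) (simp add: bij_betw_def)
  then show ?thesis using T by blast
qed

text \<open>Finite direct sums of modules \<open>M(u, r)\<close> with \<open>r\<close> fixed. The
  existential quantifier cannot range over index types, so the one that \<open>minimal_cover\<close>
  produces is prescribed.\<close>

definition free_type :: "nat \<Rightarrow> 'a fg_module \<Rightarrow> bool" where
  "free_type r N \<longleftrightarrow> (\<exists>T :: ('v \<times> (nat \<Rightarrow> 'a) set) set.
     finite T \<and> (\<forall>t\<in>T. fst t \<in> verts Q) \<and> rmod_iso A (FM T fst r) N)"

text \<open>An isomorphism is a retraction, and \<open>FM_retract_iso\<close> replaces an arbitrary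
  index type by the prescribed one.\<close>

lemma free_typeI:
  assumes r: "0 < r" "r \<le> k" and I: "finite I" "\<And>i. i \<in> I \<Longrightarrow> v i \<in> verts Q" and N: "N \<in> fg_modules A"
    and iso: "rmod_iso A N (FM I v r)"
  shows "free_type r N"
proof -
  have Nm: "fgm A N" "right_module A N" using N by (auto simp: fg_modules_def fgm_def)
  obtain f where f: "f \<in> rmod_hom A N (FM I v r)" "bij_betw f (carrier N) (carrier (FM I v r))"
    using iso by (rule rmod_isoE)
  show ?thesis unfolding free_type_def
    using rmod_hom_inv[OF Nm(2) f] f(2)
    by (intro FM_retract_iso[OF r I Nm(1) f(1)]) (auto simp: the_inv_into_f_f bij_betw_def)
qed

text \<open>Sums are joined by disjoint unions of index sets; summands are retracts and covered by
  \<open>FM_retract_iso\<close>. It bounds the subgroup of \<open>K0\<close> on which the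
  Igusa-Todorov function is evaluated.\<close>

lemma add_closure_free_type:
  assumes r: "0 < r" "r \<le> k" and S: "S \<in> fg_modules A" "free_type r S" and N: "N \<in> add_closure A {S}"
  shows "N \<in> fg_modules A \<and> free_type r N"
  using N
proof (induction rule: add_closure.induct)
  case (base M)
  then show ?case using S by simp
next
  case (zero M)
  let ?F = "FM ({} :: nat set) undefined r"
  have M: "right_module A M" using zero by (simp add: fg_modules_def)
  interpret M: right_module A M by fact
  interpret F: right_module A ?F by (rule FM_right_module) fact
  have "carrier ?F = {\<zero>\<^bsub>?F\<^esub>}" by (auto simp: FM_carrier)
  then have "rmod_iso A M ?F" using zero(2)
    by (intro rmod_isoI[of "\<lambda>_. \<zero>\<^bsub>?F\<^esub>"] rmod_homI) (auto simp: bij_betw_def simp del: FM_simps)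
  then show ?case using zero by (auto intro!: free_typeI[OF r, of "{} :: nat set" undefined])
next
  case (sum M N L)
  then obtain T T' :: "('v \<times> (nat \<Rightarrow> 'a) set) set"
    where T: "finite T" "\<forall>t\<in>T. fst t \<in> verts Q" "rmod_iso A (FM T fst r) M"
      and T': "finite T'" "\<forall>t\<in>T'. fst t \<in> verts Q" "rmod_iso A (FM T' fst r) N"
    unfolding free_type_def by blast
  have i: "rmod_iso A M (FM T fst r)" "rmod_iso A N (FM T' fst r)"
    using T(3) T'(3) rmod_iso_sym FM_right_module[OF r(2)] by blast+
  have "rmod_iso A (FM (T <+> T') (case_sum fst fst) r) (dsum (FM T fst r) (FM T' fst r))"
    using FM_plus_iso[OF r(2)] by (rule rmod_isoI)
  then have "rmod_iso A (dsum (FM T fst r) (FM T' fst r)) (FM (T <+> T') (case_sum fst fst) r)"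
    by (rule rmod_iso_sym[OF FM_right_module[OF r(2)]])
  then have "rmod_iso A L (FM (T <+> T') (case_sum fst fst) r)"
    using rmod_iso_trans[OF sum.hyps(4) rmod_iso_trans[OF dsum_iso_cong[OF i]]] by blast
  then show ?case using sum.hyps T T' by (auto intro!: free_typeI[OF r, of "T <+> T'" "case_sum fst fst"])
next
  case (summand L M N)
  then obtain T :: "('v \<times> (nat \<Rightarrow> 'a) set) set"
    where T: "finite T" "\<forall>t\<in>T. fst t \<in> verts Q" "rmod_iso A (FM T fst r) L"
    unfolding free_type_def by blast
  have m: "right_module A M" "right_module A N" "fgm A M" using summand by (auto simp: fg_modules_def fgm_def)
  interpret M: right_module A M by fact
  interpret N: right_module A N by fact
  have "rmod_iso A (FM T fst r) (dsum M N)" by (rule rmod_iso_trans[OF T(3) summand.hyps(4)])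
  then obtain f where f: "f \<in> rmod_hom A (FM T fst r) (dsum M N)" "bij_betw f (carrier (FM T fst r)) (carrier (dsum M N))"
    by (rule rmod_isoE)
  note inv = rmod_hom_inv[OF FM_right_module[OF r(2)] f]
  note h = dsum_inj_hom[OF m(1,2)]
  have "fst (f (the_inv_into (carrier (FM T fst r)) f (x, \<zero>\<^bsub>N\<^esub>))) = x" if "x \<in> carrier M" for x
    using that by (subst f_the_inv_into_f_bij_betw[OF f(2)]) auto
  then have "free_type r M" unfolding free_type_def
    using T by (intro FM_retract_iso[OF r T(1) _ m(3) rmod_hom_comp[OF h(1) inv(1)] rmod_hom_comp[OF f(1) h(3)]]) auto
  then show ?case using summand by simp
qed

definition rp :: "'v \<Rightarrow> nat \<Rightarrow> 'a fg_module" where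
  "rp u r = rep A (MS u r)"

lemma rp:
  assumes "0 < r" "r \<le> k" "u \<in> verts Q"
  shows "rp u r \<in> fg_modules A" "rmod_iso A (rp u r) (MS u r)" "rmod_iso A (MS u r) (rp u r)" "fgm A (rp u r)"
  using rep[OF MS_fgm[OF assms]] by (simp_all add: rp_def)

text \<open>Translates integer vectors indexed by vertices into formal sums of the modules
  \<open>M(u, r)\<close>. Values of \<open>c\<close> outside \<open>verts Q\<close> are
  ignored.\<close>

definition comb :: "nat \<Rightarrow> ('v \<Rightarrow> int) \<Rightarrow> ('a fg_module \<Rightarrow>\<^sub>0 int)" where
  "comb r c = (\<Sum>u\<in>verts Q. frag_cmul (c u) (frag_of (rp u r)))"

lemma comb_carrier: "0 < r \<Longrightarrow> r \<le> k \<Longrightarrow> comb r c \<in> carrier (FG A)"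
  unfolding comb_def by (rule sum_frag_carrier) (rule rp)

lemma comb_add: "comb r (\<lambda>u. c u + d u) = comb r c + comb r d"
  by (simp add: comb_def frag_cmul_distrib sum.distrib)

lemma comb_minus: "comb r (\<lambda>u. - c u) = - comb r c"
  by (simp add: comb_def sum_negf flip: minus_frag_cmul)

lemma comb_zero: "comb r (\<lambda>u. 0) = 0"
  by (simp add: comb_def)

lemma comb_cmul: "frag_cmul n (comb r c) = comb r (\<lambda>u. n * c u)"
  by (simp add: comb_def frag_cmul_sum o_def)

lemma comb_delta: "u \<in> verts Q \<Longrightarrow> comb r (\<lambda>w. if w = u then 1 else 0) = frag_of (rp u r)"
proof -
  assume u: "u \<in> verts Q"
  have "comb r (\<lambda>w. if w = u then 1 else 0) = (\<Sum>w\<in>verts Q. if u = w then frag_of (rp w r) else 0)"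
    unfolding comb_def by (rule sum.cong) auto
  then show ?thesis using u by simp
qed

lemma sum_frag_comb:
  assumes "finite I" "\<And>i. i \<in> I \<Longrightarrow> v i \<in> verts Q"
  shows "(\<Sum>i\<in>I. frag_of (rp (v i) r)) = comb r (\<lambda>u. int (card {i \<in> I. v i = u}))"
  using assms
proof (induction I)
  case (insert i I)
  have "int (card {j \<in> insert i I. v j = u}) = (if u = v i then 1 else 0) + int (card {j \<in> I. v j = u})" for u
  proof -
    have "{j \<in> insert i I. v j = u} = (if u = v i then insert i {j \<in> I. v j = u} else {j \<in> I. v j = u})" by auto
    then show ?thesis using insert.hyps by simp
  qed
  then show ?case using insert by (simp add: comb_add comb_delta)
qed (simp add: comb_zero)

lemma free_type_class:
  assumes r: "0 < r" "r \<le> k" and N: "N \<in> fg_modules A" "free_type r N"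
  shows "\<exists>c. kc A (frag_of N) = kc A (comb r c)"
proof -
  obtain T :: "('v \<times> (nat \<Rightarrow> 'a) set) set"
    where T: "finite T" "\<And>t. t \<in> T \<Longrightarrow> fst t \<in> verts Q" "rmod_iso A (FM T fst r) N"
    using N(2) unfolding free_type_def by blast
  note R = rep[OF FM_fgm[OF r T(1,2)]]
  have "kc A (frag_of N) = kc A (frag_of (rep A (FM T fst r)))"
    by (rule kc_iso[symmetric, OF R(1) N(1) rmod_iso_trans[OF R(3) T(3)]])
  also have "\<dots> = kc A (\<Sum>t\<in>T. frag_of (rp (fst t) r))"
    unfolding rp_def by (rule kc_FM[OF r T(1,2)])
  also have "(\<Sum>t\<in>T. frag_of (rp (fst t) r)) = comb r (\<lambda>u. int (card {t \<in> T. fst t = u}))"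
    by (rule sum_frag_comb[OF T(1,2)])
  finally show ?thesis by blast
qed

section \<open>Syzygies of \<open>MS u r\<close> and powers of the adjacency matrix\<close>

definition walks :: "'v \<Rightarrow> nat \<Rightarrow> 'e list set" where
  "walks u n = {q. walk Q u q \<and> length q = n}"

lemma finite_walks_length: "finite (walks u n)"
  by (rule finite_subset[OF _ finite_walks[of u "Suc n"]]) (auto simp: walks_def)

text \<open>The cover of \<open>e A / e J\<^sup>r\<close> is the truncation map from
  \<open>e A\<close>, with kernel \<open>e J\<^sup>r\<close>. Sorting the paths in the kernel by
  their first \<open>r\<close> arrows \<open>q\<close> splits it into pieces; the piece of
  \<open>q\<close> consists of the continuations of \<open>q\<close>, which have length below
  \<open>k - r\<close>.\<close>

lemma syzygy_MS:
  assumes r: "0 < r" "r < k" and u: "u \<in> verts Q"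
  shows "is_syzygy A (rp u r) (rep A (FM (walks u r) (tgt Q u) (k - r)))"
proof -
  let ?F = "FM (UNIV :: unit set) (\<lambda>_. u) k" and ?M = "MS u r" and ?G = "FM (walks u r) (tgt Q u) (k - r)"
  have rk: "r \<le> k" and kr: "0 < k - r" "k - r \<le> k" using r by auto
  interpret F: right_module A ?F by (rule FM_right_module) simp
  interpret M: right_module A ?M by (rule MS_right_module[OF rk])
  have vw: "tgt Q u q \<in> verts Q" if "q \<in> walks u r" for q
    using that walk_target by (auto simp: walks_def)
  define \<phi> where "\<phi> = (\<lambda>(y :: unit \<times> 'e list \<Rightarrow> 'k) (i, p). if length p < r then y (i, p) else 0)"
  have \<phi>: "\<phi> \<in> rmod_hom A ?F ?M"
  proof (rule rmod_homI)
    show "\<phi> x \<in> carrier ?M" if "x \<in> carrier ?F" for x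
      using that by (auto simp: \<phi>_def MS_def FM_carrier)
    show "\<phi> (x \<oplus>\<^bsub>?F\<^esub> y) = \<phi> x \<oplus>\<^bsub>?M\<^esub> \<phi> y" for x y
      by (auto simp: \<phi>_def MS_def fun_eq_iff)
    show "\<phi> (x \<odot>r\<^bsub>?F\<^esub> a) = \<phi> x \<odot>r\<^bsub>?M\<^esub> a" for x a
    proof (rule ext, clarify)
      fix i p
      show "\<phi> (x \<odot>r\<^bsub>?F\<^esub> a) (i, p) = (\<phi> x \<odot>r\<^bsub>?M\<^esub> a) (i, p)"
      proof (cases "length p < r")
        case True
        then have "splitsum (\<lambda>l s. x (i, l) * coef a (tgt Q u l, s)) p = splitsum (\<lambda>l s. \<phi> x (i, l) * coef a (tgt Q u l, s)) p"
          by (intro splitsum_cong) (auto simp: \<phi>_def)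
        then show ?thesis using True rk by (simp add: MS_def FM_ract) (simp add: \<phi>_def FM_ract)
      qed (simp add: MS_def FM_ract \<phi>_def)
    qed
  qed
  have surj: "\<phi> ` carrier ?F = carrier ?M"
  proof (intro equalityI subsetI)
    fix y assume y: "y \<in> carrier ?M"
    then have "y \<in> carrier ?F" using rk by (fastforce simp: MS_def FM_carrier)
    moreover have "\<phi> y = y" using y by (fastforce simp: MS_def FM_carrier \<phi>_def fun_eq_iff)
    ultimately show "y \<in> \<phi> ` carrier ?F" by (metis imageI)
  qed (use rmod_homD(1)[OF \<phi>] in auto)
  have ker: "\<phi> y = \<zero>\<^bsub>?M\<^esub> \<longleftrightarrow> (\<forall>i p. length p < r \<longrightarrow> y (i, p) = 0)" for y
    by (auto simp: \<phi>_def MS_def fun_eq_iff)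
  \<comment> \<open>The component at \<open>q\<close> reads off the coefficients at prolongations of
    \<open>q\<close>.\<close>
  define \<rho> where "\<rho> = (\<lambda>(y :: unit \<times> 'e list \<Rightarrow> 'k) (q, p). if q \<in> walks u r then y ((), q @ p) else 0)"
  let ?K = "kernel_module ?F ?M \<phi>"
  have \<rho>: "\<rho> \<in> rmod_hom A ?K ?G"
  proof (rule rmod_homI)
    show "\<rho> x \<in> carrier ?G" if "x \<in> carrier ?K" for x
      using that by (fastforce simp: \<rho>_def FM_carrier walks_def split: if_splits)
    show "\<rho> (x \<oplus>\<^bsub>?K\<^esub> y) = \<rho> x \<oplus>\<^bsub>?G\<^esub> \<rho> y" for x y
      by (auto simp: \<rho>_def fun_eq_iff)
    show "\<rho> (x \<odot>r\<^bsub>?K\<^esub> a) = \<rho> x \<odot>r\<^bsub>?G\<^esub> a" if x: "x \<in> carrier ?K" for x a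
    proof (rule ext, clarify)
      fix q p
      show "\<rho> (x \<odot>r\<^bsub>?K\<^esub> a) (q, p) = (\<rho> x \<odot>r\<^bsub>?G\<^esub> a) (q, p)"
      proof (cases "q \<in> walks u r")
        case True
        then have lq: "length q = r" by (simp add: walks_def)
        have "splitsum (\<lambda>l s. x ((), l) * coef a (tgt Q u l, s)) (q @ p)
          = splitsum (\<lambda>l s. x ((), q @ l) * coef a (tgt Q u (q @ l), s)) p"
          using x ker lq by (intro splitsum_prefix) auto
        then show ?thesis using True lq
          by (auto simp: \<rho>_def FM_ract)
      qed (simp add: \<rho>_def FM_ract splitsum_zero)
    qed
  qed
  \<comment> \<open>The inverse map: cut every path after its first \<open>r\<close> arrows.\<close>
  define \<rho>' where "\<rho>' = (\<lambda>(z :: 'e list \<times> 'e list \<Rightarrow> 'k) (i :: unit, p). if r \<le> length p then z (take r p, drop r p) else 0)"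
  have bij: "bij_betw \<rho> (carrier ?K) (carrier ?G)"
  proof (rule bij_betwI[of _ _ _ \<rho>'])
    show "\<rho> \<in> carrier ?K \<rightarrow> carrier ?G" using rmod_homD(1)[OF \<rho>] by auto
    show "\<rho>' \<in> carrier ?G \<rightarrow> carrier ?K"
    proof
      fix z assume z: "z \<in> carrier ?G"
      have "walk Q u p \<and> length p < k" if "z (take r p, drop r p) \<noteq> 0" "r \<le> length p" for p
      proof -
        have *: "walk Q u (take r p) \<and> walk Q (tgt Q u (take r p)) (drop r p) \<and> length (drop r p) < k - r"
          using z that by (fastforce simp: FM_carrier walks_def)
        then have "length p < k" using that(2) by (simp; linarith)
        then show ?thesis using * walk_append[of u "take r p" "drop r p"] by simp
      qed
      then show "\<rho>' z \<in> carrier ?K" by (auto simp: \<rho>'_def FM_carrier ker)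
    qed
    show "\<rho>' (\<rho> x) = x" if x: "x \<in> carrier ?K" for x
    proof (rule ext, clarify)
      fix i p
      have "x ((), p) = 0" if "r \<le> length p" "take r p \<notin> walks u r"
        using x that walk_append[of u "take r p" "drop r p"] by (auto simp: FM_carrier walks_def)
      then show "\<rho>' (\<rho> x) (i, p) = x (i, p)" using x by (auto simp: \<rho>'_def \<rho>_def ker)
    qed
    show "\<rho> (\<rho>' z) = z" if z: "z \<in> carrier ?G" for z
    proof (rule ext, clarify)
      fix q p
      have "z (q, p) = 0" if "q \<notin> walks u r" using z that by (auto simp: FM_carrier)
      moreover have "length q = r" if "q \<in> walks u r" using that by (simp add: walks_def)
      ultimately show "\<rho> (\<rho>' z) (q, p) = z (q, p)" by (auto simp: \<rho>'_def \<rho>_def)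
    qed
  qed
  note R = rep[OF FM_fgm[where I = "walks u r" and v = "tgt Q u", OF kr finite_walks_length vw]]
  have "rmod_iso A ?K ?G" by (rule rmod_isoI[OF \<rho> bij])
  then have "rmod_iso A ?G ?K"
    by (rule rmod_iso_sym[OF kernel_right_module[OF F.right_module_axioms M.right_module_axioms \<phi>]])
  then have iso: "rmod_iso A (rep A ?G) ?K" using R(3) rmod_iso_trans by blast
  have krad: "y \<in> rad" if "\<phi> y = \<zero>\<^bsub>?M\<^esub>" for y
    using that r(1) unfolding ker by (auto simp: rad_def)
  show ?thesis
    by (rule syzygyI[OF _ _ rp(1)[OF r(1) rk u] rp(2)[OF r(1) rk u] M.right_module_axioms \<phi> surj krad R(1) iso])
      (use u in auto)
qed

text \<open>The row vector \<open>c\<close> times the adjacency matrix. Summing over arrows counts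
  parallel arrows with multiplicity, and the result is zero outside \<open>verts Q\<close>.\<close>

definition push :: "('v \<Rightarrow> int) \<Rightarrow> 'v \<Rightarrow> int" where
  "push c u = (\<Sum>a | a \<in> arcs Q \<and> head Q a = u. c (tail Q a))"

lemma push_pow_outside: "u \<notin> verts Q \<Longrightarrow> 0 < n \<Longrightarrow> (push ^^ n) c u = 0"
  by (cases n) (auto simp: push_def intro!: sum.neutral)

lemma push_diff: "(push ^^ n) (\<lambda>u. c u - d u) = (\<lambda>u. (push ^^ n) c u - (push ^^ n) d u)"
  by (induction n) (auto simp: push_def sum_subtractf)

lemma push_zero: "(push ^^ n) (\<lambda>_. 0) = (\<lambda>_. 0)"
  by (induction n) (auto simp: push_def)

text \<open>Entries of the powers of the adjacency matrix count walks. The induction removes the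
  first arrow, which transforms \<open>c\<close> into \<open>push c\<close>; hence \<open>c\<close>
  is arbitrary.\<close>

lemma card_walks_push:
  assumes "w \<in> verts Q"
  shows "(\<Sum>u\<in>verts Q. c u * int (card {q \<in> walks u n. tgt Q u q = w})) = (push ^^ n) c w"
proof (induction n arbitrary: c)
  case 0
  have "{q \<in> walks u 0. tgt Q u q = w} = (if w = u then {[]} else {})" if "u \<in> verts Q" for u
    using that by (auto simp: walks_def)
  then have "(\<Sum>u\<in>verts Q. c u * int (card {q \<in> walks u 0. tgt Q u q = w})) = (\<Sum>u\<in>verts Q. if w = u then c u else 0)"
    by (intro sum.cong) auto
  then show ?case using assms by simp
next
  case (Suc n)
  let ?n = "\<lambda>n u. int (card {q \<in> walks u n. tgt Q u q = w})"
  have step: "?n (Suc n) u = (\<Sum>a | a \<in> arcs Q \<and> tail Q a = u. ?n n (head Q a))" for u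
  proof -
    have "{q \<in> walks u (Suc n). tgt Q u q = w}
      = (\<Union>a\<in>{a \<in> arcs Q. tail Q a = u}. (#) a ` {q \<in> walks (head Q a) n. tgt Q (head Q a) q = w})"
    proof (intro equalityI subsetI)
      fix q assume "q \<in> {q \<in> walks u (Suc n). tgt Q u q = w}"
      then show "q \<in> (\<Union>a\<in>{a \<in> arcs Q. tail Q a = u}. (#) a ` {q \<in> walks (head Q a) n. tgt Q (head Q a) q = w})"
        by (cases q) (auto simp: walks_def)
    qed (auto simp: walks_def)
    then have "card {q \<in> walks u (Suc n). tgt Q u q = w}
      = (\<Sum>a\<in>{a \<in> arcs Q. tail Q a = u}. card ((#) a ` {q \<in> walks (head Q a) n. tgt Q (head Q a) q = w}))"
      using finite_walks_length by (simp, intro card_UN_disjoint) auto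
    then show ?thesis by (simp add: card_image)
  qed
  have "(\<Sum>u\<in>verts Q. c u * ?n (Suc n) u)
    = (\<Sum>u\<in>verts Q. \<Sum>a | a \<in> arcs Q \<and> tail Q a = u. c (tail Q a) * ?n n (head Q a))"
    unfolding step sum_distrib_left by (intro sum.cong) auto
  also have "\<dots> = (\<Sum>a\<in>arcs Q. c (tail Q a) * ?n n (head Q a))"
    by (rule sum.group) auto
  \<comment> \<open>The arrows, so far grouped by their tails, are regrouped by their heads.\<close>
  also have "\<dots> = (\<Sum>u\<in>verts Q. \<Sum>a | a \<in> arcs Q \<and> head Q a = u. c (tail Q a) * ?n n (head Q a))"
    by (rule sum.group[symmetric]) auto
  also have "\<dots> = (\<Sum>u\<in>verts Q. push c u * ?n n u)"
    unfolding push_def sum_distrib_right by (intro sum.cong) auto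
  also have "\<dots> = (push ^^ n) (push c) w" by (rule Suc.IH)
  finally show ?case by (simp add: funpow_swap1)
qed

lemma syzygy_endo_comb:
  assumes r: "0 < r" "r < k"
  shows "syzygy_endo A (kc A (comb r c)) = kc A (comb (k - r) ((push ^^ r) c))"
proof -
  have rk: "r \<le> k" and kr: "0 < k - r" "k - r \<le> k" using r by auto
  note rp1 = rp[OF r(1) rk]
  let ?n = "\<lambda>u w. int (card {q \<in> walks u r. tgt Q u q = w})"
  have vw: "tgt Q u q \<in> verts Q" if "q \<in> walks u r" for q u
    using that walk_target by (auto simp: walks_def)
  have step: "kc A (frag_of (syz (rp u r))) = kc A (comb (k - r) (?n u))" if u: "u \<in> verts Q" for u
  proof -
    note R = rep[OF FM_fgm[where I = "walks u r" and v = "tgt Q u", OF kr finite_walks_length vw]]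
    have "kc A (frag_of (syz (rp u r))) = kc A (frag_of (rep A (FM (walks u r) (tgt Q u) (k - r))))"
      by (rule kc_iso[OF syz_fg[OF rp1(1)[OF u]] R(1) is_syzygy_unique[OF rp1(1)[OF u] syz[OF rp1(1)[OF u]] syzygy_MS[OF r u]]])
    also have "\<dots> = kc A (\<Sum>q\<in>walks u r. frag_of (rp (tgt Q u q) (k - r)))"
      unfolding rp_def by (rule kc_FM[OF kr finite_walks_length vw])
    also have "(\<Sum>q\<in>walks u r. frag_of (rp (tgt Q u q) (k - r))) = comb (k - r) (?n u)"
      by (rule sum_frag_comb[OF finite_walks_length vw])
    finally show ?thesis .
  qed
  have "syzygy_endo A (kc A (comb r c)) = kc A (frag_extend (\<lambda>M. frag_of (syz M)) (comb r c))"
    by (rule syzygy_endo_kc[OF comb_carrier[OF r(1) rk]])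
  also have "frag_extend (\<lambda>M. frag_of (syz M)) (comb r c) = (\<Sum>u\<in>verts Q. frag_cmul (c u) (frag_of (syz (rp u r))))"
    unfolding comb_def by (simp add: frag_extend_sum[unfolded o_def] frag_extend_cmul)
  also have "kc A \<dots> = kc A (\<Sum>u\<in>verts Q. frag_cmul (c u) (comb (k - r) (?n u)))"
    using step comb_carrier[OF kr] rp1(1) syz_fg by (intro kc_sum_cong) (auto simp: keys_frag_of)
  also have "(\<Sum>u\<in>verts Q. frag_cmul (c u) (comb (k - r) (?n u))) = (\<Sum>u\<in>verts Q. comb (k - r) (\<lambda>w. c u * ?n u w))"
    by (simp add: comb_cmul)
  also have "\<dots> = comb (k - r) (\<lambda>w. \<Sum>u\<in>verts Q. c u * ?n u w)"
  proof -
    have "(\<Sum>u\<in>V. comb (k - r) (\<lambda>w. c u * ?n u w)) = comb (k - r) (\<lambda>w. \<Sum>u\<in>V. c u * ?n u w)" for V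
      by (induction V rule: infinite_finite_induct) (auto simp: comb_zero comb_add)
    then show ?thesis .
  qed
  also have "\<dots> = comb (k - r) ((push ^^ r) c)"
    unfolding comb_def by (intro sum.cong refl) (simp add: card_walks_push)
  finally show ?thesis .
qed

text \<open>The coordinate at \<open>u\<close> is the value of the invariant
  \<open>top_mult u r\<close>, which descends to \<open>K0\<close> because there are no sinks and
  \<open>r < k\<close>.\<close>

lemma comb_inj:
  assumes sink: "\<And>u. u \<in> verts Q \<Longrightarrow> \<exists>a\<in>arcs Q. tail Q a = u" and r: "0 < r" "r < k"
    and eq: "kc A (comb r c) = kc A (comb r d)" and u: "u \<in> verts Q"
  shows "c u = d u"
proof -
  have rk: "r \<le> k" using r by simp
  have h: "hsum (\<lambda>M. int (top_mult u r M)) (comb r e) = e u" for e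
  proof -
    have "hsum (\<lambda>M. int (top_mult u r M)) (comb r e) = (\<Sum>w\<in>verts Q. e w * int (top_mult u r (rp w r)))"
      by (simp add: comb_def hsum_sum hsum_simps)
    also have "\<dots> = (\<Sum>w\<in>verts Q. if u = w then e w else 0)"
    proof (rule sum.cong[OF refl])
      fix w assume w: "w \<in> verts Q"
      have "top_mult u r (rp w r) = top_mult u r (MS w r)"
        by (rule top_mult_iso[OF rp(4)[OF r(1) rk w] MS_fgm[OF r(1) rk w] rp(2)[OF r(1) rk w]])
      then show "e w * int (top_mult u r (rp w r)) = (if u = w then e w else 0)"
        using top_mult_MS[OF r(1) rk w] by simp
    qed
    finally show ?thesis using u by simp
  qed
  have "hsum (\<lambda>M. int (top_mult u r M)) (comb r c) = hsum (\<lambda>M. int (top_mult u r M)) (comb r d)"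
  proof (rule hsum_kc_eq[OF _ _ comb_carrier[OF r(1) rk] comb_carrier[OF r(1) rk] eq])
    show "int (top_mult u r M) = int (top_mult u r M') + int (top_mult u r M'')"
      if "M \<in> fg_modules A" "M' \<in> fg_modules A" "M'' \<in> fg_modules A" "rmod_iso A M (dsum M' M'')" for M M' M''
      using top_mult_dsum[of M M' M'' u r] that by (simp add: fg_modules_iff)
    show "int (top_mult u r P) = 0" if "P \<in> projective_modules A" for P
      using top_mult_projective[OF sink r(2) that] by simp
  qed
  then show ?thesis unfolding h .
qed

section \<open>Closure properties of a zero Igusa-Todorov subcategory\<close>

lemma zero_IT_subcategoryD:
  assumes "zero_IT_subcategory A D"
  shows "M \<in> D \<Longrightarrow> M \<in> fg_modules A" "M \<in> D \<Longrightarrow> N \<in> fg_modules A \<Longrightarrow> rmod_iso A M N \<Longrightarrow> N \<in> D"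
    and "D = add_closure A D" "M \<in> D \<Longrightarrow> is_syzygy A M N \<Longrightarrow> N \<in> D" "M \<in> D \<Longrightarrow> IT_phi A M = 0"
proof -
  have "enat (IT_phi A M) = 0" if "M \<in> D" for M
    using assms SUP_upper[OF that, of "\<lambda>M. enat (IT_phi A M)"] by (simp add: zero_IT_subcategory_def phi_dim_def)
  then show "M \<in> D \<Longrightarrow> IT_phi A M = 0" by (simp add: zero_enat_def)
  show "M \<in> D \<Longrightarrow> M \<in> fg_modules A" "M \<in> D \<Longrightarrow> N \<in> fg_modules A \<Longrightarrow> rmod_iso A M N \<Longrightarrow> N \<in> D"
    "D = add_closure A D" "M \<in> D \<Longrightarrow> is_syzygy A M N \<Longrightarrow> N \<in> D"
    using assms unfolding zero_IT_subcategory_def subcategory_def by blast+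
qed

lemma zero_IT_sum:
  assumes "zero_IT_subcategory A D" "M \<in> D" "N \<in> D" "L \<in> fg_modules A" "rmod_iso A L (dsum M N)"
  shows "L \<in> D"
  using add_closure.sum[of M A D N L] zero_IT_subcategoryD(3)[OF assms(1)] assms(2-) by simp

lemma zero_IT_summand:
  assumes "zero_IT_subcategory A D" "L \<in> D" "M \<in> fg_modules A" "N \<in> fg_modules A" "rmod_iso A L (dsum M N)"
  shows "M \<in> D"
  using add_closure.summand[of L A D M N] zero_IT_subcategoryD(3)[OF assms(1)] assms(2-) by simp

lemma FM_insert_rep_iso:
  assumes r: "0 < r" "r \<le> k" and I: "finite I" "i \<notin> I" "\<And>j. j \<in> insert i I \<Longrightarrow> v j \<in> verts Q"
  shows "rmod_iso A (rep A (FM (insert i I) v r)) (dsum (rp (v i) r) (rep A (FM I v r)))"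
proof -
  have f: "fgm A (FM (insert i I) v r)" "fgm A (FM I v r)" using I r by (auto intro!: FM_fgm)
  have "rmod_iso A (dsum (MS (v i) r) (FM I v r)) (dsum (rp (v i) r) (rep A (FM I v r)))"
    using rp(3)[OF r, of "v i"] I rep(2)[OF f(2)] by (intro dsum_iso_cong) auto
  then show ?thesis
    by (rule rmod_iso_trans[OF rep(3)[OF f(1)] rmod_iso_trans[OF FM_insert_iso[OF r(2) I(2)]]])
qed

lemma zero_IT_FM:
  assumes D: "zero_IT_subcategory A D" and r: "0 < r" "r \<le> k"
    and I: "finite I" "\<And>i. i \<in> I \<Longrightarrow> v i \<in> verts Q" "\<And>i. i \<in> I \<Longrightarrow> rp (v i) r \<in> D"
  shows "rep A (FM I v r) \<in> D"
  using I
proof (induction I)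
  case empty
  show ?case using add_closure.zero[OF rep_FM_empty[OF r], where D = D] zero_IT_subcategoryD(3)[OF D] by simp
next
  case (insert i I)
  have f: "fgm A (FM (insert i I) v r)" using insert r by (intro FM_fgm) auto
  show ?case
    by (rule zero_IT_sum[OF D insert.prems(2)[of i] insert.IH rep(1)[OF f] FM_insert_rep_iso[OF r insert.hyps]])
      (use insert.prems in auto)
qed

lemma FM_summand_iso:
  assumes r: "0 < r" "r \<le> k" and I: "finite I" "\<And>i. i \<in> I \<Longrightarrow> v i \<in> verts Q" and i: "i \<in> I"
  obtains L where "L \<in> fg_modules A" "rmod_iso A (rep A (FM I v r)) (dsum (rp (v i) r) L)"
proof
  have e: "insert i (I - {i}) = I" using i by auto
  show "rep A (FM (I - {i}) v r) \<in> fg_modules A" using r I by (intro rep FM_fgm) auto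
  show "rmod_iso A (rep A (FM I v r)) (dsum (rp (v i) r) (rep A (FM (I - {i}) v r)))"
    using FM_insert_rep_iso[OF r, of "I - {i}" i v] I e by auto
qed

text \<open>The path \<open>q\<close> singles out one direct summand of the syzygy described in
  \<open>syzygy_MS\<close>.\<close>

lemma zero_IT_step:
  assumes D: "zero_IT_subcategory A D" and r: "0 < r" "r < k"
    and u: "u \<in> verts Q" "rp u r \<in> D" and q: "walk Q u q" "length q = r"
  shows "rp (tgt Q u q) (k - r) \<in> D"
proof -
  have kr: "0 < k - r" "k - r \<le> k" using r by auto
  have vw: "tgt Q u q \<in> verts Q" if "q \<in> walks u r" for q
    using that walk_target by (auto simp: walks_def)
  have qw: "q \<in> walks u r" using q by (simp add: walks_def)
  have F: "rep A (FM (walks u r) (tgt Q u) (k - r)) \<in> D"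
    by (rule zero_IT_subcategoryD(4)[OF D u(2) syzygy_MS[OF r u(1)]])
  obtain L where L: "L \<in> fg_modules A"
    "rmod_iso A (rep A (FM (walks u r) (tgt Q u) (k - r))) (dsum (rp (tgt Q u q) (k - r)) L)"
    by (rule FM_summand_iso[OF kr finite_walks_length vw qw])
  show ?thesis by (rule zero_IT_summand[OF D F rp(1)[OF kr vw[OF qw]] L])
qed

text \<open>Cut the path after \<open>r\<close> arrows: the first step leads to the parameter
  \<open>k - r\<close>, and the second one back to \<open>k - (k - r) = r\<close>.\<close>

lemma zero_IT_step2:
  assumes D: "zero_IT_subcategory A D" and r: "0 < r" "r < k"
    and u: "u \<in> verts Q" "rp u r \<in> D" and p: "walk Q u p" "length p = k"
  shows "rp (tgt Q u p) r \<in> D"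
proof -
  let ?q = "take r p" and ?s = "drop r p"
  have w: "walk Q u ?q" "walk Q (tgt Q u ?q) ?s" using p(1) walk_append[of u ?q ?s] by auto
  have *: "rp (tgt Q u ?q) (k - r) \<in> D" using p(2) r by (intro zero_IT_step[OF D r u w(1)]) auto
  have "rp (tgt Q (tgt Q u ?q) ?s) (k - (k - r)) \<in> D"
    by (rule zero_IT_step[OF D _ _ walk_target[OF w(1)] * w(2)]) (use p(2) r in auto)
  then show ?thesis using r tgt_append[of Q u ?q ?s] by simp
qed

text \<open>On the subgroup spanned by the classes of the modules \<open>MS u r\<close>, the syzygy endomorphism
  acts through powers of the adjacency matrix. They stabilise, which makes the \<open>LEAST\<close> in the
  definition of \<open>IT_phi\<close> meaningful.\<close>

lemma no_zero_IT_subcategory: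
  assumes sink: "\<And>u. u \<in> verts Q \<Longrightarrow> \<exists>a\<in>arcs Q. tail Q a = u" and r: "0 < r" "r < k"
    and D: "zero_IT_subcategory A D" "\<And>u. u \<in> verts Q \<Longrightarrow> rp u r \<in> D"
    and c: "push c = (\<lambda>_. 0)" "w \<in> verts Q" "c w \<noteq> 0"
    and stable: "\<And>t c. n \<le> t \<Longrightarrow> (push ^^ Suc t) c = (\<lambda>_. 0) \<Longrightarrow> (push ^^ t) c = (\<lambda>_. 0)"
  shows False
proof -
  have rk: "r \<le> k" using r by simp
  let ?w = "syzygy_endo A" and ?S = "rep A (FM (verts Q) (\<lambda>u. u) r)"
  have Sf: "fgm A (FM (verts Q) (\<lambda>u. u) r)" by (rule FM_fgm[OF r(1) rk]) auto
  have SD: "?S \<in> D" by (rule zero_IT_FM[OF D(1) r(1) rk]) (use D(2) in auto)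
  note R = rep[OF Sf]
  have Sft: "free_type r ?S" by (rule free_typeI[OF r(1) rk _ _ R(1,3)]) auto
  interpret K: comm_group "K0 A" by (rule K0_comm_group)
  interpret kc: group_hom "FG A" "K0 A" "kc A"
    using kc_hom K0_group by (simp add: group_hom_def group_hom_axioms_def)
  define X where "X = K0_span A ?S"
  have cc: "kc A (comb r' d) \<in> carrier (K0 A)" if "0 < r'" "r' < k" for r' d
    using kc.hom_closed[OF comb_carrier] that by simp
  \<comment> \<open>The subgroup \<open>X\<close> consists exactly of the classes of formal sums
    \<open>comb r d\<close>. This inclusion holds since the additive closure of \<open>?S\<close>
    contains only sums of modules \<open>M(u, r)\<close>.\<close>
  have X_sub: "\<exists>d. x = kc A (comb r d)" if "x \<in> X" for x
    using that unfolding X_def K0_span_def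
  proof (induction rule: generate.induct)
    case one
    have "\<one>\<^bsub>K0 A\<^esub> = kc A (comb r (\<lambda>_. 0))" using kc.hom_one by (simp add: comb_zero)
    then show ?case by blast
  next
    case (incl h)
    then show ?case
      using add_closure_free_type[OF r(1) rk R(1) Sft] free_type_class[OF r(1) rk] by (auto simp: K0_class_kc)
  next
    case (inv h)
    then obtain N where N: "N \<in> add_closure A {?S}" "h = kc A (frag_of N)" by (auto simp: K0_class_kc)
    then obtain d where d: "h = kc A (comb r d)"
      using add_closure_free_type[OF r(1) rk R(1) Sft N(1)] free_type_class[OF r(1) rk, of N] by auto
    have "inv\<^bsub>FG A\<^esub> (comb r d) = comb r (\<lambda>u. - d u)"
      using comb_carrier[OF r(1) rk, of d] by (simp add: comb_minus)
    then have "inv\<^bsub>K0 A\<^esub> h = kc A (comb r (\<lambda>u. - d u))"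
      using kc.hom_inv[OF comb_carrier[OF r(1) rk, of d]] by (simp add: d)
    then show ?case by blast
  next
    case (eng h1 h2)
    then obtain d1 d2 where "h1 = kc A (comb r d1)" "h2 = kc A (comb r d2)" by blast
    then have "h1 \<otimes>\<^bsub>K0 A\<^esub> h2 = kc A (comb r (\<lambda>u. d1 u + d2 u))"
      using kc_add[OF comb_carrier[OF r(1) rk] comb_carrier[OF r(1) rk]] by (simp add: comb_add)
    then show ?case by blast
  qed
  have X_carrier: "X \<subseteq> carrier (K0 A)" using X_sub cc[OF r] by blast
  have gens: "K0_class A ` add_closure A {?S} \<subseteq> carrier (K0 A)"
    using X_carrier unfolding X_def K0_span_def by (auto intro: generate.incl)
  have X_subgroup: "subgroup X (K0 A)"
    unfolding X_def K0_span_def by (rule K.generate_is_subgroup[OF gens])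
  have X_sup: "kc A (comb r d) \<in> X" for d
  proof -
    \<comment> \<open>Working with the preimage of \<open>X\<close> in the free abelian group gives
      closure under integer multiples and sums of the generators.\<close>
    have H: "subgroup {x \<in> carrier (FG A). kc A x \<in> X} (FG A)"
    proof (rule kc.G.subgroupI)
      have "0 \<in> {x \<in> carrier (FG A). kc A x \<in> X}"
        using kc.hom_one subgroup.one_closed[OF X_subgroup] by simp
      then show "{x \<in> carrier (FG A). kc A x \<in> X} \<noteq> {}" by blast
    next
      fix a assume a: "a \<in> {x \<in> carrier (FG A). kc A x \<in> X}"
      then show "inv\<^bsub>FG A\<^esub> a \<in> {x \<in> carrier (FG A). kc A x \<in> X}"
        using kc.hom_inv[of a] kc.G.inv_closed[of a] subgroup.m_inv_closed[OF X_subgroup, of "kc A a"] by auto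
      fix b assume "b \<in> {x \<in> carrier (FG A). kc A x \<in> X}"
      then show "a \<otimes>\<^bsub>FG A\<^esub> b \<in> {x \<in> carrier (FG A). kc A x \<in> X}"
        using a kc.hom_mult[of a b] kc.G.m_closed[of a b] subgroup.m_closed[OF X_subgroup, of "kc A a" "kc A b"] by auto
    qed auto
    have f: "frag_cmul (d u) (frag_of (rp u r)) \<in> {x \<in> carrier (FG A). kc A x \<in> X}" if u: "u \<in> verts Q" for u
    proof -
      obtain L where L: "L \<in> fg_modules A" "rmod_iso A ?S (dsum (rp u r) L)"
        by (rule FM_summand_iso[OF r(1) rk _ _ u, of "\<lambda>u. u"]) auto
      have "rp u r \<in> add_closure A {?S}"
        by (rule add_closure.summand[OF add_closure.base rp(1)[OF r(1) rk u] L]) (use R in auto)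
      then have "kc A (frag_of (rp u r)) \<in> X"
        unfolding X_def K0_span_def by (intro generate.incl) (auto simp: K0_class_kc)
      then have "frag_of (rp u r) \<in> {x \<in> carrier (FG A). kc A x \<in> X}"
        using rp(1)[OF r(1) rk u] by (simp add: keys_frag_of)
      then show ?thesis
        using kc.G.subgroup_int_pow_closed[OF H, of "frag_of (rp u r)" "d u"] rp(1)[OF r(1) rk u]
        by (simp add: keys_frag_of)
    qed
    have "(\<Sum>u\<in>V. frag_cmul (d u) (frag_of (rp u r))) \<in> {x \<in> carrier (FG A). kc A x \<in> X}" if "finite V" "V \<subseteq> verts Q" for V
      using that
    proof (induction V)
      case empty
      then show ?case using subgroup.one_closed[OF H] by simp
    next
      case (insert u V)
      then show ?case using subgroup.m_closed[OF H f[of u], of "\<Sum>u\<in>V. frag_cmul (d u) (frag_of (rp u r))"] by simp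
    qed
    from this[of "verts Q"] show ?thesis by (simp add: comb_def)
  qed
  \<comment> \<open>The parameter alternates between \<open>r\<close> and \<open>k - r\<close>, and
    \<open>E\<close> adds up the path lengths used so far. Each syzygy uses at least one arrow, so
    \<open>m \<le> E\<close>, and large \<open>m\<close> puts \<open>E\<close> into the stable
    range.\<close>
  have pow: "\<exists>E r'. 0 < r' \<and> r' < k \<and> m \<le> E \<and> (\<forall>d. (?w ^^ m) (kc A (comb r d)) = kc A (comb r' ((push ^^ E) d)))" for m
  proof (induction m)
    case 0
    show ?case using r by (intro exI[of _ 0] exI[of _ r]) simp
  next
    case (Suc m)
    then obtain E r' where E: "0 < r'" "r' < k" "m \<le> E"
      "\<And>d. (?w ^^ m) (kc A (comb r d)) = kc A (comb r' ((push ^^ E) d))" by blast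
    have "(?w ^^ Suc m) (kc A (comb r d)) = kc A (comb (k - r') ((push ^^ (r' + E)) d))" for d
      using syzygy_endo_comb[OF E(1,2)] E(4) by (simp add: funpow_add)
    then show ?case using E by (intro exI[of _ "r' + E"] exI[of _ "k - r'"]) auto
  qed
  have stable': "(push ^^ E) d = (\<lambda>_. 0)" if "n \<le> E" "(push ^^ (j + E)) d = (\<lambda>_. 0)" for E j d
    using that(2)
  proof (induction j)
    case (Suc j)
    then show ?case using stable[of "j + E" d] that(1) by simp
  qed simp
  let ?P = "\<lambda>m. ?w \<in> iso (syzygy_image A ?S m) (syzygy_image A ?S (Suc m))"
  have wm_carrier: "(?w ^^ m) x \<in> carrier (K0 A)" if "x \<in> carrier (K0 A)" for m x
    using that by (induction m) (auto intro: hom_in_carrier[OF syzygy_endo_hom])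
  have "?P m" if m: "n \<le> m" for m
  proof -
    have inj: "inj_on ?w ((?w ^^ m) ` X)"
    proof (rule inj_onI)
      fix x y assume x: "x \<in> (?w ^^ m) ` X" and y: "y \<in> (?w ^^ m) ` X" and eq: "?w x = ?w y"
      obtain E r' where E: "0 < r'" "r' < k" "m \<le> E"
        "\<And>d. (?w ^^ m) (kc A (comb r d)) = kc A (comb r' ((push ^^ E) d))" using pow[of m] by blast
      obtain d e where d: "x = kc A (comb r' ((push ^^ E) d))" and e: "y = kc A (comb r' ((push ^^ E) e))"
        using x y X_sub E(4) by blast
      have eq': "kc A (comb (k - r') ((push ^^ (r' + E)) d)) = kc A (comb (k - r') ((push ^^ (r' + E)) e))"
        using eq syzygy_endo_comb[OF E(1,2)] by (simp add: d e funpow_add)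
      \<comment> \<open>Independence of the classes compares coordinates at vertices only; the other
        ones are zero since \<open>push\<close> has been applied at least once.\<close>
      have eqs: "(push ^^ (r' + E)) d u = (push ^^ (r' + E)) e u" for u
      proof (cases "u \<in> verts Q")
        case True
        show ?thesis by (rule comb_inj[OF sink _ _ eq' True]) (use E in auto)
      next
        case False
        then show ?thesis using E(1) by (simp add: push_pow_outside)
      qed
      have "(push ^^ (r' + E)) (\<lambda>u. d u - e u) = (\<lambda>_. 0)"
        by (simp only: push_diff eqs diff_self)
      then have diff: "(push ^^ E) (\<lambda>u. d u - e u) = (\<lambda>_. 0)"
        by (rule stable'[OF order_trans[OF m E(3)]])
      have "(push ^^ E) d u = (push ^^ E) e u" for u
        using fun_cong[OF push_diff[of E d e], of u] unfolding diff by simp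
      then have "(push ^^ E) d = (push ^^ E) e" by blast
      then show "x = y" by (simp add: d e)
    qed
    have "?w \<in> hom (syzygy_image A ?S m) (syzygy_image A ?S (Suc m))"
    proof (rule homI)
      show "?w x \<in> carrier (syzygy_image A ?S (Suc m))" if "x \<in> carrier (syzygy_image A ?S m)" for x
        using that by (auto simp: syzygy_image_def)
      show "?w (x \<otimes>\<^bsub>syzygy_image A ?S m\<^esub> y) = ?w x \<otimes>\<^bsub>syzygy_image A ?S (Suc m)\<^esub> ?w y"
        if "x \<in> carrier (syzygy_image A ?S m)" "y \<in> carrier (syzygy_image A ?S m)" for x y
        using that X_carrier wm_carrier[of _ m] hom_mult[OF syzygy_endo_hom, of x y]
        by (auto simp: syzygy_image_def X_def)
    qed
    moreover have "bij_betw ?w (carrier (syzygy_image A ?S m)) (carrier (syzygy_image A ?S (Suc m)))"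
      using inj by (simp add: bij_betw_def syzygy_image_def X_def image_image)
    ultimately show ?thesis by (simp add: iso_def)
  qed
  then have "\<exists>k. \<forall>m\<ge>k. ?P m" by blast
  then have "\<forall>m\<ge>IT_phi A ?S. ?P m" unfolding IT_phi_def by (rule LeastI_ex)
  then have "?P 0" using zero_IT_subcategoryD(5)[OF D(1) SD] by simp
  then have inj: "inj_on ?w X" by (simp add: iso_def bij_betw_def syzygy_image_def X_def)
  \<comment> \<open>As \<open>0 < r\<close>, the kernel vector \<open>c\<close> is annihilated. Its
    class and the zero class then have the same image under a map that is injective on
    \<open>X\<close>.\<close>
  have "(push ^^ r) c = (push ^^ (r - 1)) (push c)" using r(1) by (cases r) (auto simp: funpow_swap1)
  then have "(push ^^ r) c = (push ^^ r) (\<lambda>_. 0)" by (simp add: c(1) push_zero)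
  then have "?w (kc A (comb r c)) = ?w (kc A (comb r (\<lambda>_. 0)))"
    using syzygy_endo_comb[OF r] by simp
  then have "kc A (comb r c) = kc A (comb r (\<lambda>_. 0))" using inj X_sup by (auto dest: inj_onD)
  then show False using comb_inj[OF sink r _ c(2)] c(3) by blast
qed

text \<open>An element \<open>x\<close> of minimal degree \<open>l\<close> generates a copy of \<open>MS u (k - l)\<close>, and reading off the
  coefficients at the prolongations of a path in its leading term retracts the submodule onto it.\<close>

lemma rad_submodule_summand:
  fixes I :: "'i set"
  assumes I: "finite I" "\<And>i. i \<in> I \<Longrightarrow> v i \<in> verts Q"
    and L: "submodule A (FM I v k) L" "L \<subseteq> rad" and y: "y \<in> L" "y \<noteq> (\<lambda>_. 0)"
  obtains u r and K :: "('a, 'i \<times> 'e list \<Rightarrow> 'k) rmodule"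
    where "u \<in> verts Q" "0 < r" "r < k" "fgm A K" "rmod_iso A ((FM I v k)\<lparr>carrier := L\<rparr>) (dsum (MS u r) K)"
proof -
  let ?F = "FM I v k"
  interpret F: right_module A ?F by (rule FM_right_module) simp
  let ?N = "?F\<lparr>carrier := L\<rparr>"
  interpret N: right_module A ?N by (rule F.submodule_right_module[OF L(1)])
  note LD = F.submoduleD[OF L(1)]
  let ?P = "\<lambda>l. \<exists>z\<in>L. \<exists>i p. length p = l \<and> z (i, p) \<noteq> 0"
  obtain i0 p0 where "y (i0, p0) \<noteq> 0" using y(2) by (auto simp: fun_eq_iff)
  then have ex: "\<exists>l. ?P l" using y(1) by blast
  define l where "l = (LEAST l. ?P l)"
  have "?P l" unfolding l_def by (rule LeastI_ex[OF ex])
  then obtain z i q where z: "z \<in> L" "length q = l" "z (i, q) \<noteq> 0" by blast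
  have low: "z' (j, p) = 0" if "z' \<in> L" "length p < l" for z' j p
    using not_less_Least[of "length p" ?P] that unfolding l_def by blast
  have zc: "i \<in> I" "walk Q (v i) q" "length q < k" using z LD(2)[OF z(1)] by (auto simp: FM_carrier)
  have l: "0 < l" "l < k" using z zc L(2) by (auto simp: rad_def)
  define u where "u = tgt Q (v i) q"
  have tq: "tgt Q (v i) q = u" by (simp add: u_def)
  \<comment> \<open>Prolongations of \<open>q\<close> survive up to length \<open>k - 1\<close>,
    which leaves room for \<open>k - l\<close> degrees.\<close>
  define r where "r = k - l"
  have u: "u \<in> verts Q" using walk_target[OF zc(2)] by (simp add: u_def)
  have r: "0 < r" "r < k" "r \<le> k" using l by (auto simp: r_def)
  note Mf = MS_fgm[OF r(1,3) u]
  interpret M: right_module A "MS u r" by (rule MS_right_module[OF r(3)])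
  define x where "x = z \<odot>r\<^bsub>?F\<^esub> idem u"
  have xL: "x \<in> L" unfolding x_def by (rule LD(5)[OF z(1) idem_closed[OF u]])
  have xiq: "x (i, q) = z (i, q)"
  proof -
    have "splitsum (\<lambda>l s. z (i, l) * coef (idem u) (tgt Q (v i) l, s)) q = z (i, q) * coef (idem u) (u, [])"
      by (subst splitsum_last) (auto simp: coef_idem[OF u] tq)
    then show ?thesis using zc(3) by (simp add: x_def FM_ract coef_idem[OF u])
  qed
  define \<rho> where "\<rho> = (\<lambda>(w :: 'i \<times> 'e list \<Rightarrow> 'k) (_ :: unit, p). if length p < r then w (i, q @ p) else 0)"
  have \<rho>: "\<rho> \<in> rmod_hom A ?N (MS u r)"
  proof (rule rmod_homI)
    show "\<rho> w \<in> carrier (MS u r)" if "w \<in> carrier ?N" for w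
      using that LD(2)[of w] by (fastforce simp: \<rho>_def MS_def FM_carrier u_def split: if_splits)
    show "\<rho> (w \<oplus>\<^bsub>?N\<^esub> w') = \<rho> w \<oplus>\<^bsub>MS u r\<^esub> \<rho> w'" for w w'
      by (auto simp: \<rho>_def MS_def fun_eq_iff)
    show "\<rho> (w \<odot>r\<^bsub>?N\<^esub> a) = \<rho> w \<odot>r\<^bsub>MS u r\<^esub> a" if w: "w \<in> carrier ?N" for w a
    proof (rule ext, clarify)
      fix t p
      show "\<rho> (w \<odot>r\<^bsub>?N\<^esub> a) (t, p) = (\<rho> w \<odot>r\<^bsub>MS u r\<^esub> a) (t, p)"
      proof (cases "length p < r")
        case True
        have "splitsum (\<lambda>m s. w (i, m) * coef a (tgt Q (v i) m, s)) (q @ p)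
          = splitsum (\<lambda>m s. w (i, q @ m) * coef a (tgt Q (v i) (q @ m), s)) p"
          using w z(2) low by (intro splitsum_prefix) auto
        also have "\<dots> = splitsum (\<lambda>m s. \<rho> w (t, m) * coef a (tgt Q u m, s)) p"
          using True by (intro splitsum_cong) (auto simp: \<rho>_def u_def)
        finally show ?thesis using True z(2) by (simp add: MS_def FM_ract) (simp add: \<rho>_def FM_ract r_def)
      qed (simp add: MS_def FM_ract \<rho>_def)
    qed
  qed
  \<comment> \<open>Elements of \<open>L\<close> have no terms of degree below \<open>l\<close>, and
    terms of degree \<open>k = l + r\<close> vanish.\<close>
  have killed: "killed r ?N"
    unfolding killed_def
  proof (intro ballI impI)
    fix w a assume w: "w \<in> carrier ?N" and a: "a \<in> carrier A" "\<forall>u p. length p < r \<longrightarrow> coef a (u, p) = 0"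
    have "splitsum (\<lambda>m s. w (j, m) * coef a (tgt Q (v j) m, s)) p = 0" if p: "length p < k" for j p
    proof (rule splitsum_eq_0)
      fix m s assume "m @ s = p"
      then have "length m < l \<or> length s < r" using p l by (auto simp: r_def)
      then show "w (j, m) * coef a (tgt Q (v j) m, s) = 0" using low w a(2) by auto
    qed
    then show "w \<odot>r\<^bsub>?N\<^esub> a = \<zero>\<^bsub>?N\<^esub>" by (auto simp: FM_ract fun_eq_iff)
  qed
  let ?i = "lin ?N (UNIV :: unit set) (\<lambda>_. u) (\<lambda>_. x)"
  have xN: "x \<in> carrier ?N" using xL by simp
  have i: "?i \<in> rmod_hom A (MS u r) ?N"
    unfolding MS_def by (rule lin_hom[OF r(3) _ N.right_module_axioms killed]) (use xN in auto)
  have i_eq: "?i w = x \<odot>r\<^bsub>?F\<^esub> cmp (\<lambda>_. u) w ()" if w: "w \<in> carrier (MS u r)" for w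
  proof -
    have c: "cmp (\<lambda>_. u) w () \<in> carrier A" using w unfolding MS_def by (rule cmp_closed[OF r(3)])
    have "x \<odot>r\<^bsub>?N\<^esub> cmp (\<lambda>_. u) w () \<in> carrier ?N" by (rule N.ract_closed[OF xN c])
    then show ?thesis unfolding lin_def UNIV_unit by (simp add: N.M.finsum_insert N.M.finsum_empty)
  qed
  \<comment> \<open>At a term of \<open>w\<close> of lowest degree only the cut directly behind
    \<open>q\<close> contributes: any later cut leaves a suffix shorter than \<open>p\<close>, where
    \<open>w\<close> vanishes. The composite is thus triangular with the nonzero diagonal entry
    \<open>z (i, q)\<close>.\<close>
  have lead: "\<rho> (?i w) ((), p) = z (i, q) * w ((), p)"
    if w: "w \<in> carrier (MS u r)" and p: "length p < r" and min: "\<And>s. length s < length p \<Longrightarrow> w ((), s) = 0" for w p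
  proof -
    have cw: "coef (cmp (\<lambda>_. u) w ()) (u', s) = (if u' = u then w ((), s) else 0)" for u' s
      using w unfolding MS_def by (rule coef_cmp[OF r(3)])
    have "splitsum (\<lambda>m s. x (i, m) * coef (cmp (\<lambda>_. u) w ()) (tgt Q (v i) m, s)) (q @ p)
      = splitsum (\<lambda>m s. x (i, q @ m) * coef (cmp (\<lambda>_. u) w ()) (tgt Q (v i) (q @ m), s)) p"
      using xL z(2) low by (intro splitsum_prefix) auto
    also have "\<dots> = splitsum (\<lambda>m s. if m = [] then x (i, q) * w ((), p) else 0) p"
    proof (rule splitsum_cong)
      fix m s assume ms: "m @ s = p"
      show "x (i, q @ m) * coef (cmp (\<lambda>_. u) w ()) (tgt Q (v i) (q @ m), s) = (if m = [] then x (i, q) * w ((), p) else 0)"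
        using ms min[of s] by (cases m) (auto simp: cw tq)
    qed
    also have "\<dots> = x (i, q) * w ((), p)" by (subst splitsum_first) auto
    finally show ?thesis using p z(2) by (simp add: i_eq[OF w] \<rho>_def FM_ract xiq r_def)
  qed
  let ?g = "\<lambda>w. \<rho> (?i w)"
  have g: "?g \<in> rmod_hom A (MS u r) (MS u r)" by (rule rmod_hom_comp[OF i \<rho>])
  have inj: "w = \<zero>\<^bsub>MS u r\<^esub>" if w: "w \<in> carrier (MS u r)" "?g w = \<zero>\<^bsub>MS u r\<^esub>" for w
  proof (rule ccontr)
    assume "w \<noteq> \<zero>\<^bsub>MS u r\<^esub>"
    then obtain p where "w ((), p) \<noteq> 0" by (auto simp: MS_def fun_eq_iff)
    then obtain p where p: "w ((), p) \<noteq> 0" "\<And>s. length s < length p \<Longrightarrow> w ((), s) = 0"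
      using ex_has_least_nat[of "\<lambda>p. w ((), p) \<noteq> 0" p length] by (metis linorder_not_less)
    have "length p < r" using w(1) p(1) by (auto simp: MS_def FM_carrier)
    then have "?g w ((), p) = z (i, q) * w ((), p)" using w(1) p(2) by (intro lead)
    then show False using w(2) p(1) z(3) by (simp add: MS_def)
  qed
  have inj_g: "inj_on ?g (carrier (MS u r))"
    by (rule rmod_hom_injI[OF M.right_module_axioms M.right_module_axioms g inj])
  have surj: "?g ` carrier (MS u r) = carrier (MS u r)"
  proof -
    have sup: "superfluous A (MS u r) (carrier (MS u r) \<inter> rad)"
      unfolding MS_def by (rule rad_superfluous[OF r(1,3)]) (use u in auto)
    have sub: "submodule A (MS u r) (?g ` carrier (MS u r))"
      by (rule image_submodule[OF M.right_module_axioms M.right_module_axioms g M.submodule_carrier])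
    have "?g ` carrier (MS u r) <+>\<^bsub>MS u r\<^esub> (carrier (MS u r) \<inter> rad) = carrier (MS u r)"
    proof (intro equalityI subsetI)
      fix w assume w: "w \<in> carrier (MS u r)"
      have b: "bas () \<in> carrier (MS u r)" unfolding MS_def by (rule bas_closed) (use r u in auto)
      let ?c = "w ((), []) / z (i, q)"
      define b' where "b' = bas () \<odot>r\<^bsub>MS u r\<^esub> scal ?c"
      have b'c: "b' \<in> carrier (MS u r)" unfolding b'_def by (rule M.ract_closed[OF b scal_closed])
      have "b' ((), []) = ?c"
        using b unfolding b'_def MS_def by (subst FM_scal[OF r(3)]) (auto simp: bas_def)
      then have gb: "?g b' ((), []) = w ((), [])" using lead[OF b'c, of "[]"] r(1) z(3) by simp
      have gbc: "?g b' \<in> carrier (MS u r)" by (rule rmod_homD(1)[OF g b'c])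
      have "w \<ominus>\<^bsub>MS u r\<^esub> ?g b' \<in> carrier (MS u r) \<inter> rad"
        using w gbc gb unfolding MS_def by (auto simp: rad_def FM_minus[OF r(3)] intro!: M.M.minus_closed[unfolded MS_def])
      moreover have "w = ?g b' \<oplus>\<^bsub>MS u r\<^esub> (w \<ominus>\<^bsub>MS u r\<^esub> ?g b')"
        using w gbc by (simp add: M.M.minus_eq M.M.a_lcomm[of "?g b'"] M.M.r_neg)
      ultimately show "w \<in> ?g ` carrier (MS u r) <+>\<^bsub>MS u r\<^esub> (carrier (MS u r) \<inter> rad)"
        using b'c unfolding set_add_def set_mult_def by auto
    next
      fix w assume "w \<in> ?g ` carrier (MS u r) <+>\<^bsub>MS u r\<^esub> (carrier (MS u r) \<inter> rad)"
      then obtain a b where "a \<in> carrier (MS u r)" "b \<in> carrier (MS u r)" "w = ?g a \<oplus>\<^bsub>MS u r\<^esub> b"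
        unfolding set_add_def set_mult_def by auto
      then show "w \<in> carrier (MS u r)" using rmod_homD(1)[OF g] M.M.a_closed by blast
    qed
    then show ?thesis using sup sub unfolding superfluous_def by blast
  qed
  let ?K = "kernel_module ?N (MS u r) \<rho>"
  have iso: "rmod_iso A ?N (dsum (MS u r) ?K)"
    by (rule retract_dsum_iso[OF M.right_module_axioms N.right_module_axioms i \<rho>]) (simp add: bij_betw_def inj_g surj)
  have "fgm A ?K"
  proof -
    let ?S = "a_kernel ?N (MS u r) \<rho>"
    have S: "submodule A ?N ?S" by (rule kernel_submodule[OF N.right_module_axioms M.right_module_axioms \<rho>])
    have "submodule A ?F ?S"
      using N.submoduleD[OF S] LD(1) by (intro F.submoduleI) auto
    then have "fin_gen A (?F\<lparr>carrier := ?S\<rparr>)" by (rule FM_submodule_fin_gen[OF order_refl I(1)])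
    moreover have "?K = ?F\<lparr>carrier := ?S\<rparr>" by (simp add: kernel_module_def)
    moreover have "right_module A ?K" by (rule kernel_right_module[OF N.right_module_axioms M.right_module_axioms \<rho>])
    ultimately show ?thesis by (simp add: fgm_def)
  qed
  then show ?thesis using that[OF u r(1,2) _ iso] by blast
qed

text \<open>If the kernel of a minimal cover of \<open>M\<close> were zero, \<open>M\<close> would
  be isomorphic to the projective cover. Otherwise the kernel is a nonzero submodule of the radical
  and has a summand \<open>M(u, r)\<close>. Its nonzero elements involve nontrivial paths, so there
  are arrows; with strong connectedness this rules out sinks.\<close>

lemma zero_IT_nonprojective:
  assumes D: "zero_IT_subcategory A D" and M: "M \<in> D" "M \<notin> projective_modules A"
  shows "\<exists>u r. u \<in> verts Q \<and> 0 < r \<and> r < k \<and> rp u r \<in> D" "arcs Q \<noteq> {}"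
proof -
  have Mf: "M \<in> fg_modules A" "fgm A M" "right_module A M"
    using zero_IT_subcategoryD(1)[OF D M(1)] by (auto simp: fgm_def fg_modules_def)
  obtain T :: "('v \<times> (nat \<Rightarrow> 'a) set) set" and \<phi> where T: "finite T" "\<And>t. t \<in> T \<Longrightarrow> fst t \<in> verts Q"
    and \<phi>: "\<phi> \<in> rmod_hom A (FM T fst k) M" "\<phi> ` carrier (FM T fst k) = carrier M"
    "\<And>y. y \<in> carrier (FM T fst k) \<Longrightarrow> \<phi> y = \<zero>\<^bsub>M\<^esub> \<Longrightarrow> y \<in> rad"
    by (rule minimal_cover[OF k_pos order_refl Mf(2) killed_k[OF Mf(3)]]) blast
  let ?F = "FM T fst k"
  interpret F: right_module A ?F by (rule FM_right_module) simp
  interpret M: right_module A M by (rule Mf)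
  define L where "L = a_kernel ?F M \<phi>"
  have L: "submodule A ?F L" unfolding L_def by (rule kernel_submodule[OF F.right_module_axioms Mf(3) \<phi>(1)])
  have Lrad: "L \<subseteq> rad" using \<phi>(3) by (auto simp: L_def a_kernel_def')
  have ker: "kernel_module ?F M \<phi> = ?F\<lparr>carrier := L\<rparr>" by (simp add: kernel_module_def L_def)
  have "\<exists>y\<in>L. y \<noteq> (\<lambda>_. 0)"
  proof (rule ccontr)
    assume "\<not> (\<exists>y\<in>L. y \<noteq> (\<lambda>_. 0))"
    then have z: "y = \<zero>\<^bsub>?F\<^esub>" if "y \<in> carrier ?F" "\<phi> y = \<zero>\<^bsub>M\<^esub>" for y
      using that by (auto simp: L_def a_kernel_def')
    have "inj_on \<phi> (carrier ?F)"
      by (rule rmod_hom_injI[OF F.right_module_axioms Mf(3) \<phi>(1) z])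
    then have iso: "rmod_iso A ?F M" using \<phi> by (intro rmod_isoI[OF \<phi>(1)]) (simp add: bij_betw_def)
    have "M \<in> projective_modules A"
      by (rule FM_projective[OF T Mf(1) rmod_iso_sym[OF F.right_module_axioms iso]])
    then show False using M(2) by simp
  qed
  then obtain y where y: "y \<in> L" "y \<noteq> (\<lambda>_. 0)" by blast
  obtain i p where ip: "y (i, p) \<noteq> 0" using y(2) by (auto simp: fun_eq_iff)
  have "p \<noteq> []" using ip y(1) Lrad by (cases i) (auto simp: rad_def)
  moreover have "walk Q (fst i) p" using ip y(1) F.submoduleD(2)[OF L] by (cases i) (auto simp: FM_carrier)
  ultimately show "arcs Q \<noteq> {}" by (cases p) auto
  obtain u r and K :: "('a, ('v \<times> (nat \<Rightarrow> 'a) set) \<times> 'e list \<Rightarrow> 'k) rmodule"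
    where ur: "u \<in> verts Q" "0 < r" "r < k" and K: "fgm A K" "rmod_iso A (?F\<lparr>carrier := L\<rparr>) (dsum (MS u r) K)"
    by (rule rad_submodule_summand[OF T L Lrad y]) blast+
  have rk: "r \<le> k" using ur by simp
  note kf = FM_kernel_fgm[OF order_refl T(1) Mf(3) \<phi>(1)]
  note R = rep[OF kf] and RK = rep[OF K(1)]
  have "is_syzygy A M (rep A (kernel_module ?F M \<phi>))"
    by (rule syzygyI[OF T Mf(1) rmod_iso_refl Mf(3) \<phi> R(1,3)])
  then have inD: "rep A (kernel_module ?F M \<phi>) \<in> D" by (rule zero_IT_subcategoryD(4)[OF D M(1)])
  have "rmod_iso A (dsum (MS u r) K) (dsum (rp u r) (rep A K))"
    by (rule dsum_iso_cong[OF rp(3)[OF ur(2) rk ur(1)] RK(2)])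
  then have "rmod_iso A (rep A (kernel_module ?F M \<phi>)) (dsum (rp u r) (rep A K))"
    by (rule rmod_iso_trans[OF R(3) rmod_iso_trans[OF K(2)[folded ker]]])
  then have "rp u r \<in> D" by (rule zero_IT_summand[OF D inD rp(1)[OF ur(2) rk ur(1)] RK(1)])
  then show "\<exists>u r. u \<in> verts Q \<and> 0 < r \<and> r < k \<and> rp u r \<in> D" using ur by blast
qed

section \<open>Consequences of strong connectedness\<close>

lemma strongly_connected_walk:
  assumes "strongly_connected Q" "u \<in> verts Q" "w \<in> verts Q"
  obtains p where "walk Q u p" "tgt Q u p = w"
proof -
  have "u \<rightarrow>\<^sup>*\<^bsub>Q\<^esub> w" using assms by (auto simp: strongly_connected_def)
  then show ?thesis using that by (auto simp: reachable_awalk awalk_iff_walk)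
qed

lemma strongly_connected_no_sink:
  assumes "strongly_connected Q" "arcs Q \<noteq> {}" "u \<in> verts Q"
  shows "\<exists>a\<in>arcs Q. tail Q a = u"
proof -
  obtain a where a: "a \<in> arcs Q" using assms(2) by blast
  obtain p where p: "walk Q u p" "tgt Q u p = tail Q a"
    using strongly_connected_walk[OF assms(1,3)] a by (metis tail_in_verts)
  show ?thesis using a p by (cases p) auto
qed

lemma zero_IT_spread_arrow:
  assumes D: "zero_IT_subcategory A D" and sc: "strongly_connected Q" and k: "k = 2"
    and u: "u \<in> verts Q" "rp u 1 \<in> D" and w: "w \<in> verts Q"
  shows "rp w 1 \<in> D"
proof -
  obtain p where p: "walk Q u p" "tgt Q u p = w" by (rule strongly_connected_walk[OF sc u(1) w])
  have "rp (tgt Q u p) 1 \<in> D"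
    using p(1) u
  proof (induction p arbitrary: u)
    case (Cons a p)
    have "rp (tgt Q u [a]) (k - 1) \<in> D"
      by (rule zero_IT_step[OF D _ _ Cons.prems(2,3)]) (use Cons.prems(1) k in auto)
    then show ?case using Cons.IH[of "head Q a"] Cons.prems(1) k by simp
  qed simp
  then show ?thesis using p(2) by simp
qed

lemma zero_IT_spread_loop:
  assumes D: "zero_IT_subcategory A D" and sc: "strongly_connected Q"
    and a: "a \<in> arcs Q" "tail Q a = head Q a" and r: "0 < r" "r < k"
    and u: "u \<in> verts Q" "rp u r \<in> D" and w: "w \<in> verts Q"
  shows "rp w r \<in> D"
proof -
  let ?x = "head Q a"
  have x: "?x \<in> verts Q" using a(1) by simp
  obtain p where p: "walk Q u p" "tgt Q u p = ?x" by (rule strongly_connected_walk[OF sc u(1) x])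
  obtain q where q: "walk Q ?x q" "tgt Q ?x q = w" by (rule strongly_connected_walk[OF sc x w])
  let ?n = "length p + length q"
  have loop: "walk Q ?x (replicate n a) \<and> tgt Q ?x (replicate n a) = ?x" for n
    using a x by (induction n) auto
  \<comment> \<open>Running \<open>k - 1\<close> times \<open>?n\<close> times through the loop
    brings the total length to \<open>k * ?n\<close>, whatever the lengths of \<open>p\<close> and
    \<open>q\<close> are.\<close>
  let ?s = "p @ replicate ((k - 1) * ?n) a @ q"
  have "length ?s = ?n * k" using k_pos by (cases k) auto
  moreover have "walk Q u ?s" "tgt Q u ?s = w" using p q loop by auto
  moreover have "rp (tgt Q u s) r \<in> D" if "walk Q u s" "length s = m * k" for m s
    using that u
  proof (induction m arbitrary: u s)
    case (Suc m)
    have s: "walk Q u (take k s)" "walk Q (tgt Q u (take k s)) (drop k s)"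
      using Suc.prems(1) walk_append[of u "take k s" "drop k s"] by auto
    have "rp (tgt Q u (take k s)) r \<in> D"
      by (rule zero_IT_step2[OF D r Suc.prems(3,4) s(1)]) (use Suc.prems(2) in auto)
    then have "rp (tgt Q (tgt Q u (take k s)) (drop k s)) r \<in> D"
      by (intro Suc.IH[OF s(2)] walk_target[OF s(1)]) (use Suc.prems(2) in auto)
    then show ?case using tgt_append[of Q u "take k s" "drop k s"] by simp
  qed simp
  ultimately show ?thesis by metis
qed

text \<open>Singularity over the rationals makes the determinant of the integer matrix vanish, and
  over an integral domain this already yields an integral kernel vector, as needed for coefficients
  in \<open>K0\<close>.\<close>

lemma adjacency_matrix_kernel:
  assumes vs: "distinct vs" "set vs = verts Q" and inv: "\<not> invertible_mat (adjacency_matrix Q vs)"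
  obtains c w where "push c = (\<lambda>_. 0)" "w \<in> verts Q" "c w \<noteq> 0"
proof -
  define n where "n = length vs"
  let ?e = "\<lambda>i j. card {a \<in> arcs Q. tail Q a = vs ! i \<and> head Q a = vs ! j}"
  define N :: "int mat" where "N = mat n n (\<lambda>(i, j). int (?e i j))"
  let ?M = "adjacency_matrix Q vs"
  have N: "N \<in> carrier_mat n n" by (simp add: N_def)
  have M: "?M \<in> carrier_mat n n" by (simp add: adjacency_matrix_def n_def)
  have MN: "?M = map_mat of_int N" by (rule eq_matI) (auto simp: N_def adjacency_matrix_def n_def)
  have "det ?M = 0"
  proof (rule ccontr)
    assume "det ?M \<noteq> 0"
    then have "?M \<in> Units (ring_mat TYPE(rat) n ())" by (rule det_non_zero_imp_unit[OF M])
    then obtain B where "B \<in> carrier_mat n n" "?M * B = 1\<^sub>m n" "B * ?M = 1\<^sub>m n"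
      by (auto simp: Units_def ring_mat_def)
    then have "invertible_mat ?M" using M by (auto simp: invertible_mat_def inverts_mat_def)
    then show False using inv by simp
  qed
  then have "det N = 0" unfolding MN by simp
  \<comment> \<open>\<open>push\<close> multiplies a row vector from the left, so the kernel of the
    transposed matrix is the relevant one.\<close>
  then have "det (transpose_mat N) = 0" by (simp add: det_transpose[OF N])
  then obtain b where b: "b \<in> carrier_vec n" "b \<noteq> 0\<^sub>v n" "transpose_mat N *\<^sub>v b = 0\<^sub>v n"
    using det_0_iff_vec_prod_zero[of "transpose_mat N" n] N by auto
  define c where "c u = (\<Sum>i<n. if vs ! i = u then b $ i else 0)" for u
  have c: "c (vs ! i) = b $ i" if "i < n" for i
  proof -
    have "c (vs ! i) = (\<Sum>j<n. if i = j then b $ j else 0)"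
      unfolding c_def using vs(1) that by (intro sum.cong) (auto simp: n_def nth_eq_iff_index_eq)
    then show ?thesis using that by simp
  qed
  have "push c u = 0" for u
  proof (cases "u \<in> verts Q")
    case True
    then have "u \<in> set vs" using vs(2) by simp
    then obtain j where j: "j < n" "vs ! j = u" unfolding n_def in_set_conv_nth by blast
    have "push c u = (\<Sum>i<n. \<Sum>a | a \<in> arcs Q \<and> head Q a = u. if vs ! i = tail Q a then b $ i else 0)"
      unfolding push_def c_def by (rule sum.swap)
    also have "\<dots> = (\<Sum>i<n. int (?e i j) * b $ i)"
    proof (rule sum.cong[OF refl])
      fix i
      have "(\<Sum>a | a \<in> arcs Q \<and> head Q a = u. if vs ! i = tail Q a then b $ i else 0)
        = (\<Sum>a\<in>{a \<in> {a \<in> arcs Q. head Q a = u}. vs ! i = tail Q a}. b $ i)"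
        by (rule sum.inter_filter[symmetric]) simp
      also have "{a \<in> {a \<in> arcs Q. head Q a = u}. vs ! i = tail Q a} = {a \<in> arcs Q. tail Q a = vs ! i \<and> head Q a = vs ! j}"
        using j by auto
      finally show "(\<Sum>a | a \<in> arcs Q \<and> head Q a = u. if vs ! i = tail Q a then b $ i else 0) = int (?e i j) * b $ i"
        by simp
    qed
    also have "\<dots> = (transpose_mat N *\<^sub>v b) $ j"
      using j(1) b(1) N by (auto simp: scalar_prod_def N_def atLeast0LessThan intro!: sum.cong)
    also have "\<dots> = 0" using b(3) j(1) by simp
    finally show ?thesis .
  next
    case False
    then show ?thesis using push_pow_outside[of u 1 c] by simp
  qed
  moreover obtain i where "i < n" "b $ i \<noteq> 0" using b(1,2) by (metis carrier_vecD eq_vecI index_zero_vec)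
  moreover from this have "vs ! i \<in> verts Q" using vs(2) by (metis n_def nth_mem)
  ultimately show ?thesis using that[of c "vs ! i"] c by auto
qed

lemma push_sum:
  "(push ^^ e) (\<lambda>u. \<Sum>j\<in>J. a j * f j u) = (\<lambda>u. \<Sum>j\<in>J. a j * (push ^^ e) (f j) u)"
proof (induction e)
  case (Suc e)
  have "push (\<lambda>u. \<Sum>j\<in>J. a j * g j u) = (\<lambda>u. \<Sum>j\<in>J. a j * push (g j) u)" for g
    unfolding push_def by (rule ext, subst sum.swap) (simp add: sum_distrib_left)
  then show ?case using Suc by simp
qed simp

text \<open>Fitting's lemma: \<open>card (verts Q) + 1\<close> of the vectors \<open>push\<^sup>j c\<close> are linearly dependent. The
  power \<open>j = 0\<close> is left out, since \<open>c\<close> need not vanish outside \<open>verts Q\<close>. The matrix is made square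
  by repeating its first row.\<close>

lemma push_stable:
  assumes "verts Q \<noteq> {}"
  shows "\<exists>n. \<forall>t\<ge>n. \<forall>c. (push ^^ Suc t) c = (\<lambda>_. 0) \<longrightarrow> (push ^^ t) c = (\<lambda>_. 0)"
proof -
  obtain vs where vs: "set vs = verts Q" using finite_list finite_verts by metis
  define n where "n = length vs"
  have n: "0 < n" using assms vs by (auto simp: n_def)
  have "(push ^^ t) c = (\<lambda>_. 0)" if t: "Suc n \<le> t" and zero: "(push ^^ Suc t) c = (\<lambda>_. 0)" for t c
  proof -
    define B where "B = mat (Suc n) (Suc n) (\<lambda>(i, j). (push ^^ Suc j) c (vs ! (if i < n then i else 0)))"
    have B: "B \<in> carrier_mat (Suc n) (Suc n)" by (simp add: B_def)
    have "row B n = row B 0" using n by (intro eq_vecI) (auto simp: B_def)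
    then have "det B = 0" using n by (intro det_identical_rows[OF B, of n 0]) auto
    then obtain a where a: "a \<in> carrier_vec (Suc n)" "a \<noteq> 0\<^sub>v (Suc n)" "B *\<^sub>v a = 0\<^sub>v (Suc n)"
      using det_0_iff_vec_prod_zero[OF B] by auto
    have dep: "(\<Sum>j<Suc n. a $ j * (push ^^ Suc j) c u) = 0" for u
    proof (cases "u \<in> verts Q")
      case True
      then obtain i where i: "i < n" "vs ! i = u" using vs by (metis in_set_conv_nth n_def)
      have "(B *\<^sub>v a) $ i = (\<Sum>j<Suc n. (push ^^ Suc j) c u * a $ j)"
        using i a(1) by (auto simp: B_def scalar_prod_def atLeast0LessThan simp del: funpow.simps sum.lessThan_Suc intro!: sum.cong)
      then show ?thesis using a(3) i(1) by (simp add: mult.commute del: funpow.simps sum.lessThan_Suc)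
    next
      case False
      then show ?thesis by (intro sum.neutral) (simp add: push_pow_outside del: funpow.simps)
    qed
    define j where "j = (LEAST j. j < Suc n \<and> a $ j \<noteq> 0)"
    have "\<exists>j. j < Suc n \<and> a $ j \<noteq> 0" using a(1,2) by (metis carrier_vecD eq_vecI index_zero_vec)
    then have j: "j < Suc n \<and> a $ j \<noteq> 0" unfolding j_def by (rule LeastI_ex)
    have below: "a $ i = 0" if "i < j" for i
      using not_less_Least[of i "\<lambda>j. j < Suc n \<and> a $ j \<noteq> 0"] that j unfolding j_def[symmetric] by auto
    have above: "(push ^^ m) c = (\<lambda>_. 0)" if "Suc t \<le> m" for m
    proof -
      have "(push ^^ m) c = (push ^^ (m - Suc t)) ((push ^^ Suc t) c)"
        using that funpow_add[of "m - Suc t" "Suc t" push] by (simp del: funpow.simps)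
      then show ?thesis by (simp only: zero push_zero)
    qed
    \<comment> \<open>This shift moves term \<open>j\<close> of the relation to the power
      \<open>t\<close>; it is an honest difference because \<open>j \<le> n < t\<close>. The terms
      below \<open>j\<close> have coefficient zero, and those above \<open>j\<close> belong to
      powers beyond \<open>t\<close>, which annihilate \<open>c\<close>.\<close>
    let ?e = "t - Suc j"
    have "(\<Sum>i<Suc n. a $ i * (push ^^ (?e + Suc i)) c u) = 0" for u
    proof -
      have "(push ^^ ?e) (\<lambda>u. \<Sum>i<Suc n. a $ i * (push ^^ Suc i) c u) u = 0"
        by (simp only: dep push_zero)
      then show ?thesis unfolding push_sum funpow_add o_def .
    qed
    moreover have "(\<Sum>i<Suc n. a $ i * (push ^^ (?e + Suc i)) c u) = (\<Sum>i<Suc n. if j = i then a $ j * (push ^^ t) c u else 0)" for u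
    proof (rule sum.cong[OF refl])
      fix i assume "i \<in> {..<Suc n}"
      consider "i < j" | "i = j" | "j < i" by linarith
      then show "a $ i * (push ^^ (?e + Suc i)) c u = (if j = i then a $ j * (push ^^ t) c u else 0)"
      proof cases
        case 2
        then have "?e + Suc i = t" using j t by simp
        then show ?thesis using 2 by simp
      next
        case 3
        then have "Suc t \<le> ?e + Suc i" using j t by simp
        then have "(push ^^ (?e + Suc i)) c u = 0" by (simp only: above)
        then show ?thesis using 3 by simp
      qed (simp add: below)
    qed
    ultimately have "a $ j * (push ^^ t) c u = 0" for u using j by (simp del: sum.lessThan_Suc)
    then show ?thesis using j by auto
  qed
  then show ?thesis by blast
qed

text \<open>The assumption \<open>spread\<close> isolates the only step in which the two kinds of
  algebras are treated differently.\<close>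

theorem only_trivial_zero_IT_subcategoriesI:
  assumes sc: "strongly_connected Q"
    and vs: "distinct vs" "set vs = verts Q" "\<not> invertible_mat (adjacency_matrix Q vs)"
    and spread: "\<And>D u w r. \<lbrakk>zero_IT_subcategory A D; 0 < r; r < k; u \<in> verts Q; rp u r \<in> D; w \<in> verts Q\<rbrakk> \<Longrightarrow> rp w r \<in> D"
  shows "only_trivial_zero_IT_subcategories A"
  unfolding only_trivial_zero_IT_subcategories_def
proof (intro allI impI subsetI, rule ccontr)
  fix D M assume D: "zero_IT_subcategory A D" and M: "M \<in> D" "M \<notin> projective_modules A"
  obtain u r where ur: "u \<in> verts Q" "0 < r" "r < k" "rp u r \<in> D" using zero_IT_nonprojective(1)[OF D M] by blast
  have sink: "\<exists>a\<in>arcs Q. tail Q a = u" if "u \<in> verts Q" for u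
    by (rule strongly_connected_no_sink[OF sc zero_IT_nonprojective(2)[OF D M] that])
  obtain c w where c: "push c = (\<lambda>_. 0)" "w \<in> verts Q" "c w \<noteq> 0" by (rule adjacency_matrix_kernel[OF vs])
  obtain n where "\<forall>t\<ge>n. \<forall>c. (push ^^ Suc t) c = (\<lambda>_. 0) \<longrightarrow> (push ^^ t) c = (\<lambda>_. 0)"
    using push_stable ur(1) by blast
  then show False
    using no_zero_IT_subcategory[OF sink ur(2,3) D spread[OF D ur(2,3,1,4)] c] by blast
qed

end

section \<open>The truncated path algebra\<close>

lemma splits_Cons: "{(l, s). l @ s = a # p} = insert ([], a # p) ((\<lambda>(l, s). (a # l, s)) ` {(l, s). l @ s = p})"
  by (auto simp: append_eq_Cons_conv image_iff)

lemma finite_splits: "finite {(l, s). l @ s = p}"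
  by (induction p) (simp_all add: splits_Cons)

text \<open>The link between the recursive form and the double sum that defines multiplication in
  the path algebra.\<close>

lemma splitsum_eq_sum: "splitsum f p = (\<Sum>(l, s)\<in>{(l, s). l @ s = p}. f l s)"
proof (induction p arbitrary: f)
  case Nil
  have "{(l, s). l @ s = []} = {([], [])}" by auto
  then show ?case by simp
next
  case (Cons a p)
  have "inj_on (\<lambda>(l, s). (a # l, s)) {(l, s). l @ s = p}" by (auto simp: inj_on_def)
  then have "(\<Sum>(l, s)\<in>(\<lambda>(l, s). (a # l, s)) ` {(l, s). l @ s = p}. f l s) = (\<Sum>(l, s)\<in>{(l, s). l @ s = p}. f (a # l) s)"
    by (subst sum.reindex) (auto simp: case_prod_beta)
  then show ?case
    unfolding splits_Cons using finite_splits[of p] by (subst sum.insert) (auto simp: Cons)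
qed

section \<open>The path algebra and its arrow ideal in coordinates\<close>

context fin_digraph
begin

abbreviation PA :: "(('a, 'b) qpath \<Rightarrow>\<^sub>0 'k::field) ring" where
  "PA \<equiv> path_algebra G"

lemma PA_simps [simp]: "\<zero>\<^bsub>PA\<^esub> = 0" "f \<oplus>\<^bsub>PA\<^esub> g = f + g"
  by (simp_all add: path_algebra_def)

lemma qpaths_iff: "(u, p) \<in> qpaths G \<longleftrightarrow> walk G u p"
  by (auto simp: qpaths_def awalk_iff_walk)

lemma PA_carrier: "f \<in> carrier PA \<longleftrightarrow> (\<forall>u p. Poly_Mapping.lookup f (u, p) \<noteq> 0 \<longrightarrow> walk G u p)"
proof -
  have "f \<in> carrier PA \<longleftrightarrow> (\<forall>t. Poly_Mapping.lookup f t \<noteq> 0 \<longrightarrow> t \<in> qpaths G)"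
    by (auto simp: path_algebra_def in_keys_iff subset_eq)
  then show ?thesis by (simp add: split_paired_All qpaths_iff)
qed

text \<open>A pair of paths contributes to the coefficient at \<open>(u, p)\<close> only if the
  first starts at \<open>u\<close>, the second starts where the first ends, and their concatenation
  is \<open>p\<close>. Such a pair amounts to a cut of \<open>p\<close>.\<close>

lemma PA_mult:
  assumes "f \<in> carrier PA" "g \<in> carrier PA"
  shows "Poly_Mapping.lookup (f \<otimes>\<^bsub>PA\<^esub> g) (u, p)
    = splitsum (\<lambda>l s. Poly_Mapping.lookup f (u, l) * Poly_Mapping.lookup g (tgt G u l, s)) p"
proof -
  let ?f = "Poly_Mapping.lookup f" and ?g = "Poly_Mapping.lookup g"
  let ?h = "\<lambda>(x, y). if awalk (fst x) (snd x) (fst y) \<and> fst x = u \<and> snd x @ snd y = p then ?f x * ?g y else 0"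
  let ?S = "Poly_Mapping.keys f \<times> Poly_Mapping.keys g" and ?T = "{(l, s). l @ s = p}"
  let ?h' = "\<lambda>(l, s). ?f (u, l) * ?g (tgt G u l, s)"
  have "Poly_Mapping.lookup (f \<otimes>\<^bsub>PA\<^esub> g) (u, p) = (\<Sum>x\<in>Poly_Mapping.keys f. \<Sum>y\<in>Poly_Mapping.keys g. ?h (x, y))"
    unfolding path_algebra_def by (auto simp: lookup_sum case_prod_beta lookup_single when_def intro!: sum.cong)
  also have "\<dots> = sum ?h ?S" by (simp add: sum.cartesian_product)
  \<comment> \<open>Zero terms are discarded on both sides, so that cuts and pairs in the supports
    correspond bijectively.\<close>
  also have "\<dots> = sum ?h {x \<in> ?S. ?h x \<noteq> 0}" by (rule sum.mono_neutral_right) auto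
  also have "\<dots> = sum ?h' {x \<in> ?T. ?h' x \<noteq> 0}"
    by (rule sum.reindex_bij_witness[where i = "\<lambda>(l, s). ((u, l), (tgt G u l, s))" and j = "\<lambda>(x, y). (snd x, snd y)"])
      (use assms in \<open>auto simp: awalk_iff_walk PA_carrier in_keys_iff split: if_splits\<close>)
  also have "\<dots> = sum ?h' ?T" by (rule sum.mono_neutral_left) (auto simp: finite_splits)
  finally show ?thesis by (simp add: splitsum_eq_sum)
qed

lemma PA_one: "Poly_Mapping.lookup \<one>\<^bsub>PA\<^esub> (u, p) = (if u \<in> verts G \<and> p = [] then 1 else 0)"
proof -
  have "Poly_Mapping.lookup \<one>\<^bsub>PA\<^esub> (u, p) = (\<Sum>v\<in>verts G. if u = v then (if p = [] then 1 else 0) else 0)"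
    by (auto simp: path_algebra_def lookup_sum lookup_single when_def intro!: sum.cong)
  also have "\<dots> = (if u \<in> verts G \<and> p = [] then 1 else 0)" by simp
  finally show ?thesis .
qed

lemma PA_add_closed: "f \<in> carrier PA \<Longrightarrow> g \<in> carrier PA \<Longrightarrow> f + g \<in> carrier PA"
  unfolding PA_carrier by (metis add.left_neutral lookup_add)

lemma PA_mult_closed: "f \<in> carrier PA \<Longrightarrow> g \<in> carrier PA \<Longrightarrow> f \<otimes>\<^bsub>PA\<^esub> g \<in> carrier PA"
proof -
  assume fg: "f \<in> carrier PA" "g \<in> carrier PA"
  show ?thesis
    unfolding PA_carrier
  proof (intro allI impI)
    fix u p assume "Poly_Mapping.lookup (f \<otimes>\<^bsub>PA\<^esub> g) (u, p) \<noteq> 0"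
    then obtain l s where "l @ s = p" "Poly_Mapping.lookup f (u, l) * Poly_Mapping.lookup g (tgt G u l, s) \<noteq> 0"
      unfolding PA_mult[OF fg] by (rule splitsum_neq_0E)
    then show "walk G u p" using fg by (auto simp: PA_carrier)
  qed
qed

lemma PA_ring: "ring (PA :: (('a, 'b) qpath \<Rightarrow>\<^sub>0 'k::field) ring)"
proof -
  let ?P = "PA :: (('a, 'b) qpath \<Rightarrow>\<^sub>0 'k) ring"
  have one: "\<one>\<^bsub>?P\<^esub> \<in> carrier ?P" by (auto simp: PA_carrier PA_one split: if_splits)
  have "abelian_group ?P"
  proof (rule abelian_groupI)
    fix f assume "f \<in> carrier ?P"
    then show "\<exists>g\<in>carrier ?P. g \<oplus>\<^bsub>?P\<^esub> f = \<zero>\<^bsub>?P\<^esub>"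
      by (intro bexI[of _ "- f"]) (auto simp: PA_carrier)
  qed (auto simp: PA_add_closed algebra_simps, simp add: PA_carrier)
  moreover have "monoid ?P"
  proof (rule monoidI)
    fix f g h assume f: "f \<in> carrier ?P" and g: "g \<in> carrier ?P" and h: "h \<in> carrier ?P"
    note fg = PA_mult_closed[OF f g] and gh = PA_mult_closed[OF g h]
    show "f \<otimes>\<^bsub>?P\<^esub> g \<otimes>\<^bsub>?P\<^esub> h = f \<otimes>\<^bsub>?P\<^esub> (g \<otimes>\<^bsub>?P\<^esub> h)"
    proof (rule poly_mapping_eqI, clarify)
      fix u p
      let ?t = "\<lambda>m n s. Poly_Mapping.lookup f (u, m) * Poly_Mapping.lookup g (tgt G u m, n) * Poly_Mapping.lookup h (tgt G (tgt G u m) n, s)"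
      have "Poly_Mapping.lookup (f \<otimes>\<^bsub>?P\<^esub> g \<otimes>\<^bsub>?P\<^esub> h) (u, p) = splitsum (\<lambda>l s. splitsum (\<lambda>m n. ?t m n s) l) p"
        unfolding PA_mult[OF fg h] PA_mult[OF f g]
        by (intro splitsum_cong) (auto simp flip: splitsum_mult_right intro!: splitsum_cong)
      also have "\<dots> = splitsum (\<lambda>m s. splitsum (\<lambda>n c. ?t m n c) s) p" by (rule splitsum_assoc)
      also have "\<dots> = Poly_Mapping.lookup (f \<otimes>\<^bsub>?P\<^esub> (g \<otimes>\<^bsub>?P\<^esub> h)) (u, p)"
        unfolding PA_mult[OF f gh] PA_mult[OF g h]
      proof (rule splitsum_cong)
        fix m s
        show "splitsum (\<lambda>n c. ?t m n c) s = Poly_Mapping.lookup f (u, m) * splitsum (\<lambda>l s. Poly_Mapping.lookup g (tgt G u m, l) * Poly_Mapping.lookup h (tgt G (tgt G u m) l, s)) s"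
          by (simp only: mult.assoc splitsum_mult_left[of "Poly_Mapping.lookup f (u, m)"
              "\<lambda>n c. Poly_Mapping.lookup g (tgt G u m, n) * Poly_Mapping.lookup h (tgt G (tgt G u m) n, c)"])
      qed
      finally show "Poly_Mapping.lookup (f \<otimes>\<^bsub>?P\<^esub> g \<otimes>\<^bsub>?P\<^esub> h) (u, p) = Poly_Mapping.lookup (f \<otimes>\<^bsub>?P\<^esub> (g \<otimes>\<^bsub>?P\<^esub> h)) (u, p)" .
    qed
  next
    fix f assume f: "f \<in> carrier ?P"
    show "\<one>\<^bsub>?P\<^esub> \<otimes>\<^bsub>?P\<^esub> f = f"
    proof (rule poly_mapping_eqI, clarify)
      fix u p
      have "u \<in> verts G" if "Poly_Mapping.lookup f (u, p) \<noteq> 0" using f that walk_source by (auto simp: PA_carrier)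
      then show "Poly_Mapping.lookup (\<one>\<^bsub>?P\<^esub> \<otimes>\<^bsub>?P\<^esub> f) (u, p) = Poly_Mapping.lookup f (u, p)"
        unfolding PA_mult[OF one f] PA_one by (subst splitsum_first) auto
    qed
    show "f \<otimes>\<^bsub>?P\<^esub> \<one>\<^bsub>?P\<^esub> = f"
    proof (rule poly_mapping_eqI, clarify)
      fix u p
      have "tgt G u p \<in> verts G" if "Poly_Mapping.lookup f (u, p) \<noteq> 0" using f that walk_target by (auto simp: PA_carrier)
      then show "Poly_Mapping.lookup (f \<otimes>\<^bsub>?P\<^esub> \<one>\<^bsub>?P\<^esub>) (u, p) = Poly_Mapping.lookup f (u, p)"
        unfolding PA_mult[OF f one] PA_one by (subst splitsum_last) auto
    qed
  qed (auto simp: one PA_mult_closed)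
  ultimately show ?thesis
  proof (rule ringI)
    fix f g h assume fgh: "f \<in> carrier ?P" "g \<in> carrier ?P" "h \<in> carrier ?P"
    show "(f \<oplus>\<^bsub>?P\<^esub> g) \<otimes>\<^bsub>?P\<^esub> h = f \<otimes>\<^bsub>?P\<^esub> h \<oplus>\<^bsub>?P\<^esub> g \<otimes>\<^bsub>?P\<^esub> h"
      using fgh by (intro poly_mapping_eqI, clarify)
        (simp add: PA_mult PA_add_closed lookup_add distrib_right splitsum_add)
    show "h \<otimes>\<^bsub>?P\<^esub> (f \<oplus>\<^bsub>?P\<^esub> g) = h \<otimes>\<^bsub>?P\<^esub> f \<oplus>\<^bsub>?P\<^esub> h \<otimes>\<^bsub>?P\<^esub> g"
      using fgh by (intro poly_mapping_eqI, clarify)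
        (simp add: PA_mult PA_add_closed lookup_add distrib_left splitsum_add)
  qed
qed

text \<open>The power \<open>n\<close> of the arrow ideal in coordinates, which
  \<open>ideal_power_eq\<close> confirms.\<close>

definition long_paths :: "nat \<Rightarrow> (('a, 'b) qpath \<Rightarrow>\<^sub>0 'k::field) set" where
  "long_paths n = {f \<in> carrier PA. \<forall>u p. length p < n \<longrightarrow> Poly_Mapping.lookup f (u, p) = 0}"

lemma long_paths_mult:
  assumes "f \<in> long_paths m" "g \<in> long_paths n"
  shows "f \<otimes>\<^bsub>PA\<^esub> g \<in> long_paths (m + n)"
proof -
  have fg: "f \<in> carrier PA" "g \<in> carrier PA" using assms by (auto simp: long_paths_def)
  have "Poly_Mapping.lookup (f \<otimes>\<^bsub>PA\<^esub> g) (u, p) = 0" if p: "length p < m + n" for u p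
    unfolding PA_mult[OF fg]
  proof (rule splitsum_eq_0)
    fix l s assume "l @ s = p"
    then have "length l < m \<or> length s < n" using p by auto
    then show "Poly_Mapping.lookup f (u, l) * Poly_Mapping.lookup g (tgt G u l, s) = 0"
      using assms by (auto simp: long_paths_def)
  qed
  then show ?thesis using PA_mult_closed[OF fg] by (simp add: long_paths_def)
qed

lemma long_paths_0: "long_paths 0 = carrier PA"
  by (simp add: long_paths_def)

lemma long_paths_ideal: "ideal (long_paths n) (PA :: (('a, 'b) qpath \<Rightarrow>\<^sub>0 'k::field) ring)"
proof (rule idealI[OF PA_ring])
  interpret P: ring "PA :: (('a, 'b) qpath \<Rightarrow>\<^sub>0 'k) ring" by (rule PA_ring)
  have m: "- f \<in> long_paths n" if "f \<in> long_paths n" for f :: "('a, 'b) qpath \<Rightarrow>\<^sub>0 'k"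
    using that by (auto simp: long_paths_def PA_carrier)
  have inv: "\<ominus>\<^bsub>PA\<^esub> f = - f" if "f \<in> long_paths n" for f :: "('a, 'b) qpath \<Rightarrow>\<^sub>0 'k"
    using that m[OF that] by (intro P.minus_equality) (auto simp: long_paths_def)
  show "subgroup (long_paths n) (add_monoid (PA :: (('a, 'b) qpath \<Rightarrow>\<^sub>0 'k) ring))"
  proof (rule P.add.subgroupI)
    show "long_paths n \<subseteq> carrier (PA :: (('a, 'b) qpath \<Rightarrow>\<^sub>0 'k) ring)" by (auto simp: long_paths_def)
    have "(0 :: ('a, 'b) qpath \<Rightarrow>\<^sub>0 'k) \<in> long_paths n" by (auto simp: long_paths_def PA_carrier)
    then show "long_paths n \<noteq> ({} :: (('a, 'b) qpath \<Rightarrow>\<^sub>0 'k) set)" by blast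
    fix f g :: "('a, 'b) qpath \<Rightarrow>\<^sub>0 'k" assume f: "f \<in> long_paths n"
    show "\<ominus>\<^bsub>PA\<^esub> f \<in> long_paths n" using m[OF f] inv[OF f] by simp
    assume "g \<in> long_paths n"
    then show "f \<oplus>\<^bsub>PA\<^esub> g \<in> long_paths n" using f PA_add_closed by (auto simp: long_paths_def lookup_add)
  qed
  show "x \<otimes>\<^bsub>PA\<^esub> a \<in> long_paths n" "a \<otimes>\<^bsub>PA\<^esub> x \<in> long_paths n"
    if "a \<in> long_paths n" "x \<in> carrier PA" for a x :: "('a, 'b) qpath \<Rightarrow>\<^sub>0 'k"
    using long_paths_mult[of x 0 a n] long_paths_mult[of a n x 0] that by (simp_all add: long_paths_0)
qed

lemma single_mult:
  assumes "walk G u p" "walk G (tgt G u p) q"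
  shows "Poly_Mapping.single (u, p) c \<otimes>\<^bsub>PA\<^esub> Poly_Mapping.single (tgt G u p, q) d = Poly_Mapping.single (u, p @ q) (c * d)"
proof -
  have "awalk u p (tgt G u p)" using assms(1) by (simp add: awalk_iff_walk)
  then show ?thesis by (cases "c = 0"; cases "d = 0") (simp_all add: path_algebra_def)
qed

lemma single_closed: "walk G u p \<Longrightarrow> Poly_Mapping.single (u, p) c \<in> carrier PA"
  by (auto simp: PA_carrier lookup_single when_def split: if_splits)

lemma single_long_paths:
  assumes "walk G u p" "n \<le> length p"
  shows "Poly_Mapping.single (u, p) c \<in> long_paths n"
  using single_closed[OF assms(1), of c] assms(2) by (auto simp: long_paths_def lookup_single when_def)

text \<open>An element is the finite sum of its terms, so membership in an additively closed set is
  checked on the paths of its support.\<close>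

lemma sum_single_induct:
  fixes f :: "('a, 'b) qpath \<Rightarrow>\<^sub>0 'k::field"
  assumes "0 \<in> S" "\<And>f g. f \<in> S \<Longrightarrow> g \<in> S \<Longrightarrow> f + g \<in> S"
    and "\<And>u p c. Poly_Mapping.lookup f (u, p) \<noteq> 0 \<Longrightarrow> Poly_Mapping.single (u, p) c \<in> S"
  shows "f \<in> S"
proof -
  have f: "f = (\<Sum>t\<in>Poly_Mapping.keys f. Poly_Mapping.single t (Poly_Mapping.lookup f t))"
  proof (rule poly_mapping_eqI)
    fix t
    have "Poly_Mapping.lookup (\<Sum>t\<in>Poly_Mapping.keys f. Poly_Mapping.single t (Poly_Mapping.lookup f t)) t
      = (\<Sum>s\<in>Poly_Mapping.keys f. if t = s then Poly_Mapping.lookup f s else 0)"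
      by (auto simp: lookup_sum lookup_single when_def intro!: sum.cong)
    then show "Poly_Mapping.lookup f t = Poly_Mapping.lookup (\<Sum>t\<in>Poly_Mapping.keys f. Poly_Mapping.single t (Poly_Mapping.lookup f t)) t"
      by (simp add: in_keys_iff)
  qed
  have "(\<Sum>t\<in>T. Poly_Mapping.single t (Poly_Mapping.lookup f t)) \<in> S" if "finite T" "T \<subseteq> Poly_Mapping.keys f" for T
    using that
  proof (induction T)
    case (insert t T)
    then have "Poly_Mapping.single t (Poly_Mapping.lookup f t) \<in> S"
      by (cases t) (auto intro!: assms(3) simp: in_keys_iff)
    then show ?case using insert assms(2) by auto
  qed (simp add: assms(1))
  from this[of "Poly_Mapping.keys f"] show ?thesis using f by simp
qed

text \<open>A nontrivial path is its first arrow times the remaining path; a scalar is supplied by a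
  multiple of the trivial path at its source.\<close>

lemma arrow_ideal_eq: "arrow_ideal G = (long_paths 1 :: (('a, 'b) qpath \<Rightarrow>\<^sub>0 'k::field) set)"
proof -
  let ?P = "PA :: (('a, 'b) qpath \<Rightarrow>\<^sub>0 'k) ring"
  interpret P: ring ?P by (rule PA_ring)
  let ?ar = "(\<lambda>a. Poly_Mapping.single (tail G a, [a]) (1 :: 'k)) ` arcs G"
  have ar: "?ar \<subseteq> long_paths 1"
    by (auto simp: long_paths_def lookup_single when_def intro!: single_closed)
  have "long_paths 1 \<subseteq> J" if J: "ideal J ?P" "?ar \<subseteq> J" for J
  proof
    interpret J: ideal J ?P by (rule J(1))
    fix f :: "('a, 'b) qpath \<Rightarrow>\<^sub>0 'k" assume f: "f \<in> long_paths 1"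
    show "f \<in> J"
    proof (rule sum_single_induct)
      show "0 \<in> J" using J.zero_closed by simp
      show "g + h \<in> J" if "g \<in> J" "h \<in> J" for g h using J.a_closed[OF that] by simp
      fix u p and c :: 'k assume ne: "Poly_Mapping.lookup f (u, p) \<noteq> 0"
      then have "walk G u p" "p \<noteq> []" using f by (auto simp: long_paths_def PA_carrier)
      then obtain a q where p: "p = a # q" and w: "a \<in> arcs G" "tail G a = u" "walk G (head G a) q" by (cases p) auto
      have u: "u \<in> verts G" using w by auto
      have "Poly_Mapping.single (u, [a]) 1 \<in> J" using J(2) w by auto
      then have "Poly_Mapping.single (u, []) c \<otimes>\<^bsub>?P\<^esub> (Poly_Mapping.single (u, [a]) 1 \<otimes>\<^bsub>?P\<^esub> Poly_Mapping.single (head G a, q) 1) \<in> J"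
        using w u by (intro J.I_l_closed J.I_r_closed single_closed) auto
      also have "Poly_Mapping.single (u, [a]) 1 \<otimes>\<^bsub>?P\<^esub> Poly_Mapping.single (head G a, q) 1 = Poly_Mapping.single (u, a # q) 1"
        using single_mult[of u "[a]" q 1 1] w by simp
      also have "Poly_Mapping.single (u, []) c \<otimes>\<^bsub>?P\<^esub> Poly_Mapping.single (u, a # q) 1 = Poly_Mapping.single (u, p) c"
        using single_mult[of u "[]" "a # q" c 1] w u p by simp
      finally show "Poly_Mapping.single (u, p) c \<in> J" .
    qed
  qed
  moreover have "genideal ?P ?ar \<subseteq> long_paths 1"
    by (rule P.genideal_minimal[OF long_paths_ideal ar])
  ultimately show ?thesis unfolding arrow_ideal_def genideal_def by blast
qed

text \<open>A path of length at least \<open>n + 1\<close> is a path of length at least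
  \<open>n\<close> times its last arrow. Conversely, lengths add up in products.\<close>

lemma ideal_power_eq: "ideal_power PA (arrow_ideal G) n = (long_paths n :: (('a, 'b) qpath \<Rightarrow>\<^sub>0 'k::field) set)"
proof (induction n)
  case 0
  then show ?case by (simp add: long_paths_0)
next
  case (Suc n)
  let ?P = "PA :: (('a, 'b) qpath \<Rightarrow>\<^sub>0 'k) ring"
  let ?I = "ideal_prod ?P (long_paths n) (long_paths 1)"
  interpret L: ideal "long_paths (Suc n)" ?P by (rule long_paths_ideal)
  have "f \<in> long_paths (Suc n)" if "f \<in> ?I" for f
    using that
  proof (induction rule: ideal_prod.induct)
    case (prod i j)
    then show ?case using long_paths_mult[of i n j 1] by simp
  next
    case (sum s1 s2)
    show ?case by (rule additive_subgroup.a_closed[OF L.additive_subgroup_axioms sum(3,4)])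
  qed
  moreover have "f \<in> ?I" if f: "f \<in> long_paths (Suc n)" for f
  proof (rule sum_single_induct)
    have z: "(0 :: ('a, 'b) qpath \<Rightarrow>\<^sub>0 'k) \<in> long_paths m" for m by (auto simp: long_paths_def PA_carrier)
    have "0 \<otimes>\<^bsub>?P\<^esub> 0 = 0" by (simp add: path_algebra_def)
    moreover have "0 \<otimes>\<^bsub>?P\<^esub> 0 \<in> ?I" by (rule ideal_prod.prod[OF z z])
    ultimately show "0 \<in> ?I" by simp
    show "g + h \<in> ?I" if "g \<in> ?I" "h \<in> ?I" for g h using ideal_prod.sum[OF that] by simp
    fix u p and c :: 'k assume ne: "Poly_Mapping.lookup f (u, p) \<noteq> 0"
    then have p: "walk G u p" "Suc n \<le> length p" using f by (auto simp: long_paths_def PA_carrier not_less_eq_eq[symmetric] not_less)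
    then obtain q a where qa: "p = q @ [a]" by (cases p rule: rev_cases) auto
    then have w: "walk G u q" "walk G (tgt G u q) [a]" "n \<le> length q" using p by auto
    have "Poly_Mapping.single (u, q) c \<in> long_paths n" "Poly_Mapping.single (tgt G u q, [a]) 1 \<in> long_paths 1"
      using w by (auto intro!: single_long_paths)
    then have "Poly_Mapping.single (u, q) c \<otimes>\<^bsub>?P\<^esub> Poly_Mapping.single (tgt G u q, [a]) 1 \<in> ?I"
      by (rule ideal_prod.prod)
    then show "Poly_Mapping.single (u, p) c \<in> ?I" using single_mult[OF w(1,2), of c 1] qa by simp
  qed
  ultimately show ?case using Suc by (auto simp: arrow_ideal_eq)
qed

text \<open>Any representative of a coset may be chosen: two of them differ by an element without
  terms of length below \<open>k\<close>, and longer paths are cut off.\<close>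

definition tcoef :: "nat \<Rightarrow> (('a, 'b) qpath \<Rightarrow>\<^sub>0 'k::field) set \<Rightarrow> 'a \<times> 'b list \<Rightarrow> 'k" where
  "tcoef k X = (\<lambda>(u, p). if length p < k then Poly_Mapping.lookup (SOME f. f \<in> X) (u, p) else 0)"

lemma tcoef_coset:
  assumes "f \<in> carrier PA"
  shows "tcoef k (long_paths k +>\<^bsub>PA\<^esub> f) (u, p) = (if length p < k then Poly_Mapping.lookup f (u, p) else 0)"
proof -
  have "0 + f \<in> long_paths k +>\<^bsub>PA\<^esub> f" unfolding a_r_coset_def' by (auto simp: long_paths_def PA_carrier)
  then have "(SOME g. g \<in> long_paths k +>\<^bsub>PA\<^esub> f) \<in> long_paths k +>\<^bsub>PA\<^esub> f" by (rule someI)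
  then obtain h where "h \<in> long_paths k" "(SOME g. g \<in> long_paths k +>\<^bsub>PA\<^esub> f) = h + f" unfolding a_r_coset_def' by auto
  then show ?thesis by (auto simp: tcoef_def long_paths_def lookup_add)
qed

lemma truncated_path_algebra_trunc_alg:
  assumes "0 < k"
  shows "trunc_alg G (truncated_path_algebra G k :: (('a, 'b) qpath \<Rightarrow>\<^sub>0 'k::field) set ring) k (tcoef k)"
proof -
  let ?P = "PA :: (('a, 'b) qpath \<Rightarrow>\<^sub>0 'k) ring"
  let ?A = "truncated_path_algebra G k :: (('a, 'b) qpath \<Rightarrow>\<^sub>0 'k) set ring"
  let ?\<pi> = "\<lambda>f. long_paths k +>\<^bsub>?P\<^esub> f"
  interpret P: ring ?P by (rule PA_ring)
  interpret I: ideal "long_paths k" ?P by (rule long_paths_ideal)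
  have A: "?A = ?P Quot long_paths k" by (simp add: truncated_path_algebra_def ideal_power_eq)
  have car: "carrier ?A = ?\<pi> ` carrier ?P" unfolding A FactRing_def A_RCOSETS_def' by auto
  have hom: "?\<pi> \<in> Ring.ring_hom ?P ?A" unfolding A by (rule I.rcos_ring_hom)
  have tc: "tcoef k (?\<pi> f) (u, p) = (if length p < k then Poly_Mapping.lookup f (u, p) else 0)" if "f \<in> carrier ?P" for f u p
    by (rule tcoef_coset[OF that])
  have ringA: "ring ?A" unfolding A by (rule I.quotient_is_ring)
  have inj: "?\<pi> f = ?\<pi> g" if fg: "f \<in> carrier ?P" "g \<in> carrier ?P" and eq: "tcoef k (?\<pi> f) = tcoef k (?\<pi> g)" for f g
  proof -
    have "Poly_Mapping.lookup f (u, p) = Poly_Mapping.lookup g (u, p)" if "length p < k" for u p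
      using fun_cong[OF eq, of "(u, p)"] tc[OF fg(1), of u p] tc[OF fg(2), of u p] that by simp
    moreover have m: "f \<ominus>\<^bsub>?P\<^esub> g = f - g"
    proof -
      have "- g \<in> carrier ?P" using fg(2) by (simp add: PA_carrier)
      then have "\<ominus>\<^bsub>?P\<^esub> g = - g" using fg(2) by (intro P.minus_equality) auto
      then show ?thesis by (simp add: a_minus_def)
    qed
    ultimately have "f \<ominus>\<^bsub>?P\<^esub> g \<in> long_paths k"
      using P.minus_closed[OF fg] unfolding long_paths_def m by (simp add: lookup_minus)
    then show ?thesis using P.quotient_eq_iff_same_a_r_cos[OF long_paths_ideal fg] by simp
  qed
  show ?thesis
  proof (intro trunc_alg.intro trunc_alg_axioms.intro ringA)
    show "fin_digraph G" by unfold_locales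
    show "0 < k" by fact
    show "bij_betw (tcoef k) (carrier ?A) {c. \<forall>u p. c (u, p) \<noteq> 0 \<longrightarrow> walk G u p \<and> length p < k}"
      unfolding bij_betw_def
    proof (intro conjI equalityI subsetI)
      show "inj_on (tcoef k) (carrier ?A)" using inj unfolding car by (auto simp: inj_on_def)
    next
      fix c :: "'a \<times> 'b list \<Rightarrow> 'k" assume "c \<in> tcoef k ` carrier ?A"
      then obtain f where "f \<in> carrier ?P" "c = tcoef k (?\<pi> f)" unfolding car by auto
      then show "c \<in> {c. \<forall>u p. c (u, p) \<noteq> 0 \<longrightarrow> walk G u p \<and> length p < k}" using tc by (auto simp: PA_carrier)
    next
      fix c :: "'a \<times> 'b list \<Rightarrow> 'k" assume c: "c \<in> {c. \<forall>u p. c (u, p) \<noteq> 0 \<longrightarrow> walk G u p \<and> length p < k}"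
      \<comment> \<open>A finite quiver has finitely many walks shorter than \<open>k\<close>, so
        every function supported on them is an element of the path algebra.\<close>
      have "{t. c t \<noteq> 0} \<subseteq> (\<Union>u\<in>verts G. Pair u ` {p. walk G u p \<and> length p < k})"
        using c walk_source by force
      then have fin: "finite {t. c t \<noteq> 0}" by (rule finite_subset) (auto intro: finite_walks)
      define f where "f = Abs_poly_mapping c"
      have l: "Poly_Mapping.lookup f = c" unfolding f_def by (rule lookup_Abs_poly_mapping[OF fin])
      have f: "f \<in> carrier ?P" using c by (auto simp: PA_carrier l)
      have "tcoef k (?\<pi> f) (u, p) = c (u, p)" for u p using tc[OF f, of u p] c by (auto simp: l)
      then have "c = tcoef k (?\<pi> f)" by (auto simp: fun_eq_iff)
      then show "c \<in> tcoef k ` carrier ?A" unfolding car using f by blast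
    qed
  next
    fix a b assume "a \<in> carrier ?A" "b \<in> carrier ?A"
    then obtain f g where fg: "f \<in> carrier ?P" "g \<in> carrier ?P" and a: "a = ?\<pi> f" and b: "b = ?\<pi> g"
      unfolding car by blast
    have add: "a \<oplus>\<^bsub>?A\<^esub> b = ?\<pi> (f + g)" unfolding a b using ring_hom_add[OF hom fg] by simp
    have mult: "a \<otimes>\<^bsub>?A\<^esub> b = ?\<pi> (f \<otimes>\<^bsub>?P\<^esub> g)" unfolding a b using ring_hom_mult[OF hom fg] by simp
    show "tcoef k (a \<oplus>\<^bsub>?A\<^esub> b) t = tcoef k a t + tcoef k b t" for t
      unfolding add by (cases t) (simp add: a b tc PA_add_closed[OF fg] fg lookup_add)
    fix u and p :: "'b list" assume p: "length p < k"
    show "tcoef k (a \<otimes>\<^bsub>?A\<^esub> b) (u, p) = splitsum (\<lambda>l s. tcoef k a (u, l) * tcoef k b (tgt G u l, s)) p"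
      unfolding mult tc[OF PA_mult_closed[OF fg]] PA_mult[OF fg] if_P[OF p]
    proof (rule splitsum_cong)
      fix l s assume "l @ s = p"
      then have "length l < k" "length s < k" using p by auto
      then show "Poly_Mapping.lookup f (u, l) * Poly_Mapping.lookup g (tgt G u l, s) = tcoef k a (u, l) * tcoef k b (tgt G u l, s)"
        by (simp add: a b tc fg)
    qed
  next
    show "tcoef k \<one>\<^bsub>?A\<^esub> (u, p) = (if u \<in> verts G \<and> p = [] then 1 else 0)" for u p
      using ring_hom_one[OF hom] tc[of "\<one>\<^bsub>?P\<^esub>" u p] assms by (auto simp: PA_one)
  qed
qed

end

theorem proposition5p4:
  fixes Q :: "('v, 'e) pre_digraph" and vs :: "'v list"
  assumes "fin_digraph Q" and "distinct vs" and "set vs = verts Q"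
  shows "(let A = (truncated_path_algebra Q 2 :: (('v, 'e) qpath \<Rightarrow>\<^sub>0 'k::field) set ring) in
        \<not> selfinjective A \<and> strongly_connected Q \<and> \<not> invertible_mat (adjacency_matrix Q vs)
          \<longrightarrow> only_trivial_zero_IT_subcategories A) \<and>
     (\<forall>k\<ge>2. let A = (truncated_path_algebra Q k :: (('v, 'e) qpath \<Rightarrow>\<^sub>0 'k) set ring) in
        strongly_connected Q \<and> (\<exists>a\<in>arcs Q. tail Q a = head Q a) \<and>
          \<not> invertible_mat (adjacency_matrix Q vs)
          \<longrightarrow> only_trivial_zero_IT_subcategories A)"
  unfolding Let_def
proof (intro conjI allI impI; elim conjE)
  assume sc: "strongly_connected Q" and inv: "\<not> invertible_mat (adjacency_matrix Q vs)"
  interpret trunc_alg Q "truncated_path_algebra Q 2 :: (('v, 'e) qpath \<Rightarrow>\<^sub>0 'k) set ring" 2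
    "fin_digraph.tcoef 2"
    by (rule fin_digraph.truncated_path_algebra_trunc_alg[OF assms(1)]) simp
  show "only_trivial_zero_IT_subcategories (truncated_path_algebra Q 2 :: (('v, 'e) qpath \<Rightarrow>\<^sub>0 'k) set ring)"
  proof (rule only_trivial_zero_IT_subcategoriesI[OF sc assms(2,3) inv])
    fix D u w and r :: nat
    assume *: "zero_IT_subcategory (truncated_path_algebra Q 2 :: (('v, 'e) qpath \<Rightarrow>\<^sub>0 'k) set ring) D"
      "0 < r" "r < 2" "u \<in> verts Q" "rp u r \<in> D" "w \<in> verts Q"
    then have r: "r = 1" by simp
    show "rp w r \<in> D" unfolding r by (rule zero_IT_spread_arrow[OF *(1) sc refl *(4) *(5)[unfolded r] *(6)])
  qed
next
  fix k :: nat
  assume "2 \<le> k" and sc: "strongly_connected Q" and loop: "\<exists>a\<in>arcs Q. tail Q a = head Q a"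
    and inv: "\<not> invertible_mat (adjacency_matrix Q vs)"
  then interpret trunc_alg Q "truncated_path_algebra Q k :: (('v, 'e) qpath \<Rightarrow>\<^sub>0 'k) set ring" k
    "fin_digraph.tcoef k"
    by (intro fin_digraph.truncated_path_algebra_trunc_alg[OF assms(1)]) simp
  show "only_trivial_zero_IT_subcategories (truncated_path_algebra Q k :: (('v, 'e) qpath \<Rightarrow>\<^sub>0 'k) set ring)"
  proof (rule only_trivial_zero_IT_subcategoriesI[OF sc assms(2,3) inv])
    fix D u w and r :: nat
    assume *: "zero_IT_subcategory (truncated_path_algebra Q k :: (('v, 'e) qpath \<Rightarrow>\<^sub>0 'k) set ring) D"
      "0 < r" "r < k" "u \<in> verts Q" "rp u r \<in> D" "w \<in> verts Q"
    obtain a where "a \<in> arcs Q" "tail Q a = head Q a" using loop by blast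
    then show "rp w r \<in> D" by (rule zero_IT_spread_loop[OF *(1) sc _ _ *(2-6)])
  qed
qed

end
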